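(* There is a universal constant $c>0$ such that the following holds for all $N,n,d\in\mathbb{N}$ and all real $h\geq 0$. Let $X=(X_1,\dots,X_N)$ and let $f_0,f_1,\dots,f_n\in\mathbb{Z}[X]$ be polynomials of degree at most $d$ and of height at most $h$. If $f_0\in(f_1,\dots,f_n)\mathbb{Z}[X]$, then $$f_0=g_1f_1+\cdots+g_nf_n$$ for certain polynomials $g_1,\dots,g_n\in\mathbb{Z}[X]$ of degree at most $$(2d)^{2^{cN^2}}(h+1).$$
   Context: Here $\mathbb{N}=\{0,1,2,\dots\}$. Degree means total degree, with $\deg(0)=-\infty$. The height $h(f)$ of a polynomial $f\in\mathbb{Z}[X]$ is the maximum of $\log|a|$ where $a$ ranges over the non-zero coefficients of $f$, with $h(0):=0$. (The paper writes the bound as $(2d)^{2^{O(N^2)}}(h+1)$; the constant hidden in the $O$-notation is universal.) *)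

theory Defs
  imports
    "HOL-Analysis.Analysis"
    "HOL-Library.Poly_Mapping"
    "HOL-Algebra.Ideal"
begin

(* A monomial is its exponent vector, a finitely supported map from variable indices to
   exponents; a polynomial is a finitely supported map from monomials to coefficients, with
   the convolution product of Poly_Mapping. *)

type_synonym monomial = "nat \<Rightarrow>\<^sub>0 nat"
type_synonym int_mpoly = "monomial \<Rightarrow>\<^sub>0 int"

(* The variables X_1, ..., X_N have the indices 0, ..., N - 1. *)

definition int_mpoly_ring :: "nat \<Rightarrow> int_mpoly ring" where
  "int_mpoly_ring N =
    \<lparr>carrier = {p. \<forall>m \<in> Poly_Mapping.keys p. Poly_Mapping.keys m \<subseteq> {..<N}},
     mult = (*), one = 1, zero = 0, add = (+)\<rparr>"

definition monomial_degree :: "monomial \<Rightarrow> nat" where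
  "monomial_degree m = (\<Sum>i \<in> Poly_Mapping.keys m. Poly_Mapping.lookup m i)"

definition total_degree :: "int_mpoly \<Rightarrow> ereal" where
  "total_degree p =
    (if p = 0 then -\<infinity>
     else ereal (real (Max (monomial_degree ` Poly_Mapping.keys p))))"

definition height :: "int_mpoly \<Rightarrow> real" where
  "height p =
    (if p = 0 then 0
     else Max ((\<lambda>m. ln \<bar>real_of_int (Poly_Mapping.lookup p m)\<bar>) ` Poly_Mapping.keys p))"

lemma int_mpoly_ring_simps:
  "carrier (int_mpoly_ring N) = {p. \<forall>m \<in> Poly_Mapping.keys p. Poly_Mapping.keys m \<subseteq> {..<N}}"
  "mult (int_mpoly_ring N) = (*)" "one (int_mpoly_ring N) = 1"
  "zero (int_mpoly_ring N) = 0" "add (int_mpoly_ring N) = (+)"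
  by (simp_all add: int_mpoly_ring_def)

lemma cring_int_mpoly_ring: "cring (int_mpoly_ring N)"
proof (rule cringI)
  let ?C = "{p :: int_mpoly. \<forall>m \<in> Poly_Mapping.keys p. Poly_Mapping.keys m \<subseteq> {..<N}}"
  have add: "p + q \<in> ?C" if "p \<in> ?C" "q \<in> ?C" for p q
    using that Poly_Mapping.keys_add[of p q] by blast
  have mult: "p * q \<in> ?C" if "p \<in> ?C" "q \<in> ?C" for p q
  proof -
    have "Poly_Mapping.keys m \<subseteq> {..<N}" if m: "m \<in> Poly_Mapping.keys (p * q)" for m
    proof -
      obtain a b where "a \<in> Poly_Mapping.keys p" "b \<in> Poly_Mapping.keys q" "m = a + b"
        using m keys_mult[of p q] by blast
      then show ?thesis
        using \<open>p \<in> ?C\<close> \<open>q \<in> ?C\<close> Poly_Mapping.keys_add[of a b] by blast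
    qed
    then show ?thesis by blast
  qed
  have neg: "- p \<in> ?C" if "p \<in> ?C" for p
    using that by simp
  have zero: "0 \<in> ?C" and one: "1 \<in> ?C"
    by simp_all
  show "abelian_group (int_mpoly_ring N)"
  proof (rule abelian_groupI, unfold int_mpoly_ring_simps)
    fix p assume "p \<in> ?C"
    then show "\<exists>q \<in> ?C. q + p = 0"
      by (intro bexI[of _ "- p"] neg) simp_all
  qed (fact add zero | rule add.assoc add.commute add_0_left)+
  show "Group.comm_monoid (int_mpoly_ring N)"
    by (rule comm_monoidI, unfold int_mpoly_ring_simps)
      (erule (1) mult | fact one | rule mult.assoc mult.commute mult_1_left)+
qed (unfold int_mpoly_ring_simps, rule distrib_right)

end

theory Submission
  imports Defs "Jordan_Normal_Form.Determinant"
begin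

text \<open>
  Write \<open>f\<^sub>0 = \<Sum> y\<^sub>j f\<^sub>j\<close>.  Over \<open>\<rat>\<close> there is a solution of bounded degree, so by Cramer's rule
  \<open>\<delta> f\<^sub>0 = \<Sum> w\<^sub>j f\<^sub>j\<close> with \<open>w\<^sub>j\<close> of bounded degree and \<open>log \<delta>\<close> linear in the height.  If a prime \<open>p\<close>
  divides \<open>\<delta>\<close>, then \<open>w - \<delta> y\<close> is a syzygy of \<open>(f\<^sub>j)\<close> congruent to \<open>w\<close> modulo \<open>p\<close>.  Such a \<open>w\<close> is congruent
  modulo \<open>p\<close> to a syzygy \<open>z\<close> of degree at most \<open>deg w + b\<close>, where \<open>b\<close> depends only on \<open>N\<close> and \<open>d\<close>;
  replace \<open>w\<close> by \<open>(w - z) / p\<close> and \<open>\<delta>\<close> by \<open>\<delta> / p\<close>.  As \<open>\<delta>\<close> has at most \<open>log\<^sub>2 \<delta>\<close> prime factors, the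
  denominator disappears at a cost in degree that is linear in \<open>log \<delta>\<close>.

  The key is thus the existence of \<open>z\<close> (\<open>bounded_lift\<close>), for the kernel of an arbitrary matrix and by
  induction on the number of variables.  Maximal minors of least divisibility by \<open>p\<close> produce, by
  Cramer's rule, kernel vectors with a common entry \<open>\<Delta>\<close> not divisible by \<open>p\<close>.  After a generic linear
  change of coordinates, \<open>p\<close>-adic Weierstrass division by \<open>\<Delta>\<close> bounds the degree in one variable, and
  the coefficients with respect to that variable satisfy a linear system in one variable fewer.
  Membership over \<open>\<rat>\<close> with bounded degrees is an instance of the same lemma, for the prime
  element \<open>T\<close> of \<open>\<int>[T]\<close>.
\<close>

text \<open>The residue field of a prime number is finite, so a polynomial may fail to become
  regular under every integral linear change of coordinates. Hence the infinitely many variables: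
  all but the first \<open>N\<close> are scalars of degree 0, and each change of coordinates takes
  fresh ones as slopes. The leading coefficients that arise are prime to \<pi> but not invertible;
  they are multiplied through instead of divided by. A lift is therefore congruent to
  \<open>c * w\<close>, not to \<open>w\<close>, for a scalar polynomial \<open>c\<close> that \<pi>
  does not divide. Extracting one coefficient with respect to the extra variables turns
  \<open>c\<close> into a number, which is inverted modulo \<open>p\<close>, or becomes the
  denominator when the prime is \<open>T\<close>. Weierstrass division is carried out modulo a power
  of \<pi>, so the induction must accept vectors that lie in the kernel only modulo such a power.
  The degree bound depends on the number of equations, not of unknowns. Passing to one variable
  fewer replaces \<open>m\<close> equations by \<open>m * (m * d + d)\<close>, roughly a squaring;
  this is the source of the double exponential in \<open>N\<close>.\<close>

hide_const (open) Module.smult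

section \<open>Filtrations and maximal minors\<close>

text \<open>\<open>F n x\<close> reads: \<open>x\<close> has degree at most \<open>n\<close>. The
  abstraction lets the same estimates serve for total degree relative to scalars, for polynomials
  over a filtered ring, for polynomials in finitely many variables and, with the trivial filtration,
  where no degree is tracked.\<close>

locale ring_filtration =
  fixes F :: "nat \<Rightarrow> 'a::comm_ring_1 \<Rightarrow> bool"
  assumes filt_zero: "F n 0"
    and filt_one: "F 0 1"
    and filt_add: "F n x \<Longrightarrow> F n y \<Longrightarrow> F n (x + y)"
    and filt_uminus: "F n x \<Longrightarrow> F n (- x)"
    and filt_mult: "F a x \<Longrightarrow> F b y \<Longrightarrow> F (a + b) (x * y)"
    and filt_mono: "F a x \<Longrightarrow> a \<le> b \<Longrightarrow> F b x"
begin

lemma filt_diff: "F n x \<Longrightarrow> F n y \<Longrightarrow> F n (x - y)"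
  using filt_add[of n x "- y"] filt_uminus by simp

lemma filt_sum: "(\<And>i. i \<in> I \<Longrightarrow> F n (f i)) \<Longrightarrow> F n (sum f I)"
  by (induction I rule: infinite_finite_induct) (auto simp: filt_zero filt_add)

lemma filt_prod: "(\<And>i. i \<in> I \<Longrightarrow> F (e i) (f i)) \<Longrightarrow> F (sum e I) (prod f I)"
  by (induction I rule: infinite_finite_induct) (auto simp: filt_one filt_mult)

lemma filt_power: "F a x \<Longrightarrow> F (a * k) (x ^ k)"
  by (induction k) (auto simp: filt_one dest: filt_mult)

lemma filt_one': "F n 1"
  using filt_mono[OF filt_one] by simp

lemma filt_sign: "F a x \<Longrightarrow> F a ((- 1) ^ k * x)"
  by (cases "even k") (auto simp: filt_uminus)

end

text \<open>Index lists rather than sets: rows and columns may come in any order or be repeated, so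
  that exchanging a column is a list operation and degenerate choices simply give 0.\<close>

definition minor :: "(nat \<Rightarrow> nat \<Rightarrow> 'a::comm_ring_1) \<Rightarrow> nat list \<Rightarrow> nat list \<Rightarrow> 'a" where
  "minor A is js =
    Determinant.det (Matrix.mat (length is) (length js) (\<lambda>(a, b). A (is ! a) (js ! b)))"

lemma minor_Nil [simp]: "minor A [] [] = 1"
  unfolding minor_def by (rule det_dim_zero) simp

lemma nth_remove: "b < length xs \<Longrightarrow> c < length xs - 1 \<Longrightarrow>
  (take b xs @ drop (Suc b) xs) ! c = xs ! (if c < b then c else Suc c)"
  by (auto simp: nth_append min_def)

text \<open>Expansion along the last row. The factors of \<open>A i j\<close> and of the
  \<open>A i (js ! b)\<close> do not involve the row \<open>i\<close>; whenever the bordered minors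
  vanish, this becomes a relation between columns.\<close>

lemma minor_laplace:
  assumes len: "length is = r" "length js = r"
  shows "minor A (is @ [i]) (js @ [j]) = minor A is js * A i j +
    (\<Sum>b<r. (- 1) ^ (r + b) * minor A is (take b js @ drop (Suc b) js @ [j]) * A i (js ! b))"
proof -
  define B where "B = Matrix.mat (Suc r) (Suc r) (\<lambda>(a, b). A ((is @ [i]) ! a) ((js @ [j]) ! b))"
  have B: "B \<in> carrier_mat (Suc r) (Suc r)"
    unfolding B_def by simp
  have del: "mat_delete B r b =
      Matrix.mat r r (\<lambda>(a, c). A (is ! a) ((take b (js @ [j]) @ drop (Suc b) (js @ [j])) ! c))"
    if b: "b < Suc r" for b
  proof (rule eq_matI, goal_cases)
    case (1 a c)
    have "(take b (js @ [j]) @ drop (Suc b) (js @ [j])) ! c = (js @ [j]) ! (if c < b then c else Suc c)"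
      by (rule nth_remove) (use b 1 len in auto)
    then show ?case
      using 1 b len by (auto simp: mat_delete_def B_def nth_append)
  qed (simp_all add: mat_delete_def B_def)
  have cof: "cofactor B r b = (- 1) ^ (r + b) * minor A is (take b (js @ [j]) @ drop (Suc b) (js @ [j]))"
    if b: "b < Suc r" for b
  proof -
    have "length (take b (js @ [j]) @ drop (Suc b) (js @ [j])) = r"
      using b len by auto
    then show ?thesis
      unfolding cofactor_def del[OF b] minor_def by (simp only: len(1))
  qed
  have "minor A (is @ [i]) (js @ [j]) = Determinant.det B"
    unfolding minor_def B_def using len by simp
  also have "\<dots> = (\<Sum>b<Suc r. B $$ (r, b) * cofactor B r b)"
    by (rule laplace_expansion_row[OF B]) simp
  also have "\<dots> = (\<Sum>b<Suc r. A i ((js @ [j]) ! b) *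
      ((- 1) ^ (r + b) * minor A is (take b (js @ [j]) @ drop (Suc b) (js @ [j]))))"
  proof (rule sum.cong[OF refl], goal_cases)
    case (1 b)
    then show ?case
      using cof[of b] by (auto simp: B_def nth_append len)
  qed
  also have "\<dots> = A i j * ((- 1) ^ (r + r) * minor A is js) + (\<Sum>b<r. A i ((js @ [j]) ! b) *
      ((- 1) ^ (r + b) * minor A is (take b (js @ [j]) @ drop (Suc b) (js @ [j]))))"
    using len by (simp add: nth_append)
  also have "(\<Sum>b<r. A i ((js @ [j]) ! b) *
      ((- 1) ^ (r + b) * minor A is (take b (js @ [j]) @ drop (Suc b) (js @ [j])))) =
      (\<Sum>b<r. (- 1) ^ (r + b) * minor A is (take b js @ drop (Suc b) js @ [j]) * A i (js ! b))"
    by (rule sum.cong) (use len in \<open>auto simp: nth_append mult_ac\<close>)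
  finally show ?thesis
    by (simp add: mult_ac)
qed

lemma minor_eq_0_if_not_distinct:
  assumes "length is = length js" "\<not> (distinct is \<and> distinct js)"
  shows "minor A is js = 0"
proof -
  define r where "r = length is"
  define B where "B = Matrix.mat r r (\<lambda>(a, b). A (is ! a) (js ! b))"
  have B: "B \<in> carrier_mat r r" and minor: "minor A is js = Determinant.det B"
    unfolding B_def minor_def r_def using assms by simp_all
  show ?thesis
  proof (cases "distinct is")
    case False
    then obtain a b where "a < r" "b < r" "a \<noteq> b" "is ! a = is ! b"
      unfolding distinct_conv_nth r_def by auto
    then show ?thesis
      unfolding minor by (intro det_identical_rows[OF B, of a b]) (auto simp: B_def)
  next
    case True
    then obtain a b where "a < r" "b < r" "a \<noteq> b" "js ! a = js ! b"
      using assms unfolding distinct_conv_nth r_def by auto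
    then show ?thesis
      unfolding minor by (intro det_identical_columns[OF B, of a b]) (auto simp: B_def)
  qed
qed

text \<open>\<open>K\<close> is the adjugate matrix. It is chosen before \<open>y\<close>, so a
  divisibility of the entries of \<open>A y\<close> passes to the minor times
  \<open>y\<close>.\<close>

lemma minor_cramer:
  fixes A :: "nat \<Rightarrow> nat \<Rightarrow> 'a::comm_ring_1"
  assumes "length is = r" "length js = r"
  shows "\<exists>K. \<forall>y. \<forall>b<r. minor A is js * y b =
    (\<Sum>a<r. K b a * (\<Sum>b<r. A (is ! a) (js ! b) * y b))"
proof -
  define B where "B = Matrix.mat r r (\<lambda>(a, b). A (is ! a) (js ! b))"
  have B: "B \<in> carrier_mat r r" and minor: "minor A is js = Determinant.det B"
    unfolding B_def minor_def using assms by simp_all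
  have adj: "adj_mat B \<in> carrier_mat r r" "adj_mat B * B = Determinant.det B \<cdot>\<^sub>m 1\<^sub>m r"
    using adj_mat[OF B] by auto
  have entry: "(\<Sum>a<r. adj_mat B $$ (b, a) * B $$ (a, c)) = (if b = c then Determinant.det B else 0)"
    if "b < r" "c < r" for b c
  proof -
    have "(\<Sum>a<r. adj_mat B $$ (b, a) * B $$ (a, c)) = (adj_mat B * B) $$ (b, c)"
      unfolding times_mat_def scalar_prod_def using that B adj(1)
      by (auto simp: atLeast0LessThan intro!: sum.cong)
    then show ?thesis
      using that by (simp add: adj(2))
  qed
  have "minor A is js * y b = (\<Sum>a<r. adj_mat B $$ (b, a) * (\<Sum>c<r. A (is ! a) (js ! c) * y c))"
    if "b < r" for y b
  proof -
    have "(\<Sum>a<r. adj_mat B $$ (b, a) * (\<Sum>c<r. A (is ! a) (js ! c) * y c)) =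
        (\<Sum>a<r. \<Sum>c<r. adj_mat B $$ (b, a) * B $$ (a, c) * y c)"
      by (auto simp: sum_distrib_left B_def mult.assoc intro!: sum.cong)
    also have "\<dots> = (\<Sum>c<r. (\<Sum>a<r. adj_mat B $$ (b, a) * B $$ (a, c)) * y c)"
      by (subst sum.swap) (simp add: sum_distrib_right)
    also have "\<dots> = (\<Sum>c<r. if c = b then Determinant.det B * y c else 0)"
      by (rule sum.cong) (use that in \<open>auto simp: entry\<close>)
    finally show ?thesis
      using that by (simp add: minor)
  qed
  then show ?thesis
    by (intro exI[of _ "\<lambda>b a. adj_mat B $$ (b, a)"]) blast
qed

lemma (in ring_filtration) filt_minor:
  assumes "length is = length js" "\<And>i j. i \<in> set is \<Longrightarrow> j \<in> set js \<Longrightarrow> F d (A i j)"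
  shows "F (length is * d) (minor A is js)"
proof -
  define r where "r = length is"
  have "minor A is js = (\<Sum>p | p permutes {0..<r}. signof p * (\<Prod>a = 0..<r. A (is ! a) (js ! p a)))"
    unfolding minor_def using assms(1)
    by (subst det_def'[of _ r]) (auto simp: r_def intro!: sum.cong prod.cong dest: permutes_in_image)
  moreover have "F (length is * d) (signof p * (\<Prod>a = 0..<r. A (is ! a) (js ! p a)))"
    if p: "p permutes {0..<r}" for p
  proof -
    have "F (\<Sum>a = 0..<r. d) (\<Prod>a = 0..<r. A (is ! a) (js ! p a))"
    proof (rule filt_prod)
      fix a assume a: "a \<in> {0..<r}"
      then have "p a \<in> {0..<r}"
        using p by (simp add: permutes_in_image del: atLeastLessThan_iff)
      then show "F d (A (is ! a) (js ! p a))"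
        using a assms by (auto simp: r_def)
    qed
    then show ?thesis
      by (auto simp: sign_def r_def filt_uminus)
  qed
  ultimately show ?thesis
    by (auto intro!: filt_sum)
qed

lemma maximal_minor:
  fixes A :: "nat \<Rightarrow> nat \<Rightarrow> 'a::comm_ring_1"
  obtains r "is" js where "r \<le> m" "length is = r" "length js = r"
    "set is \<subseteq> {..<m}" "set js \<subseteq> {..<n}" "minor A is js \<noteq> 0"
    "\<And>is js. length is = Suc r \<Longrightarrow> length js = Suc r \<Longrightarrow> set is \<subseteq> {..<m} \<Longrightarrow> set js \<subseteq> {..<n} \<Longrightarrow>
      minor A is js = 0"
proof -
  define S where "S r \<longleftrightarrow> (\<exists>is js. length is = r \<and> length js = r \<and>
    set is \<subseteq> {..<m} \<and> set js \<subseteq> {..<n} \<and> minor A is js \<noteq> 0)" for r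
  have bound: "r \<le> m" if "S r" for r
  proof -
    from that obtain "is" js where *: "length is = r" "length js = r" "set is \<subseteq> {..<m}" "minor A is js \<noteq> 0"
      unfolding S_def by auto
    then have "distinct is"
      using minor_eq_0_if_not_distinct[of "is" js A] by auto
    then show "r \<le> m"
      using * card_mono[of "{..<m}" "set is"] by (simp add: distinct_card)
  qed
  \<comment> \<open>The empty minor is 1, so even a zero matrix has a maximal nonvanishing minor, of
    size 0.\<close>
  have "S 0"
    unfolding S_def by (auto intro!: exI[of _ "[]"])
  then have "S (Greatest S)" and max: "\<And>r. S r \<Longrightarrow> r \<le> Greatest S"
    using bound by (auto intro: GreatestI_nat Greatest_le_nat)
  then obtain "is" js where idx: "length is = Greatest S" "length js = Greatest S"
    "set is \<subseteq> {..<m}" "set js \<subseteq> {..<n}" "minor A is js \<noteq> 0"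
    unfolding S_def by blast
  have "\<not> S (Suc (Greatest S))"
    using max by fastforce
  then have "minor A is js = 0" if "length is = Suc (Greatest S)" "length js = Suc (Greatest S)"
    "set is \<subseteq> {..<m}" "set js \<subseteq> {..<n}" for "is" js
    using that unfolding S_def by blast
  with \<open>S (Greatest S)\<close> idx show thesis
    by (intro that[of "Greatest S" "is" js] bound)
qed

lemma minor_relation:
  fixes A :: "nat \<Rightarrow> nat \<Rightarrow> 'a::comm_ring_1"
  assumes "length is = r" "length js = r" "set is \<subseteq> {..<m}" "set js \<subseteq> {..<n}"
    and zero: "\<And>is js. length is = Suc r \<Longrightarrow> length js = Suc r \<Longrightarrow> set is \<subseteq> {..<m} \<Longrightarrow> set js \<subseteq> {..<n} \<Longrightarrow>
      minor A is js = 0"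
    and "i < m" "j < n"
  shows "minor A is js * A i j =
    (\<Sum>b<r. - ((- 1) ^ (r + b) * minor A is (take b js @ drop (Suc b) js @ [j])) * A i (js ! b))"
proof -
  have "minor A (is @ [i]) (js @ [j]) = 0"
    by (rule zero) (use assms in auto)
  then show ?thesis
    using minor_laplace[OF assms(1,2), of A i j] by (simp add: sum_negf eq_neg_iff_add_eq_0)
qed

lemma sum_nth_eq_sum_set:
  assumes "distinct xs"
  shows "(\<Sum>b<length xs. f (xs ! b)) = sum f (set xs)"
  using assms sum.distinct_set_conv_list[of xs f] by (simp add: sum_list_sum_nth atLeast0LessThan)

section \<open>Pivot columns with a denominator prime to \<pi>\<close>

lemma prime_power_dvd_cancel:
  fixes \<pi> :: "'a::idom"
  assumes "prime_elem \<pi>" "\<not> \<pi> dvd x"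
  shows "\<pi> ^ E dvd x * y \<longleftrightarrow> \<pi> ^ E dvd y"
proof (induction E arbitrary: y)
  case (Suc E)
  show ?case
  proof
    assume *: "\<pi> ^ Suc E dvd x * y"
    then have "\<pi> dvd x * y"
      using dvd_mult_left[of \<pi> "\<pi> ^ E" "x * y"] by simp
    then obtain z where z: "y = \<pi> * z"
      using assms by (auto simp: prime_elem_dvd_mult_iff)
    then have "\<pi> * \<pi> ^ E dvd \<pi> * (x * z)"
      using * by (simp add: mult_ac)
    then show "\<pi> ^ Suc E dvd y"
      using assms(1) Suc[of z] by (auto simp: z)
  qed simp
qed simp

text \<open>Among the minors of maximal size \<open>r\<close>, one of least \<pi>-adic valuation
  \<open>k\<close> is chosen, and \<open>P\<close> consists of its columns. All minors of that size
  are divisible by \<open>\<pi> ^ k\<close>, so the column relations can be divided by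
  \<open>\<pi> ^ k\<close>; \<open>\<Delta>\<close> and the \<open>C j l\<close> stay in the ring,
  and \<open>\<Delta>\<close> becomes prime to \<pi>. The hypothesis \<open>div\<close> keeps their
  degrees under control. The last property is an approximate converse: vectors in the kernel modulo
  a high power of \<pi> satisfy the pivot relations, with a loss \<open>k\<close> that does not
  depend on the vector.\<close>

lemma exists_pivots:
  fixes A :: "nat \<Rightarrow> nat \<Rightarrow> 'a::idom"
  assumes prime: "prime_elem \<pi>" and sep: "\<And>x. x \<noteq> 0 \<Longrightarrow> \<exists>k. \<not> \<pi> ^ k dvd x"
    and filt: "ring_filtration F" and div: "\<And>a x. F a (\<pi> * x) \<Longrightarrow> F a x"
    and deg: "\<And>i j. i < m \<Longrightarrow> j < n \<Longrightarrow> F d (A i j)"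
  obtains P \<Delta> C k where "P \<subseteq> {..<n}" "\<not> \<pi> dvd \<Delta>" "F (m * d) \<Delta>"
    "\<And>j l. j \<in> {..<n} - P \<Longrightarrow> l \<in> P \<Longrightarrow> F (m * d) (C j l)"
    "\<And>i j. i < m \<Longrightarrow> j \<in> {..<n} - P \<Longrightarrow> \<Delta> * A i j = (\<Sum>l\<in>P. C j l * A i l)"
    "\<And>v E l. (\<And>i. i < m \<Longrightarrow> \<pi> ^ (E + k) dvd (\<Sum>j<n. A i j * v j)) \<Longrightarrow> l \<in> P \<Longrightarrow>
       \<pi> ^ E dvd \<Delta> * v l + (\<Sum>j\<in>{..<n} - P. C j l * v j)"
proof -
  interpret ring_filtration F by fact
  have \<pi>0: "\<pi> \<noteq> 0"
    using prime by auto
  have div': "F a x" if "F a (\<pi> ^ k * x)" for a k x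
    using that by (induction k) (auto simp: mult.assoc dest: div)
  obtain r is0 js0 where r: "r \<le> m" "length is0 = r" "length js0 = r"
    "set is0 \<subseteq> {..<m}" "set js0 \<subseteq> {..<n}" "minor A is0 js0 \<noteq> 0"
    and zero: "\<And>is js. length is = Suc r \<Longrightarrow> length js = Suc r \<Longrightarrow> set is \<subseteq> {..<m} \<Longrightarrow> set js \<subseteq> {..<n} \<Longrightarrow>
      minor A is js = 0"
    using maximal_minor[of m n A] by blast
  \<comment> \<open>The shift by \<open>Suc\<close> makes the least \<open>k\<close> with
    \<open>S k\<close> the minimal valuation itself.\<close>
  define S where "S k \<longleftrightarrow> (\<exists>is js. length is = r \<and> length js = r \<and> set is \<subseteq> {..<m} \<and> set js \<subseteq> {..<n} \<and>
    \<not> \<pi> ^ Suc k dvd minor A is js)" for k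
  define k where "k = (LEAST k. S k)"
  obtain k0 where "\<not> \<pi> ^ k0 dvd minor A is0 js0"
    using sep r by blast
  then have "\<not> \<pi> ^ Suc k0 dvd minor A is0 js0"
    by (auto dest: dvd_mult_right)
  then have "S k0"
    unfolding S_def using r by blast
  then have "S k"
    unfolding k_def by (rule LeastI)
  then obtain "is" js where idx: "length is = r" "length js = r" "set is \<subseteq> {..<m}" "set js \<subseteq> {..<n}"
    and nd: "\<not> \<pi> ^ Suc k dvd minor A is js"
    unfolding S_def by auto
  have kdvd: "\<pi> ^ k dvd minor A is js"
    if "length is = r" "length js = r" "set is \<subseteq> {..<m}" "set js \<subseteq> {..<n}" for "is" js
  proof (cases k)
    case (Suc k')
    then have "\<not> S k'"
      using not_less_Least[of k' S] by (simp add: k_def)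
    then show ?thesis
      using that Suc unfolding S_def by auto
  qed simp
  have "minor A is js \<noteq> 0"
    using nd by auto
  then have dist: "distinct js"
    using minor_eq_0_if_not_distinct[of "is" js A] idx by auto
  obtain \<Delta> where \<Delta>: "minor A is js = \<pi> ^ k * \<Delta>"
    using kdvd[OF idx] by auto
  have nd\<Delta>: "\<not> \<pi> dvd \<Delta>"
    using nd by (auto simp: \<Delta> mult.commute)
  define M where "M j b = - ((- 1) ^ (r + b) * minor A is (take b js @ drop (Suc b) js @ [j]))" for j b
  have sub: "length (take b js @ drop (Suc b) js @ [j]) = r" "set (take b js @ drop (Suc b) js @ [j]) \<subseteq> {..<n}"
    if "b < r" "j < n" for b j
    using that idx set_take_subset[of b js] set_drop_subset[of "Suc b" js] by auto
  have "\<pi> ^ k dvd M j b" if "b < r" "j < n" for b j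
    unfolding M_def dvd_minus_iff by (intro dvd_mult kdvd idx(1,3) sub[OF that])
  then have "\<forall>j b. \<exists>c. b < r \<and> j < n \<longrightarrow> M j b = \<pi> ^ k * c"
    by (auto simp: dvd_def)
  then obtain C' where C': "\<And>j b. b < r \<Longrightarrow> j < n \<Longrightarrow> M j b = \<pi> ^ k * C' j b"
    by metis
  define ix where "ix = the_inv_into {..<r} ((!) js)"
  have inj: "inj_on ((!) js) {..<r}"
    using dist idx by (auto simp: inj_on_nth)
  have ix: "ix (js ! b) = b" if "b < r" for b
    unfolding ix_def by (rule the_inv_into_f_f[OF inj]) (use that in simp)
  define C where "C j l = C' j (ix l)" for j l
  have P: "\<exists>b<r. l = js ! b" if "l \<in> set js" for l
    using that idx by (auto simp: in_set_conv_nth)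
  have sumP: "(\<Sum>b<r. f (js ! b)) = sum f (set js)" for f :: "nat \<Rightarrow> 'a"
    using sum_nth_eq_sum_set[OF dist, of f] idx by simp
  have rel: "\<Delta> * A i j = (\<Sum>l\<in>set js. C j l * A i l)" if "i < m" "j < n" for i j
  proof -
    have "minor A is js * A i j = (\<Sum>b<r. M j b * A i (js ! b))"
      unfolding M_def by (rule minor_relation[OF idx _ that]) (rule zero)
    then have "\<pi> ^ k * (\<Delta> * A i j) = (\<Sum>b<r. M j b * A i (js ! b))"
      by (simp only: \<Delta> mult.assoc)
    also have "\<dots> = (\<Sum>b<r. \<pi> ^ k * (C j (js ! b) * A i (js ! b)))"
      by (rule sum.cong) (use that in \<open>auto simp: C' C_def ix\<close>)
    also have "\<dots> = \<pi> ^ k * (\<Sum>l\<in>set js. C j l * A i l)"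
      using sumP[of "\<lambda>l. \<pi> ^ k * (C j l * A i l)"] by (simp add: sum_distrib_left)
    finally show ?thesis
      using \<pi>0 by simp
  qed
  have rm: "r * d \<le> m * d"
    using r by simp
  have F_minor: "F (m * d) (minor A is js)"
    if "length is = r" "length js = r" "set is \<subseteq> {..<m}" "set js \<subseteq> {..<n}" for "is" js
    using filt_mono[OF filt_minor[of "is" js d A] , of "m * d"] that deg rm by auto
  show thesis
  proof (rule that[of "set js" \<Delta> C k])
    show "F (m * d) \<Delta>"
      by (rule div'[of _ k]) (use F_minor[OF idx] in \<open>simp add: \<Delta>\<close>)
    show "F (m * d) (C j l)" if "j \<in> {..<n} - set js" "l \<in> set js" for j l
    proof -
      obtain b where b: "b < r" "l = js ! b"
        using P \<open>l \<in> set js\<close> by blast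
      have "F (m * d) (M j b)"
        unfolding M_def using F_minor[OF idx(1) sub(1) idx(3) sub(2)] that b
        by (intro filt_uminus filt_sign) auto
      then show ?thesis
        using that b div'[of "m * d" k "C j l"] by (simp add: C' C_def ix)
    qed
    show "\<pi> ^ E dvd \<Delta> * v l + (\<Sum>j\<in>{..<n} - set js. C j l * v j)"
      if v: "\<And>i. i < m \<Longrightarrow> \<pi> ^ (E + k) dvd (\<Sum>j<n. A i j * v j)" and l: "l \<in> set js" for v E l
    proof -
      define y where "y l = \<Delta> * v l + (\<Sum>j\<in>{..<n} - set js. C j l * v j)" for l
      \<comment> \<open>The relations for the other columns collapse the system onto the pivot
        columns: there \<open>A\<close> maps \<open>y\<close> to \<open>\<Delta>\<close> times
        \<open>A v\<close>.\<close>
      have Ay: "(\<Sum>l\<in>set js. A i l * y l) = \<Delta> * (\<Sum>j<n. A i j * v j)" if "i < m" for i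
      proof -
        have "(\<Sum>l\<in>set js. A i l * y l) = (\<Sum>l\<in>set js. \<Delta> * (A i l * v l)) +
            (\<Sum>l\<in>set js. \<Sum>j\<in>{..<n} - set js. C j l * A i l * v j)"
          unfolding y_def by (simp add: distrib_left sum.distrib sum_distrib_left mult_ac)
        also have "(\<Sum>l\<in>set js. \<Sum>j\<in>{..<n} - set js. C j l * A i l * v j) =
            (\<Sum>j\<in>{..<n} - set js. (\<Sum>l\<in>set js. C j l * A i l) * v j)"
          by (subst sum.swap) (simp add: sum_distrib_right)
        also have "\<dots> = (\<Sum>j\<in>{..<n} - set js. \<Delta> * (A i j * v j))"
          by (rule sum.cong) (use \<open>i < m\<close> in \<open>auto simp: rel[symmetric]\<close>)
        also have "(\<Sum>l\<in>set js. \<Delta> * (A i l * v l)) + \<dots> = (\<Sum>j<n. \<Delta> * (A i j * v j))"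
          using sum.subset_diff[OF idx(4), of "\<lambda>j. \<Delta> * (A i j * v j)"] by simp
        finally show ?thesis
          by (simp add: sum_distrib_left)
      qed
      obtain K where K: "\<And>y b. b < r \<Longrightarrow> minor A is js * y b =
          (\<Sum>a<r. K b a * (\<Sum>b<r. A (is ! a) (js ! b) * y b))"
        using minor_cramer[OF idx(1,2)] by blast
      obtain b where b: "b < r" "l = js ! b"
        using P l by blast
      have Kl: "minor A is js * y l = (\<Sum>a<r. K b a * (\<Sum>l\<in>set js. A (is ! a) l * y l))"
        using K[OF b(1), of "\<lambda>b. y (js ! b)"] sumP[of "\<lambda>l. A i l * y l" for i] b by simp
      have "\<pi> ^ (E + k) dvd minor A is js * y l"
        unfolding Kl
      proof (rule dvd_sum, rule dvd_mult, goal_cases)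
        case (1 a)
        then have "is ! a \<in> {..<m}"
          using idx nth_mem[of a "is"] by (intro subsetD[OF idx(3)]) simp
        then show ?case
          using v[of "is ! a"] by (simp add: Ay)
      qed
      \<comment> \<open>The minor in Cramer's rule carries the factor \<open>\<pi> ^ k\<close>; this
        consumes the surplus \<open>k\<close> in the hypothesis on \<open>v\<close>. The remaining
        factor \<open>\<Delta>\<close> is cancelled by primality.\<close>
      then have "\<pi> ^ k * \<pi> ^ E dvd \<pi> ^ k * (\<Delta> * y l)"
        by (simp only: \<Delta> power_add mult.assoc mult.commute[of "\<pi> ^ E"])
      then have "\<pi> ^ E dvd \<Delta> * y l"
        using \<pi>0 dvd_mult_cancel_left[of "\<pi> ^ k" "\<pi> ^ E" "\<Delta> * y l"] by auto
      then show ?thesis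
        unfolding y_def[symmetric] using prime_power_dvd_cancel[OF prime nd\<Delta>] by simp
    qed
    show "\<Delta> * A i j = (\<Sum>l\<in>set js. C j l * A i l)" if "i < m" "j \<in> {..<n} - set js" for i j
      using rel that by blast
  qed (use idx nd\<Delta> in auto)
qed

section \<open>Weierstrass division modulo powers of a prime element\<close>

text \<open>Total degree, the variable of \<open>poly\<close> having degree 1. The clause
  \<open>i \<le> D\<close> does not follow from the other one, because \<open>D - i\<close> is
  truncated subtraction.\<close>

definition poly_filt :: "(nat \<Rightarrow> 'a::comm_ring_1 \<Rightarrow> bool) \<Rightarrow> nat \<Rightarrow> 'a poly \<Rightarrow> bool" where
  "poly_filt F D p \<longleftrightarrow> (\<forall>i. coeff p i \<noteq> 0 \<longrightarrow> i \<le> D \<and> F (D - i) (coeff p i))"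

lemma (in ring_filtration) poly_filt_coeff: "poly_filt F D p \<Longrightarrow> F (D - i) (coeff p i)"
  by (cases "coeff p i = 0") (auto simp: poly_filt_def filt_zero)

lemma (in ring_filtration) ring_filtration_poly_filt: "ring_filtration (poly_filt F)"
proof
  fix a b n :: nat and x y :: "'a poly"
  show "poly_filt F n 0"
    by (simp add: poly_filt_def)
  show "poly_filt F 0 1"
    by (auto simp: poly_filt_def filt_one coeff_1)
  show "poly_filt F n (- x)" if "poly_filt F n x"
    using that by (auto simp: poly_filt_def filt_uminus)
  show "poly_filt F n (x + y)" if x: "poly_filt F n x" and y: "poly_filt F n y"
    unfolding poly_filt_def coeff_add
  proof (intro allI impI conjI)
    fix i assume "coeff x i + coeff y i \<noteq> 0"
    then have "coeff x i \<noteq> 0 \<or> coeff y i \<noteq> 0"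
      by auto
    then show "i \<le> n"
      using x y by (auto simp: poly_filt_def)
    show "F (n - i) (coeff x i + coeff y i)"
      by (intro filt_add poly_filt_coeff x y)
  qed
  show "poly_filt F b x" if x: "poly_filt F a x" and "a \<le> b"
    unfolding poly_filt_def
  proof (intro allI impI)
    fix i assume "coeff x i \<noteq> 0"
    then have "i \<le> a" "F (a - i) (coeff x i)"
      using x by (auto simp: poly_filt_def)
    then show "i \<le> b \<and> F (b - i) (coeff x i)"
      using \<open>a \<le> b\<close> by (auto intro: filt_mono)
  qed
  show "poly_filt F (a + b) (x * y)" if x: "poly_filt F a x" and y: "poly_filt F b y"
    unfolding poly_filt_def
  proof (intro allI impI)
    fix i assume nz: "coeff (x * y) i \<noteq> 0"
    have summand: "F (a + b - i) (coeff x k * coeff y (i - k))" if "k \<le> i" for k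
    proof (cases "coeff x k = 0 \<or> coeff y (i - k) = 0")
      case False
      then have "k \<le> a" "i - k \<le> b" "F (a - k) (coeff x k)" "F (b - (i - k)) (coeff y (i - k))"
        using x y by (auto simp: poly_filt_def)
      then show ?thesis
        using filt_mult[of "a - k" "coeff x k" "b - (i - k)" "coeff y (i - k)"] that
        by (simp add: algebra_simps)
    qed (auto simp: filt_zero)
    obtain k where "k \<le> i" "coeff x k * coeff y (i - k) \<noteq> 0"
      using nz unfolding coeff_mult by (metis (lifting) sum.neutral atMost_iff)
    then have "coeff x k \<noteq> 0" "coeff y (i - k) \<noteq> 0"
      by auto
    then have "k \<le> a" "i - k \<le> b"
      using x y by (auto simp: poly_filt_def)
    then have "i \<le> a + b"
      by simp
    then show "i \<le> a + b \<and> F (a + b - i) (coeff (x * y) i)"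
      unfolding coeff_mult using summand by (auto intro!: filt_sum)
  qed
qed

lemma (in ring_filtration) poly_filt_const: "F D c \<Longrightarrow> poly_filt F D [:c:]"
  by (auto simp: poly_filt_def coeff_pCons split: nat.splits)

lemma (in ring_filtration) poly_filt_monom: "F a c \<Longrightarrow> poly_filt F (a + n) (monom c n)"
  by (auto simp: poly_filt_def)

lemma const_power_dvd_iff:
  fixes p :: "'a::idom poly"
  shows "[:c:] ^ n dvd p \<longleftrightarrow> (\<forall>i. c ^ n dvd coeff p i)"
  by (simp add: const_poly_dvd_iff poly_const_pow)

text \<open>Each step cancels the top coefficient at the price of a factor
  \<open>coeff \<Delta> s\<close>. When \<open>\<Delta>\<close> has total degree at most
  \<open>s\<close>, that factor has degree 0, so neither the scaling nor the subtraction lifts the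
  total degree above \<open>D\<close>.\<close>

lemma (in ring_filtration) pseudo_division:
  fixes \<Delta> w :: "'a poly"
  assumes "\<And>i. i > s \<Longrightarrow> coeff \<Delta> i = 0" "\<And>i. i \<ge> s + n \<Longrightarrow> coeff w i = 0"
  shows "\<exists>q r. smult (coeff \<Delta> s ^ n) w = q * \<Delta> + r \<and> (\<forall>i\<ge>s. coeff r i = 0) \<and>
    (\<forall>i\<ge>n. coeff q i = 0) \<and> (poly_filt F s \<Delta> \<and> poly_filt F D w \<longrightarrow> poly_filt F D q)"
  using assms(2)
proof (induction n arbitrary: w)
  case 0
  then show ?case
    by (intro exI[of _ 0] exI[of _ w]) (auto simp: poly_filt_def)
next
  case (Suc n)
  interpret G: ring_filtration "poly_filt F"
    by (rule ring_filtration_poly_filt)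
  define b where "b = coeff w (s + n)"
  define w' where "w' = smult (coeff \<Delta> s) w - monom b n * \<Delta>"
  have w': "coeff w' i = 0" if "i \<ge> s + n" for i
  proof (cases "i = s + n")
    case True
    then show ?thesis
      by (simp add: w'_def b_def coeff_monom_mult)
  next
    case False
    then show ?thesis
      using that Suc.prems[of i] assms(1)[of "i - n"] by (simp add: w'_def coeff_monom_mult)
  qed
  obtain q r where qr: "smult (coeff \<Delta> s ^ n) w' = q * \<Delta> + r" "\<forall>i\<ge>s. coeff r i = 0" "\<forall>i\<ge>n. coeff q i = 0"
    "poly_filt F s \<Delta> \<and> poly_filt F D w' \<longrightarrow> poly_filt F D q"
    using Suc.IH[of w', OF w'] by auto
  have "smult (coeff \<Delta> s ^ Suc n) w = smult (coeff \<Delta> s ^ n) (w' + monom b n * \<Delta>)"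
    by (simp add: w'_def mult.commute)
  also have "\<dots> = (q + smult (coeff \<Delta> s ^ n) (monom b n)) * \<Delta> + r"
    by (simp add: smult_add_right qr(1) algebra_simps)
  finally have eq: "smult (coeff \<Delta> s ^ Suc n) w = (q + smult (coeff \<Delta> s ^ n) (monom b n)) * \<Delta> + r" .
  have "poly_filt F D (q + smult (coeff \<Delta> s ^ n) (monom b n))"
    if \<Delta>: "poly_filt F s \<Delta>" and w: "poly_filt F D w"
  proof -
    have c0: "F 0 (coeff \<Delta> s)"
      using poly_filt_coeff[OF \<Delta>, of s] by simp
    have c: "poly_filt F 0 [:coeff \<Delta> s ^ n:]" "poly_filt F 0 [:coeff \<Delta> s:]"
      using c0 filt_power[OF c0, of n] by (auto intro: poly_filt_const)
    have m: "poly_filt F (D - s) (monom b n)" "b = 0 \<or> s \<le> D"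
    proof (atomize (full), cases "b = 0")
      case False
      then have "s + n \<le> D" "F (D - (s + n)) b"
        using w by (auto simp: poly_filt_def b_def)
      then show "poly_filt F (D - s) (monom b n) \<and> (b = 0 \<or> s \<le> D)"
        using poly_filt_monom[of "D - (s + n)" b n] by simp
    qed (simp add: G.filt_zero)
    have "poly_filt F D (monom b n * \<Delta>)"
      using G.filt_mult[OF m(1) \<Delta>] m(2) by (auto simp: G.filt_zero)
    then have "poly_filt F D w'"
      using G.filt_mult[OF c(2) w] by (auto simp: w'_def intro: G.filt_diff)
    moreover have "poly_filt F D (smult (coeff \<Delta> s ^ n) (monom b n))"
      using G.filt_mult[OF c(1) G.filt_mono[OF m(1), of D]] by simp
    ultimately show ?thesis
      using qr(4) \<Delta> by (auto intro: G.filt_add)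
  qed
  then show ?case
    using eq qr by (intro exI[of _ "q + smult (coeff \<Delta> s ^ n) (monom b n)"] exI[of _ r]) auto
qed

text \<open>Modulo \<open>\<pi> ^ E\<close> the polynomial \<open>W\<close> has degree
  \<open>s\<close> and a leading coefficient that can be cancelled. If \<open>t\<close> is the last
  index at which \<open>g\<close> is nonzero modulo \<open>\<pi> ^ E\<close>, the product is
  therefore nonzero at \<open>s + t\<close>.\<close>

lemma dvd_coeff_cancel_leading:
  fixes W g :: "'a::idom poly"
  assumes prime: "prime_elem \<pi>" and lead: "\<not> \<pi> dvd coeff W s"
    and high: "\<And>i. i > s \<Longrightarrow> \<pi> ^ E dvd coeff W i"
    and prod: "\<And>i. i \<ge> s + n \<Longrightarrow> \<pi> ^ E dvd coeff (W * g) i"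
    and "i \<ge> n"
  shows "\<pi> ^ E dvd coeff g i"
proof (rule ccontr)
  assume nd: "\<not> \<pi> ^ E dvd coeff g i"
  define T where "T = {i. \<not> \<pi> ^ E dvd coeff g i}"
  have "T \<subseteq> {..degree g}"
    by (auto simp: T_def intro!: le_degree)
  then have fin: "finite T"
    using finite_subset by blast
  moreover have "i \<in> T"
    using nd by (simp add: T_def)
  ultimately have M: "Max T \<in> T" "i \<le> Max T"
    using Max_in[of T] by (auto simp del: Max_in)
  define t where "t = Max T"
  have "coeff (W * g) (s + t) = (\<Sum>k\<le>s + t. coeff W k * coeff g (s + t - k))"
    by (rule coeff_mult)
  also have "\<dots> = coeff W s * coeff g t + (\<Sum>k\<in>{..s + t} - {s}. coeff W k * coeff g (s + t - k))"
    by (subst sum.remove[of _ s]) auto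
  finally have eq: "coeff W s * coeff g t =
      coeff (W * g) (s + t) - (\<Sum>k\<in>{..s + t} - {s}. coeff W k * coeff g (s + t - k))"
    by simp
  have "\<pi> ^ E dvd coeff W k * coeff g (s + t - k)" if "k \<in> {..s + t} - {s}" for k
  proof (cases "k > s")
    case False
    then have "s + t - k > Max T"
      using that by (auto simp: t_def)
    then have "s + t - k \<notin> T"
      using fin Max_ge by (meson not_le)
    then show ?thesis
      by (simp add: T_def)
  qed (simp add: high)
  then have "\<pi> ^ E dvd coeff W s * coeff g t"
    unfolding eq using prod[of "s + t"] M \<open>i \<ge> n\<close> by (auto simp: t_def intro!: dvd_diff dvd_sum)
  then have "\<pi> ^ E dvd coeff g t"
    using prime_power_dvd_cancel[OF prime lead] by simp
  then show False
    using M by (simp add: T_def t_def)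
qed

text \<open>Factors \<pi> are split off \<open>h\<close> one at a time: modulo \<pi> the divisor has
  degree exactly \<open>s\<close>, so a product of degree below \<open>s\<close> forces the other
  factor to vanish modulo \<pi>.\<close>

lemma weierstrass_uniqueness:
  fixes \<Delta> h :: "'a::idom poly"
  assumes prime: "prime_elem \<pi>" and lead: "\<not> \<pi> dvd coeff \<Delta> s"
    and high: "\<And>i. i > s \<Longrightarrow> \<pi> dvd coeff \<Delta> i"
    and prod: "\<And>i. i \<ge> s \<Longrightarrow> \<pi> ^ E dvd coeff (h * \<Delta>) i"
  shows "[:\<pi>:] ^ E dvd h"
proof -
  have "e \<le> E \<Longrightarrow> [:\<pi>:] ^ e dvd h" for e
  proof (induction e)
    case (Suc e)
    then obtain h' where h': "h = [:\<pi>:] ^ e * h'"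
      by auto
    have "\<pi> ^ 1 dvd coeff (\<Delta> * h') i" if "i \<ge> s + 0" for i
    proof -
      have "\<pi> ^ Suc e dvd coeff (h * \<Delta>) i"
        using prod[of i] that le_imp_power_dvd[OF Suc.prems, of \<pi>] by (auto intro: dvd_trans)
      then have "\<pi> ^ e * \<pi> dvd \<pi> ^ e * coeff (h' * \<Delta>) i"
        by (simp add: h' poly_const_pow mult.commute)
      then show ?thesis
        using prime by (auto simp: mult.commute)
    qed
    then have "\<pi> ^ 1 dvd coeff h' i" for i
      using dvd_coeff_cancel_leading[OF prime lead, of 1 0 h' i] high by simp
    then have "[:\<pi>:] dvd h'"
      by (simp add: const_poly_dvd_iff)
    then show ?case
      unfolding h' power_Suc2 by (intro mult_dvd_mono dvd_refl)
  qed simp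
  then show ?thesis
    by simp
qed

text \<open>Division by \<open>\<Delta>0\<close> leaves an error divisible by \<pi>, which is
  divided in turn. Control over the degree of \<open>q\<close> is lost on the way, but modulo \<pi>
  the quotient still comes from the first division up to a scalar; \<open>q0\<close> records this
  residue with its bound. Every large \<open>K\<close> is allowed, so that several polynomials can
  share one power of the leading coefficient.\<close>

lemma (in ring_filtration) weierstrass_division:
  fixes \<Delta> \<Delta>0 v w :: "'a poly"
  assumes \<Delta>: "\<Delta> = \<Delta>0 + [:\<pi>:] * Z" and high: "\<And>i. i > s \<Longrightarrow> coeff \<Delta>0 i = 0"
    and filt: "poly_filt F s \<Delta>0"
    and v: "v = w + [:\<pi>:] * x" and "E > 0"
  shows "\<exists>K0. \<forall>K\<ge>K0. \<exists>q r h q0. smult (coeff \<Delta>0 s ^ K) v = q * \<Delta> + r + [:\<pi>:] ^ E * h \<and>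
    (\<forall>i\<ge>s. coeff r i = 0) \<and> [:\<pi>:] dvd q - q0 \<and> (poly_filt F D w \<longrightarrow> poly_filt F D q0)"
  using \<open>E > 0\<close>
proof (induction E rule: nat_induct_non_zero)
  have base: "\<exists>q r h. smult (coeff \<Delta>0 s ^ K) v = q * \<Delta> + r + [:\<pi>:] * h \<and>
    (\<forall>i\<ge>s. coeff r i = 0) \<and> (poly_filt F D w \<longrightarrow> poly_filt F D q)"
    if v: "v = w + [:\<pi>:] * x" and K: "K > degree w" for K v w x
  proof -
    have "coeff w i = 0" if "i \<ge> s + K" for i
      using K that by (intro coeff_eq_0) simp
    then obtain q r where qr: "smult (coeff \<Delta>0 s ^ K) w = q * \<Delta>0 + r" "\<forall>i\<ge>s. coeff r i = 0"
        "poly_filt F D w \<longrightarrow> poly_filt F D q"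
      using pseudo_division[of s \<Delta>0 K w D, OF high] filt by blast
    have "smult (coeff \<Delta>0 s ^ K) v = q * \<Delta> + r + [:\<pi>:] * (smult (coeff \<Delta>0 s ^ K) x - q * Z)"
      unfolding v \<Delta> smult_add_right qr(1) by (simp add: algebra_simps)
    with qr show ?thesis
      by blast
  qed
  case 1
  show ?case
  proof (intro exI[of _ "Suc (degree w)"] allI impI)
    fix K assume "Suc (degree w) \<le> K"
    then obtain q r h where "smult (coeff \<Delta>0 s ^ K) v = q * \<Delta> + r + [:\<pi>:] * h"
      "\<forall>i\<ge>s. coeff r i = 0" "poly_filt F D w \<longrightarrow> poly_filt F D q"
      using base[OF v, of K] by auto
    then show "\<exists>q r h q0. smult (coeff \<Delta>0 s ^ K) v = q * \<Delta> + r + [:\<pi>:] ^ 1 * h \<and>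
      (\<forall>i\<ge>s. coeff r i = 0) \<and> [:\<pi>:] dvd q - q0 \<and> (poly_filt F D w \<longrightarrow> poly_filt F D q0)"
      by (intro exI[of _ q] exI[of _ r] exI[of _ h] exI[of _ q]) simp
  qed
  case (Suc E)
  then obtain K0 q r h q0 where *: "smult (coeff \<Delta>0 s ^ K0) v = q * \<Delta> + r + [:\<pi>:] ^ E * h"
      "\<forall>i\<ge>s. coeff r i = 0" "[:\<pi>:] dvd q - q0" "poly_filt F D w \<longrightarrow> poly_filt F D q0"
    by blast
  interpret G: ring_filtration "poly_filt F"
    by (rule ring_filtration_poly_filt)
  have c0: "F 0 (coeff \<Delta>0 s)"
    using poly_filt_coeff[OF filt, of s] by simp
  show ?case
  proof (intro exI[of _ "K0 + Suc (degree h)"] allI impI)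
    fix K assume K: "K0 + Suc (degree h) \<le> K"
    define e where "e = K - K0"
    define c where "c = coeff \<Delta>0 s ^ e"
    have cK: "coeff \<Delta>0 s ^ K = c * coeff \<Delta>0 s ^ K0"
      using K by (simp add: c_def e_def flip: power_add)
    obtain q' r' h' where **: "smult c h = q' * \<Delta> + r' + [:\<pi>:] * h'" "\<forall>i\<ge>s. coeff r' i = 0"
    proof -
      have "degree h < e"
        using K by (simp add: e_def)
      then show thesis
        using base[of h h 0 e] that unfolding c_def by auto
    qed
    have "smult (coeff \<Delta>0 s ^ K) v = smult c (q * \<Delta> + r) + [:\<pi>:] ^ E * smult c h"
      unfolding cK smult_smult[symmetric] *(1) by (simp add: smult_add_right)
    also have "\<dots> = (smult c q + [:\<pi>:] ^ E * q') * \<Delta> + (smult c r + [:\<pi>:] ^ E * r') + [:\<pi>:] ^ Suc E * h'"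
      unfolding **(1) by (simp add: smult_add_right algebra_simps)
    finally have "smult (coeff \<Delta>0 s ^ K) v =
      (smult c q + [:\<pi>:] ^ E * q') * \<Delta> + (smult c r + [:\<pi>:] ^ E * r') + [:\<pi>:] ^ Suc E * h'" .
    moreover have "\<forall>i\<ge>s. coeff (smult c r + [:\<pi>:] ^ E * r') i = 0"
      using *(2) **(2) by (simp add: poly_const_pow)
    moreover have "[:\<pi>:] dvd smult c q + [:\<pi>:] ^ E * q' - smult c q0"
    proof -
      have "smult c q + [:\<pi>:] ^ E * q' - smult c q0 = smult c (q - q0) + [:\<pi>:] ^ E * q'"
        by (simp add: smult_diff_right)
      also have "[:\<pi>:] dvd \<dots>"
        using *(3) \<open>0 < E\<close> by (intro dvd_add dvd_smult dvd_mult2 dvd_power) auto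
      finally show ?thesis .
    qed
    moreover have "poly_filt F D w \<longrightarrow> poly_filt F D (smult c q0)"
      using *(4) G.filt_mult[of 0 "[:c:]" D q0] poly_filt_const[of 0 c] filt_power[OF c0, of e]
      by (auto simp: c_def)
    ultimately show "\<exists>q r h q0. smult (coeff \<Delta>0 s ^ K) v = q * \<Delta> + r + [:\<pi>:] ^ Suc E * h \<and>
      (\<forall>i\<ge>s. coeff r i = 0) \<and> [:\<pi>:] dvd q - q0 \<and> (poly_filt F D w \<longrightarrow> poly_filt F D q0)"
      by blast
  qed
qed

text \<open>\<open>U\<close> is the unit factor of \<open>\<Delta>\<close> in the Weierstrass preparation theorem: multiplication by it turns
  a quotient \<open>P / \<Delta>\<close> into one of bounded degree.\<close>

lemma weierstrass_unit:
  fixes \<Delta> \<Delta>0 :: "'a::idom poly"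
  assumes prime: "prime_elem \<pi>" and \<Delta>: "\<Delta> = \<Delta>0 + [:\<pi>:] * Z"
    and high: "\<And>i. i > s \<Longrightarrow> coeff \<Delta>0 i = 0" and lead: "\<not> \<pi> dvd coeff \<Delta>0 s"
    and L: "s \<le> L" "\<And>i. i > L \<Longrightarrow> coeff \<Delta> i = 0" and "E > 0"
  shows "\<exists>U t. [:\<pi>:] dvd U - [:coeff \<Delta>0 s ^ t:] \<and> (\<forall>i>L - s. coeff U i = 0) \<and>
    (\<forall>y P. (\<forall>i\<ge>L + s. coeff P i = 0) \<and> [:\<pi>:] ^ E dvd \<Delta> * y - P \<longrightarrow>
      (\<exists>g. [:\<pi>:] ^ E dvd U * y - g \<and> (\<forall>i\<ge>L. coeff g i = 0)))"
proof -
  interpret triv: ring_filtration "\<lambda>_ (_ :: 'a). True"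
    by standard auto
  have filt_triv: "poly_filt (\<lambda>_ _. True) s \<Delta>0"
    by (auto simp: poly_filt_def) (meson high not_le)
  define c0 where "c0 = coeff \<Delta>0 s"
  have \<Delta>_high: "\<pi> dvd coeff \<Delta> i" if "i > s" for i
    using that by (simp add: \<Delta> high)
  have \<Delta>_lead: "\<not> \<pi> dvd coeff \<Delta> s"
    using lead by (simp add: \<Delta> dvd_add_left_iff)
  obtain K0 where "\<And>K. K \<ge> K0 \<Longrightarrow> \<exists>q r h q0.
      smult (coeff \<Delta>0 s ^ K) (monom 1 s) = q * \<Delta> + r + [:\<pi>:] ^ E * h \<and> (\<forall>i\<ge>s. coeff r i = 0)"
    using triv.weierstrass_division[of \<Delta> \<Delta>0 \<pi> Z s "monom 1 s" "monom 1 s" 0 E 0, OF \<Delta> high filt_triv _ \<open>E > 0\<close>]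
    by auto meson
  then obtain K q r h where qr: "smult (c0 ^ K) (monom 1 s) = q * \<Delta> + r + [:\<pi>:] ^ E * h"
      "\<forall>i\<ge>s. coeff r i = 0"
    unfolding c0_def by blast
  define a where "a = c0 ^ K"
  \<comment> \<open>The Weierstrass polynomial of \<open>\<Delta>\<close> up to the scalar
    \<open>a\<close>: it has degree \<open>s\<close> and is a multiple of \<open>\<Delta>\<close>
    modulo \<open>\<pi> ^ E\<close>.\<close>
  define W where "W = smult a (monom 1 s) - r"
  have W: "coeff W s = a" "\<And>i. i > s \<Longrightarrow> coeff W i = 0"
    using qr(2) by (auto simp: W_def)
  have W_lead: "\<not> \<pi> dvd coeff W s"
    using prime_elem_dvd_power[OF prime, of c0 K] lead by (auto simp: W a_def c0_def)
  have W_eq: "W = q * \<Delta> + [:\<pi>:] ^ E * h"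
    unfolding W_def a_def qr(1) by simp
  \<comment> \<open>\<open>\<Delta>\<close> has degree at most \<open>L\<close> and \<open>W\<close>
    has degree \<open>s\<close>, so the quotient \<open>U\<close> has degree below
    \<open>L + 1 - s\<close>.\<close>
  define n where "n = Suc L - s"
  have n: "n > 0"
    using L by (simp add: n_def)
  obtain U R where UR: "smult (a ^ n) \<Delta> = U * W + R" "\<forall>i\<ge>s. coeff R i = 0" "\<forall>i\<ge>n. coeff U i = 0"
    using triv.pseudo_division[of s W n \<Delta> 0] W L by (auto simp: n_def)
  \<comment> \<open>Modulo \<open>\<pi> ^ E\<close> the remainder is a multiple of
    \<open>\<Delta>\<close> of degree below \<open>s\<close>, hence 0 by uniqueness. Thus
    \<open>U * W\<close> is \<open>\<Delta>\<close> up to a scalar.\<close>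
  have R: "[:\<pi>:] ^ E dvd R"
  proof -
    define h' where "h' = [:a ^ n:] - U * q"
    have eq: "h' * \<Delta> = R + [:\<pi>:] ^ E * (U * h)"
      using UR(1) unfolding h'_def W_eq by (simp add: algebra_simps)
    have "[:\<pi>:] ^ E dvd h'"
      by (rule weierstrass_uniqueness[OF prime \<Delta>_lead \<Delta>_high])
        (use UR(2) in \<open>auto simp: eq poly_const_pow\<close>)
    then have "[:\<pi>:] ^ E dvd h' * \<Delta>"
      by simp
    then show ?thesis
      unfolding eq by (simp add: dvd_add_left_iff)
  qed
  have mult: "\<exists>g. [:\<pi>:] ^ E dvd U * y - g \<and> (\<forall>i\<ge>L. coeff g i = 0)"
    if P: "\<forall>i\<ge>L + s. coeff P i = 0" and y: "[:\<pi>:] ^ E dvd \<Delta> * y - P" for y P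
  proof (intro exI[of _ "poly_cutoff L (U * y)"] conjI)
    \<comment> \<open>Modulo \<open>\<pi> ^ E\<close> this product is a scalar multiple of
      \<open>P\<close>, of degree below \<open>L + s\<close>. Since \<open>W\<close> has degree
      \<open>s\<close>, the degree of \<open>U * y\<close> is below \<open>L\<close>, and truncation
      does not change its class.\<close>
    have "W * (U * y) = smult (a ^ n) \<Delta> * y - R * y"
      by (simp add: UR(1) algebra_simps)
    also have "\<dots> = smult (a ^ n) P + (smult (a ^ n) (\<Delta> * y - P) - R * y)"
      by (simp add: smult_diff_right)
    finally have eq: "W * (U * y) = smult (a ^ n) P + (smult (a ^ n) (\<Delta> * y - P) - R * y)" .
    have "[:\<pi>:] ^ E dvd smult (a ^ n) (\<Delta> * y - P) - R * y"
      by (intro dvd_diff dvd_smult y dvd_mult2 R)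
    then have h1: "\<pi> ^ E dvd coeff (smult (a ^ n) (\<Delta> * y - P) - R * y) i" for i
      by (simp only: const_power_dvd_iff)
    have h2: "coeff (smult (a ^ n) P) i = 0" if "i \<ge> s + L" for i
      using P that by (simp add: add.commute)
    have "\<pi> ^ E dvd coeff (W * (U * y)) i" if "i \<ge> s + L" for i
      using h1[of i] h2[OF that] by (simp only: eq coeff_add add_0_left)
    then have high_Uy: "\<pi> ^ E dvd coeff (U * y) i" if "i \<ge> L" for i
      using dvd_coeff_cancel_leading[OF prime W_lead, of E L "U * y" i] that W(2) by simp
    then show "[:\<pi>:] ^ E dvd U * y - poly_cutoff L (U * y)"
      by (auto simp: const_power_dvd_iff coeff_poly_cutoff)
  qed (simp add: coeff_poly_cutoff)
  have \<pi>R: "\<pi> dvd coeff R i" for i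
    using R dvd_trans[OF dvd_power[of E \<pi>]] \<open>E > 0\<close> by (simp add: const_power_dvd_iff)
  have WU: "coeff (W * U) i = a ^ n * coeff \<Delta> i - coeff R i" for i
    using arg_cong[OF UR(1), of "\<lambda>p. coeff p i"] by (simp add: mult.commute[of W])
  \<comment> \<open>Modulo \<pi> the degree of \<open>W * U\<close> is that of \<open>W\<close>, so
    \<open>U\<close> is constant there. Comparing coefficients at \<open>s\<close> identifies the
    constant as \<open>a ^ (n - 1) * c0\<close>, a power of \<open>c0\<close>.\<close>
  have "\<pi> ^ 1 dvd coeff (W * U) i" if "i \<ge> s + 1" for i
    using \<Delta>_high[of i] that \<pi>R[of i] unfolding WU by (auto intro!: dvd_diff)
  then have U_high: "\<pi> dvd coeff U i" if "i \<ge> 1" for i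
    using dvd_coeff_cancel_leading[OF prime W_lead, of 1 1 U i] that W(2) by simp
  have U_low: "\<pi> dvd coeff U 0 - a ^ (n - 1) * c0"
  proof -
    have "coeff (W * U) s = a * coeff U 0 + (\<Sum>k<s. coeff W k * coeff U (s - k))"
      unfolding coeff_mult by (simp add: W lessThan_Suc_atMost[symmetric])
    then have "a * coeff U 0 - a ^ n * coeff \<Delta> s =
        - (coeff R s + (\<Sum>k<s. coeff W k * coeff U (s - k)))"
      unfolding WU by (simp add: algebra_simps)
    then have "\<pi> dvd a * coeff U 0 - a ^ n * coeff \<Delta> s"
      using \<pi>R[of s] U_high by (auto intro!: dvd_diff dvd_sum)
    moreover have "\<pi> dvd a ^ n * coeff \<Delta> s - a ^ n * c0"
      by (simp add: \<Delta> c0_def algebra_simps)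
    ultimately have "\<pi> dvd (a * coeff U 0 - a ^ n * coeff \<Delta> s) + (a ^ n * coeff \<Delta> s - a ^ n * c0)"
      by (rule dvd_add)
    also have "\<dots> = a * (coeff U 0 - a ^ (n - 1) * c0)"
      using n by (cases n) (simp_all add: algebra_simps)
    finally show ?thesis
      using W_lead prime by (auto simp: W prime_elem_dvd_mult_iff)
  qed
  have "a ^ (n - 1) * c0 = c0 ^ (K * (n - 1) + 1)"
    by (simp only: a_def power_mult power_add power_one_right)
  with U_low have "[:\<pi>:] dvd U - [:c0 ^ (K * (n - 1) + 1):]"
    using U_high by (simp add: const_poly_dvd_iff coeff_pCons del: power_Suc power_add split: nat.split)
  with mult UR(3) show ?thesis
    unfolding c0_def n_def
    by (intro exI[of _ U] exI[of _ "K * (Suc L - s - 1) + 1"]) auto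
qed

section \<open>Polynomials in infinitely many variables\<close>

type_synonym 'a mpoly = "monomial \<Rightarrow>\<^sub>0 'a"

abbreviation Const :: "'a::zero \<Rightarrow> 'a mpoly" where
  "Const \<equiv> Poly_Mapping.single 0"

abbreviation Var :: "nat \<Rightarrow> 'a::zero_neq_one mpoly" where
  "Var i \<equiv> Poly_Mapping.single (Poly_Mapping.single i (Suc 0)) 1"

definition mdeg :: "nat \<Rightarrow> monomial \<Rightarrow> nat" where
  "mdeg N m = (\<Sum>i<N. Poly_Mapping.lookup m i)"

text \<open>Variables with an index \<open>\<ge> N\<close> are treated as constants.\<close>

definition deg_le :: "nat \<Rightarrow> nat \<Rightarrow> 'a::zero mpoly \<Rightarrow> bool" where
  "deg_le N D f \<longleftrightarrow> (\<forall>m\<in>Poly_Mapping.keys f. mdeg N m \<le> D)"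

lemma mdeg_0 [simp]: "mdeg N 0 = 0"
  by (simp add: mdeg_def)

lemma mdeg_add [simp]: "mdeg N (a + b) = mdeg N a + mdeg N b"
  by (simp add: mdeg_def lookup_add sum.distrib)

lemma mdeg_single [simp]: "mdeg N (Poly_Mapping.single i k) = (if i < N then k else 0)"
  by (simp add: mdeg_def lookup_single when_def)

lemma comm_ring_homI:
  fixes \<phi> :: "'a::comm_ring_1 \<Rightarrow> 'b::comm_ring_1"
  assumes "\<And>x y. \<phi> (x + y) = \<phi> x + \<phi> y" "\<And>x y. \<phi> (x * y) = \<phi> x * \<phi> y" "\<phi> 1 = 1"
  shows "comm_ring_hom \<phi>"
proof
  have "\<phi> 0 + \<phi> 0 = \<phi> 0 + 0"
    using assms(1)[of 0 0] by simp
  then show "\<phi> 0 = 0"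
    by (simp only: add_left_cancel)
qed (use assms in auto)

lemma comm_ring_hom_comp:
  assumes "comm_ring_hom \<phi>" "comm_ring_hom \<psi>"
  shows "comm_ring_hom (\<lambda>x. \<phi> (\<psi> x))"
proof -
  interpret \<phi>: comm_ring_hom \<phi> by fact
  interpret \<psi>: comm_ring_hom \<psi> by fact
  show ?thesis
    by (rule comm_ring_homI) (simp_all add: \<phi>.hom_add \<psi>.hom_add \<phi>.hom_mult \<psi>.hom_mult)
qed

lemma comm_ring_hom_Const: "comm_ring_hom (Const :: 'a::comm_ring_1 \<Rightarrow> 'a mpoly)"
  by (rule comm_ring_homI) (simp_all add: single_add mult_single)

lemma comm_ring_hom_const_poly: "comm_ring_hom (\<lambda>c :: 'a::comm_ring_1. [:c:])"
  by (rule comm_ring_homI) simp_all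

lemma comm_ring_hom_poly_map_poly:
  assumes "comm_ring_hom \<rho>"
  shows "comm_ring_hom (\<lambda>p. poly (map_poly \<rho> p) x)"
proof -
  interpret comm_ring_hom \<rho> by fact
  define \<phi> where "\<phi> p = poly (map_poly \<rho> p) x" for p
  have 0: "\<phi> 0 = 0"
    by (simp add: \<phi>_def)
  have \<phi>_pCons: "\<phi> (pCons a p) = \<rho> a + x * \<phi> p" for a p
    by (simp add: \<phi>_def map_poly_pCons)
  have add: "\<phi> (p + q) = \<phi> p + \<phi> q" for p q
  proof (induction p arbitrary: q)
    case (pCons a p q)
    obtain b q' where q: "q = pCons b q'"
      by (cases q)
    show ?case
      using pCons.IH[of q'] by (simp add: q \<phi>_pCons hom_add algebra_simps)
  qed (simp add: 0)
  have smult: "\<phi> (smult c p) = \<rho> c * \<phi> p" for c p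
    by (induction p) (simp_all add: 0 \<phi>_pCons hom_distribs algebra_simps)
  have mult: "\<phi> (p * q) = \<phi> p * \<phi> q" for p q
    by (induction p) (simp_all add: 0 \<phi>_pCons add smult algebra_simps)
  have "\<phi> [:1:] = 1"
    by (simp only: \<phi>_pCons) (simp add: 0)
  then show ?thesis
    unfolding \<phi>_def[symmetric] by (intro comm_ring_homI add mult) (simp add: one_pCons)
qed

section \<open>Evaluation homomorphisms\<close>

definition mon_subst :: "(nat \<Rightarrow> 'b::comm_ring_1) \<Rightarrow> monomial \<Rightarrow> 'b" where
  "mon_subst \<sigma> m = (\<Prod>i\<in>Poly_Mapping.keys m. \<sigma> i ^ Poly_Mapping.lookup m i)"

definition subst :: "('a::comm_ring_1 \<Rightarrow> 'b::comm_ring_1) \<Rightarrow> (nat \<Rightarrow> 'b) \<Rightarrow> 'a mpoly \<Rightarrow> 'b" where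
  "subst \<kappa> \<sigma> f = (\<Sum>m\<in>Poly_Mapping.keys f. \<kappa> (Poly_Mapping.lookup f m) * mon_subst \<sigma> m)"

lemma mon_subst_superset:
  assumes "finite A" "Poly_Mapping.keys m \<subseteq> A"
  shows "mon_subst \<sigma> m = (\<Prod>i\<in>A. \<sigma> i ^ Poly_Mapping.lookup m i)"
  unfolding mon_subst_def using assms
  by (intro prod.mono_neutral_left) (auto simp: in_keys_iff)

lemma mon_subst_0 [simp]: "mon_subst \<sigma> 0 = 1"
  by (simp add: mon_subst_def)

lemma mon_subst_add: "mon_subst \<sigma> (a + b) = mon_subst \<sigma> a * mon_subst \<sigma> b"
proof -
  let ?A = "Poly_Mapping.keys a \<union> Poly_Mapping.keys b"
  have "mon_subst \<sigma> (a + b) = (\<Prod>i\<in>?A. \<sigma> i ^ Poly_Mapping.lookup (a + b) i)"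
    using Poly_Mapping.keys_add[of a b] by (intro mon_subst_superset) auto
  also have "\<dots> = mon_subst \<sigma> a * mon_subst \<sigma> b"
    by (simp add: mon_subst_superset[of ?A] lookup_add power_add prod.distrib)
  finally show ?thesis .
qed

lemma mpoly_eq_sum_single:
  fixes f :: "'b \<Rightarrow>\<^sub>0 'a::comm_monoid_add"
  shows "f = (\<Sum>m\<in>Poly_Mapping.keys f. Poly_Mapping.single m (Poly_Mapping.lookup f m))"
  by (rule poly_mapping_eqI) (auto simp: lookup_sum lookup_single when_def in_keys_iff)

lemma mpoly_mult_eq_sum:
  fixes f g :: "'a::comm_ring_1 mpoly"
  shows "f * g = (\<Sum>a\<in>Poly_Mapping.keys f. \<Sum>b\<in>Poly_Mapping.keys g.
    Poly_Mapping.single (a + b) (Poly_Mapping.lookup f a * Poly_Mapping.lookup g b))"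
proof -
  have "(\<Sum>m\<in>Poly_Mapping.keys f. Poly_Mapping.single m (Poly_Mapping.lookup f m)) *
      (\<Sum>m\<in>Poly_Mapping.keys g. Poly_Mapping.single m (Poly_Mapping.lookup g m)) =
    (\<Sum>a\<in>Poly_Mapping.keys f. \<Sum>b\<in>Poly_Mapping.keys g.
      Poly_Mapping.single (a + b) (Poly_Mapping.lookup f a * Poly_Mapping.lookup g b))"
    by (simp only: sum_product mult_single)
  then show ?thesis
    by (simp only: mpoly_eq_sum_single[symmetric])
qed

lemma comm_ring_hom_subst:
  assumes "comm_ring_hom \<kappa>"
  shows "comm_ring_hom (subst \<kappa> \<sigma>)"
proof -
  interpret comm_ring_hom \<kappa> by fact
  have superset: "subst \<kappa> \<sigma> f = (\<Sum>m\<in>A. \<kappa> (Poly_Mapping.lookup f m) * mon_subst \<sigma> m)"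
    if "finite A" "Poly_Mapping.keys f \<subseteq> A" for f A
    unfolding subst_def using that by (intro sum.mono_neutral_left) (auto simp: in_keys_iff)
  have add: "subst \<kappa> \<sigma> (f + g) = subst \<kappa> \<sigma> f + subst \<kappa> \<sigma> g" for f g
  proof -
    let ?A = "Poly_Mapping.keys f \<union> Poly_Mapping.keys g"
    have "subst \<kappa> \<sigma> (f + g) = (\<Sum>m\<in>?A. \<kappa> (Poly_Mapping.lookup (f + g) m) * mon_subst \<sigma> m)"
      using Poly_Mapping.keys_add[of f g] by (intro superset) auto
    also have "\<dots> = subst \<kappa> \<sigma> f + subst \<kappa> \<sigma> g"
      by (simp add: superset[of ?A] lookup_add hom_distribs distrib_right sum.distrib)
    finally show ?thesis .
  qed
  have 0: "subst \<kappa> \<sigma> 0 = 0"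
    by (simp add: subst_def)
  have sum: "subst \<kappa> \<sigma> (sum f I) = (\<Sum>i\<in>I. subst \<kappa> \<sigma> (f i))" for f :: "monomial \<Rightarrow> _" and I
    by (induction I rule: infinite_finite_induct) (auto simp: 0 add)
  have single: "subst \<kappa> \<sigma> (Poly_Mapping.single m c) = \<kappa> c * mon_subst \<sigma> m" for m c
    by (simp add: subst_def)
  have mult: "subst \<kappa> \<sigma> (f * g) = subst \<kappa> \<sigma> f * subst \<kappa> \<sigma> g" for f g
  proof -
    have "subst \<kappa> \<sigma> (f * g) = (\<Sum>a\<in>Poly_Mapping.keys f. \<Sum>b\<in>Poly_Mapping.keys g.
        (\<kappa> (Poly_Mapping.lookup f a) * mon_subst \<sigma> a) * (\<kappa> (Poly_Mapping.lookup g b) * mon_subst \<sigma> b))"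
      unfolding mpoly_mult_eq_sum[of f g] sum mult_single single mon_subst_add hom_mult by (simp only: mult_ac)
    also have "\<dots> = subst \<kappa> \<sigma> f * subst \<kappa> \<sigma> g"
      by (simp add: sum_product subst_def)
    finally show ?thesis .
  qed
  show ?thesis
    by (intro comm_ring_homI add mult) (simp add: subst_def)
qed

lemma subst_single: "comm_ring_hom \<kappa> \<Longrightarrow> subst \<kappa> \<sigma> (Poly_Mapping.single m c) = \<kappa> c * mon_subst \<sigma> m"
  by (cases "c = 0") (simp_all add: subst_def comm_ring_hom_def ring_hom_def semiring_hom_def
      comm_monoid_add_hom_def monoid_add_hom_def zero_hom_def)

lemma subst_Const [simp]: "comm_ring_hom \<kappa> \<Longrightarrow> subst \<kappa> \<sigma> (Const c) = \<kappa> c"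
  by (simp add: subst_single)

lemma subst_Var [simp]: "comm_ring_hom \<kappa> \<Longrightarrow> subst \<kappa> \<sigma> (Var i) = \<sigma> i"
proof -
  assume "comm_ring_hom \<kappa>"
  then interpret comm_ring_hom \<kappa> .
  show ?thesis
    using \<open>comm_ring_hom \<kappa>\<close> by (simp add: subst_single mon_subst_def)
qed

lemma Var_power: "(Var i :: 'a::comm_ring_1 mpoly) ^ k = Poly_Mapping.single (Poly_Mapping.single i k) 1"
  by (induction k) (simp_all add: mult_single flip: single_add)

lemma prod_single_one:
  "(\<Prod>i\<in>A. (Poly_Mapping.single (a i) 1 :: 'a::comm_ring_1 mpoly)) = Poly_Mapping.single (\<Sum>i\<in>A. a i) 1"
  by (induction A rule: infinite_finite_induct) (simp_all add: mult_single)

lemma mon_subst_Var: "mon_subst Var m = (Poly_Mapping.single m 1 :: 'a::comm_ring_1 mpoly)"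
  unfolding mon_subst_def Var_power prod_single_one using mpoly_eq_sum_single[of m] by simp

lemma hom_eq_subst:
  assumes "comm_ring_hom \<phi>"
  shows "\<phi> f = subst (\<lambda>c. \<phi> (Const c)) (\<lambda>i. \<phi> (Var i)) f"
proof -
  interpret comm_ring_hom \<phi> by fact
  have mon: "\<phi> (Poly_Mapping.single m 1) = mon_subst (\<lambda>i. \<phi> (Var i)) m" for m
  proof -
    have "\<phi> (mon_subst Var m) = mon_subst (\<lambda>i. \<phi> (Var i)) m"
      unfolding mon_subst_def by (simp only: hom_prod hom_power)
    then show ?thesis
      by (simp only: mon_subst_Var)
  qed
  have single: "\<phi> (Poly_Mapping.single m c) = \<phi> (Const c) * mon_subst (\<lambda>i. \<phi> (Var i)) m" for m c
  proof -
    have "\<phi> (Poly_Mapping.single m c) = \<phi> (Const c) * \<phi> (Poly_Mapping.single m 1)"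
      unfolding hom_mult[symmetric] by (simp only: mult_single add_0_left mult_1_right)
    then show ?thesis
      unfolding mon[of m] .
  qed
  have "\<phi> (\<Sum>m\<in>Poly_Mapping.keys f. Poly_Mapping.single m (Poly_Mapping.lookup f m)) =
      subst (\<lambda>c. \<phi> (Const c)) (\<lambda>i. \<phi> (Var i)) f"
    unfolding subst_def hom_sum by (intro sum.cong refl single)
  then show ?thesis
    by (simp only: mpoly_eq_sum_single[symmetric])
qed

lemma mpoly_hom_eqI:
  assumes "comm_ring_hom \<phi>" "comm_ring_hom \<psi>"
    and "\<And>c. \<phi> (Const c) = \<psi> (Const c)" "\<And>i. \<phi> (Var i) = \<psi> (Var i)"
  shows "\<phi> f = \<psi> f"
  using hom_eq_subst[OF assms(1), of f] hom_eq_subst[OF assms(2), of f] assms(3,4) by simp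

lemma (in ring_filtration) filt_mon_subst:
  assumes "\<And>i. F (if i < N then 1 else 0) (\<sigma> i)"
  shows "F (mdeg N m) (mon_subst \<sigma> m)"
proof -
  have "mdeg N m = (\<Sum>i\<in>{..<N} \<union> Poly_Mapping.keys m. (if i < N then 1 else 0) * Poly_Mapping.lookup m i)"
    unfolding mdeg_def by (intro sum.mono_neutral_cong_left) auto
  also have "\<dots> = (\<Sum>i\<in>Poly_Mapping.keys m. (if i < N then 1 else 0) * Poly_Mapping.lookup m i)"
    by (intro sum.mono_neutral_right) (auto simp: in_keys_iff)
  finally have "mdeg N m = (\<Sum>i\<in>Poly_Mapping.keys m. (if i < N then 1 else 0) * Poly_Mapping.lookup m i)" .
  then show ?thesis
    unfolding mon_subst_def by (simp only:) (intro filt_prod filt_power assms)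
qed

lemma (in ring_filtration) filt_subst:
  assumes "\<And>c. F 0 (\<kappa> c)" "\<And>i. F (if i < N then 1 else 0) (\<sigma> i)" "deg_le N D f"
  shows "F D (subst \<kappa> \<sigma> f)"
  unfolding subst_def
proof (rule filt_sum)
  fix m assume "m \<in> Poly_Mapping.keys f"
  then have "mdeg N m \<le> D"
    using assms(3) by (auto simp: deg_le_def)
  then show "F D (\<kappa> (Poly_Mapping.lookup f m) * mon_subst \<sigma> m)"
    using filt_mult[OF assms(1) filt_mon_subst[OF assms(2), of m]] by (auto intro: filt_mono)
qed

section \<open>Degrees and divisibility by constants\<close>

lemma ring_filtration_deg_le: "ring_filtration (deg_le N :: nat \<Rightarrow> 'a::comm_ring_1 mpoly \<Rightarrow> bool)"
proof
  fix a b n :: nat and x y :: "'a mpoly"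
  show "deg_le N n 0" "deg_le N 0 1"
    by (auto simp: deg_le_def)
  show "deg_le N n (x + y)" if "deg_le N n x" "deg_le N n y"
    using that Poly_Mapping.keys_add[of x y] by (auto simp: deg_le_def)
  show "deg_le N n (- x)" if "deg_le N n x"
    using that by (auto simp: deg_le_def in_keys_iff)
  show "deg_le N (a + b) (x * y)" if "deg_le N a x" "deg_le N b y"
    using that keys_mult[of x y] by (fastforce simp: deg_le_def intro: add_mono)
  show "deg_le N b x" if "deg_le N a x" "a \<le> b"
    using that by (auto simp: deg_le_def)
qed

lemma deg_le_single [simp]: "deg_le N D (Poly_Mapping.single m c) \<longleftrightarrow> c = 0 \<or> mdeg N m \<le> D"
  by (simp add: deg_le_def)

lemma deg_le_one [simp]: "deg_le N D (1 :: 'a::zero_neq_one mpoly)"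
  by (simp add: deg_le_def)

lemma lookup_Const_mult: "Poly_Mapping.lookup (Const c * f) m = c * Poly_Mapping.lookup f m"
  for c :: "'a::comm_ring_1"
  by (simp add: mult_map_scale_conv_mult[symmetric] Poly_Mapping.map.rep_eq when_def)

lemma deg_le_Const_mult_cancel:
  "deg_le N D (Const c * f) \<Longrightarrow> c \<noteq> 0 \<Longrightarrow> deg_le N D f" for c :: "'a::idom"
  by (auto simp: deg_le_def in_keys_iff lookup_Const_mult)

lemma Const_dvd_iff: "Const c dvd f \<longleftrightarrow> (\<forall>m. c dvd Poly_Mapping.lookup f m)" for c :: "'a::comm_ring_1"
proof
  assume "\<forall>m. c dvd Poly_Mapping.lookup f m"
  then have "Const c dvd Poly_Mapping.single m (Poly_Mapping.lookup f m)" for m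
    by (metis dvd_def mult_single add_0)
  then have "Const c dvd (\<Sum>m\<in>Poly_Mapping.keys f. Poly_Mapping.single m (Poly_Mapping.lookup f m))"
    by (intro dvd_sum) auto
  then show "Const c dvd f"
    by (simp only: mpoly_eq_sum_single[symmetric])
qed (auto simp: lookup_Const_mult)

lemma Const_power: "Const c ^ k = Const (c ^ k)" for c :: "'a::comm_ring_1"
  by (induction k) (simp_all add: mult_single)

definition mpart :: "(monomial \<Rightarrow> bool) \<Rightarrow> 'a::comm_monoid_add mpoly \<Rightarrow> 'a mpoly" where
  "mpart P f = (\<Sum>m\<in>{m\<in>Poly_Mapping.keys f. P m}. Poly_Mapping.single m (Poly_Mapping.lookup f m))"

lemma lookup_mpart: "Poly_Mapping.lookup (mpart P f) m = (if P m then Poly_Mapping.lookup f m else 0)"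
  by (auto simp: mpart_def lookup_sum lookup_single when_def in_keys_iff)

lemma keys_mpart: "Poly_Mapping.keys (mpart P f) = {m\<in>Poly_Mapping.keys f. P m}"
  by (auto simp: in_keys_iff lookup_mpart split: if_splits)

text \<open>The representative keeps only coefficients that are nonzero modulo \<pi>. Degree and
  leading term of the residue class can be read off from it, which avoids quotient rings.\<close>

lemma mod_Const_representative:
  fixes \<pi> :: "'a::comm_ring_1"
  shows "Const \<pi> dvd f - mpart (\<lambda>m. \<not> \<pi> dvd Poly_Mapping.lookup f m) f"
  by (simp add: Const_dvd_iff lookup_minus lookup_mpart)

text \<open>The linear order on monomials is compatible with addition, so no other pair of terms
  contributes to the product of the leading ones.\<close>

lemma lookup_mult_Max:
  fixes f g :: "'a::comm_ring_1 mpoly"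
  assumes "f \<noteq> 0" "g \<noteq> 0"
  defines "a \<equiv> Max (Poly_Mapping.keys f)" and "b \<equiv> Max (Poly_Mapping.keys g)"
  shows "Poly_Mapping.lookup (f * g) (a + b) = Poly_Mapping.lookup f a * Poly_Mapping.lookup g b"
proof -
  have ab: "a \<in> Poly_Mapping.keys f" "b \<in> Poly_Mapping.keys g"
    unfolding a_def b_def using assms by (auto intro!: Max_in)
  have max: "a' + b' = a + b \<longleftrightarrow> a' = a \<and> b' = b"
    if "a' \<in> Poly_Mapping.keys f" "b' \<in> Poly_Mapping.keys g" for a' b'
  proof -
    have "a' \<le> a" "b' \<le> b"
      using that by (auto simp: a_def b_def)
    then show ?thesis
      by (metis add_less_le_mono add_le_less_mono order_le_less order_less_irrefl)
  qed
  have "Poly_Mapping.lookup (f * g) (a + b) =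
      (\<Sum>a'\<in>Poly_Mapping.keys f. \<Sum>b'\<in>Poly_Mapping.keys g.
        (if a' + b' = a + b then Poly_Mapping.lookup f a' * Poly_Mapping.lookup g b' else 0))"
    by (subst mpoly_mult_eq_sum) (simp add: lookup_sum lookup_single when_def)
  also have "\<dots> = (\<Sum>a'\<in>Poly_Mapping.keys f. if a' = a then \<Sum>b'\<in>Poly_Mapping.keys g.
        if b' = b then Poly_Mapping.lookup f a * Poly_Mapping.lookup g b else 0 else 0)"
    by (intro sum.cong[OF refl]) (auto simp: max intro!: sum.cong sum.neutral)
  also have "\<dots> = Poly_Mapping.lookup f a * Poly_Mapping.lookup g b"
    using ab by (simp add: sum.delta)
  finally show ?thesis .
qed

text \<open>Gauss's lemma. For representatives without coefficients divisible by \<pi>, the product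
  of the leading coefficients would have to be divisible by \<pi>.\<close>

lemma prime_elem_Const:
  fixes \<pi> :: "'a::idom"
  assumes prime: "prime_elem \<pi>"
  shows "prime_elem (Const \<pi>)"
proof (rule prime_elemI)
  show "Const \<pi> \<noteq> 0"
    using prime by (metis lookup_single_eq lookup_zero prime_elem_def)
  show "\<not> Const \<pi> dvd 1"
    using prime by (auto simp: Const_dvd_iff intro!: exI[of _ 0] dest: prime_elem_not_unit)
  fix f g :: "'a mpoly"
  assume dvd: "Const \<pi> dvd f * g"
  show "Const \<pi> dvd f \<or> Const \<pi> dvd g"
  proof (rule ccontr)
    assume nd: "\<not> (Const \<pi> dvd f \<or> Const \<pi> dvd g)"
    define f0 where "f0 = mpart (\<lambda>m. \<not> \<pi> dvd Poly_Mapping.lookup f m) f"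
    define g0 where "g0 = mpart (\<lambda>m. \<not> \<pi> dvd Poly_Mapping.lookup g m) g"
    have mod: "Const \<pi> dvd f - f0" "Const \<pi> dvd g - g0"
      unfolding f0_def g0_def by (rule mod_Const_representative)+
    then have nz: "f0 \<noteq> 0" "g0 \<noteq> 0"
      using nd by auto
    have "f0 * g0 = f * g - (f - f0) * g - f0 * (g - g0)"
      by (simp add: algebra_simps)
    then have "Const \<pi> dvd f0 * g0"
      using dvd mod by (auto intro!: dvd_diff)
    then have "\<pi> dvd Poly_Mapping.lookup f0 (Max (Poly_Mapping.keys f0)) *
        Poly_Mapping.lookup g0 (Max (Poly_Mapping.keys g0))"
      unfolding lookup_mult_Max[OF nz, symmetric] by (simp add: Const_dvd_iff)
    moreover have "Max (Poly_Mapping.keys f0) \<in> Poly_Mapping.keys f0" "Max (Poly_Mapping.keys g0) \<in> Poly_Mapping.keys g0"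
      using nz by (auto intro!: Max_in)
    ultimately show False
      using prime by (auto simp: f0_def g0_def keys_mpart lookup_mpart prime_elem_dvd_mult_iff)
  qed
qed

lemma Const_separated:
  fixes \<pi> :: "'a::comm_ring_1"
  assumes "\<And>x. x \<noteq> 0 \<Longrightarrow> \<exists>k. \<not> \<pi> ^ k dvd x" and "f \<noteq> 0"
  shows "\<exists>k. \<not> Const \<pi> ^ k dvd f"
proof -
  obtain m where "Poly_Mapping.lookup f m \<noteq> 0"
    using \<open>f \<noteq> 0\<close> by (metis poly_mapping_eqI lookup_zero)
  then show ?thesis
    using assms(1) by (fastforce simp: Const_power Const_dvd_iff)
qed

section \<open>A linear change of coordinates\<close>

text \<open>\<open>chart N K\<close> turns \<open>x\<^sub>0\<close> into the variable of \<open>poly\<close> and shifts the others, with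
  \<open>x\<^sub>j\<^sub>+\<^sub>1\<close> sent to \<open>x\<^sub>j + x\<^sub>K\<^sub>+\<^sub>j X\<close> for \<open>j < N\<close>; \<open>unchart N K\<close> is its inverse.  For \<open>K\<close> beyond the variables
  of a given polynomial, the slopes \<open>x\<^sub>K\<^sub>+\<^sub>j\<close> are generic, which makes it regular in \<open>X\<close>.\<close>

definition chart :: "nat \<Rightarrow> nat \<Rightarrow> 'a::comm_ring_1 mpoly \<Rightarrow> 'a mpoly poly" where
  "chart N K = subst (\<lambda>c. [:Const c:])
    (\<lambda>i. case i of 0 \<Rightarrow> [:0, 1:] | Suc j \<Rightarrow> [:Var j, if j < N then Var (K + j) else 0:])"

definition unshift :: "nat \<Rightarrow> nat \<Rightarrow> 'a::comm_ring_1 mpoly \<Rightarrow> 'a mpoly" where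
  "unshift N K = subst Const (\<lambda>i. Var (Suc i) - (if i < N then Var (Suc (K + i)) * Var 0 else 0))"

definition unchart :: "nat \<Rightarrow> nat \<Rightarrow> 'a::comm_ring_1 mpoly poly \<Rightarrow> 'a mpoly" where
  "unchart N K p = poly (map_poly (unshift N K) p) (Var 0)"

lemma comm_ring_hom_const_Const: "comm_ring_hom (\<lambda>c :: 'a::comm_ring_1. [:Const c:])"
  by (rule comm_ring_hom_comp[OF comm_ring_hom_const_poly comm_ring_hom_Const])

lemma comm_ring_hom_chart: "comm_ring_hom (chart N K)"
  unfolding chart_def by (rule comm_ring_hom_subst[OF comm_ring_hom_const_Const])

lemma comm_ring_hom_unshift: "comm_ring_hom (unshift N K)"
  unfolding unshift_def by (rule comm_ring_hom_subst[OF comm_ring_hom_Const])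

lemma comm_ring_hom_unchart: "comm_ring_hom (unchart N K)"
  unfolding unchart_def by (rule comm_ring_hom_poly_map_poly[OF comm_ring_hom_unshift])

lemma unchart_const: "unchart N K [:c:] = unshift N K c"
proof -
  interpret comm_ring_hom "unshift N K"
    by (rule comm_ring_hom_unshift)
  show ?thesis
    by (simp add: unchart_def map_poly_pCons)
qed

lemma unshift_Const [simp]: "unshift N K (Const c) = Const c"
  by (simp add: unshift_def comm_ring_hom_Const)

lemma unshift_Var: "unshift N K (Var i) = Var (Suc i) - (if i < N then Var (Suc (K + i)) * Var 0 else 0)"
  by (simp add: unshift_def comm_ring_hom_Const)

lemma chart_Const [simp]: "chart N K (Const c) = [:Const c:]"
  by (simp add: chart_def comm_ring_hom_const_Const)

lemma chart_Var: "chart N K (Var i) =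
    (case i of 0 \<Rightarrow> [:0, 1:] | Suc j \<Rightarrow> [:Var j, if j < N then Var (K + j) else 0:])"
  by (simp add: chart_def comm_ring_hom_const_Const)

text \<open>\<open>N \<le> K\<close> places the slopes among the scalars, whose indices are only
  shifted; otherwise the substitution would alter the slopes that it uses.\<close>

lemma unchart_chart:
  fixes f :: "'a::comm_ring_1 mpoly"
  assumes "N \<le> K"
  shows "unchart N K (chart N K f) = f"
proof -
  interpret un: comm_ring_hom "unshift N K :: 'a mpoly \<Rightarrow> _"
    by (rule comm_ring_hom_unshift)
  have linear: "unchart N K [:a, b:] = unshift N K a + unshift N K b * Var 0"
    for a b :: "'a mpoly"
    by (simp add: unchart_def map_poly_pCons mult.commute)
  have Var: "unchart N K (chart N K (Var i)) = (Var i :: 'a mpoly)" for i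
    using assms by (cases i) (auto simp: chart_Var linear unshift_Var)
  have id: "comm_ring_hom (\<lambda>f :: 'a mpoly. f)"
    by (rule comm_ring_homI) simp_all
  show ?thesis
    by (rule mpoly_hom_eqI[OF comm_ring_hom_comp[OF comm_ring_hom_unchart comm_ring_hom_chart] id _ Var])
      (simp add: unchart_const)
qed

lemma chart_unshift:
  fixes f :: "'a::comm_ring_1 mpoly"
  assumes "N \<le> K"
  shows "chart N K (unshift N K f) = [:f:]"
proof -
  interpret ch: comm_ring_hom "chart N K :: 'a mpoly \<Rightarrow> _"
    by (rule comm_ring_hom_chart)
  have Var: "chart N K (unshift N K (Var i)) = [:Var i :: 'a mpoly:]" for i
    using assms by (auto simp: unshift_Var ch.hom_minus ch.hom_mult chart_Var)
  show ?thesis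
    by (rule mpoly_hom_eqI[OF comm_ring_hom_comp[OF comm_ring_hom_chart comm_ring_hom_unshift]
      comm_ring_hom_const_poly _ Var]) simp
qed

lemma poly_filt_chart:
  fixes f :: "'a::comm_ring_1 mpoly"
  assumes "N \<le> K" "deg_le (Suc N) D f"
  shows "poly_filt (deg_le N) D (chart N K f)"
proof -
  interpret ring_filtration "poly_filt (deg_le N :: nat \<Rightarrow> 'a mpoly \<Rightarrow> bool)"
    by (intro ring_filtration.ring_filtration_poly_filt ring_filtration_deg_le)
  show ?thesis
    unfolding chart_def
    by (rule filt_subst[OF _ _ assms(2)])
      (use assms(1) in \<open>auto simp: poly_filt_def coeff_pCons split: nat.splits if_splits\<close>)
qed

lemma deg_le_unshift:
  fixes f :: "'a::comm_ring_1 mpoly"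
  assumes "N \<le> K" "deg_le N D f"
  shows "deg_le (Suc N) D (unshift N K f)"
proof -
  interpret ring_filtration "deg_le (Suc N) :: nat \<Rightarrow> 'a mpoly \<Rightarrow> bool"
    by (rule ring_filtration_deg_le)
  have "deg_le (Suc N) 1 (Var (Suc i) - Var (Suc (K + i)) * Var 0 :: 'a mpoly)" for i
    using assms(1) by (intro filt_diff) (auto simp: mult_single)
  then show ?thesis
    unfolding unshift_def
    by (intro filt_subst[OF _ _ assms(2)]) auto
qed

lemma deg_le_unchart:
  fixes p :: "'a::comm_ring_1 mpoly poly"
  assumes "N \<le> K" "poly_filt (deg_le N) D p"
  shows "deg_le (Suc N) D (unchart N K p)"
proof -
  interpret ring_filtration "deg_le (Suc N) :: nat \<Rightarrow> 'a mpoly \<Rightarrow> bool"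
    by (rule ring_filtration_deg_le)
  interpret un: comm_ring_hom "unshift N K :: 'a mpoly \<Rightarrow> _"
    by (rule comm_ring_hom_unshift)
  have "unchart N K p = (\<Sum>i\<le>degree (map_poly (unshift N K) p). unshift N K (coeff p i) * Var 0 ^ i)"
    unfolding unchart_def poly_altdef by (simp add: coeff_map_poly)
  moreover have "deg_le (Suc N) D (unshift N K (coeff p i) * Var 0 ^ i)" for i
  proof (cases "coeff p i = 0")
    case False
    then have i: "i \<le> D" "deg_le N (D - i) (coeff p i)"
      using assms(2) by (auto simp: poly_filt_def)
    have "deg_le (Suc N) ((D - i) + 1 * i) (unshift N K (coeff p i) * Var 0 ^ i)"
      by (intro filt_mult deg_le_unshift[OF assms(1) i(2)] filt_power) simp
    then show ?thesis
      using i by simp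
  qed (simp add: filt_zero)
  ultimately show ?thesis
    by (auto intro: filt_sum)
qed

lemma coeff_mult_top:
  assumes "degree p \<le> a" "degree q \<le> b"
  shows "coeff (p * q) (a + b) = coeff p a * coeff q b"
proof -
  have "coeff (p * q) (a + b) = coeff p a * coeff q (a + b - a) +
      (\<Sum>i\<in>{..a + b} - {a}. coeff p i * coeff q (a + b - i))"
    unfolding coeff_mult by (rule sum.remove) auto
  also have "(\<Sum>i\<in>{..a + b} - {a}. coeff p i * coeff q (a + b - i)) = 0"
  proof (rule sum.neutral, rule ballI)
    fix i assume "i \<in> {..a + b} - {a}"
    then consider "i > a" | "a + b - i > b"
      by fastforce
    then show "coeff p i * coeff q (a + b - i) = 0"
      using assms by cases (auto simp: coeff_eq_0)
  qed
  finally show ?thesis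
    by simp
qed

lemma coeff_mon_subst_top:
  fixes \<sigma> :: "nat \<Rightarrow> 'a::comm_ring_1 poly"
  assumes "\<And>i. degree (\<sigma> i) \<le> (if i < N then 1 else 0)"
  shows "degree (mon_subst \<sigma> m) \<le> mdeg N m"
    and "coeff (mon_subst \<sigma> m) (mdeg N m) = mon_subst (\<lambda>i. coeff (\<sigma> i) (if i < N then 1 else 0)) m"
proof -
  interpret ring_filtration "\<lambda>D (p :: 'a poly). degree p \<le> D"
  proof
    show "degree (p + q) \<le> n" if "degree p \<le> n" "degree q \<le> n" for p q :: "'a poly" and n
      using that by (rule degree_add_le)
    show "degree (p * q) \<le> a + b" if "degree p \<le> a" "degree q \<le> b" for p q :: "'a poly" and a b
      using that degree_mult_le[of p q] by simp
  qed auto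
  show "degree (mon_subst \<sigma> m) \<le> mdeg N m"
    by (rule filt_mon_subst[OF assms])
  define w where "w i = (if i < N then 1 else 0 :: nat)" for i
  have pow: "coeff (\<sigma> i ^ k) (w i * k) = coeff (\<sigma> i) (w i) ^ k" for i k
  proof (induction k)
    case (Suc k)
    then show ?case
      using coeff_mult_top[OF assms[of i] filt_power[OF assms[of i], of k]] by (simp add: w_def)
  qed simp
  have prod: "coeff (\<Prod>i\<in>A. \<sigma> i ^ k i) (\<Sum>i\<in>A. w i * k i) = (\<Prod>i\<in>A. coeff (\<sigma> i) (w i) ^ k i)"
    for k and A :: "nat set"
  proof (induction A rule: infinite_finite_induct)
    case (insert x A)
    have "degree (\<sigma> i ^ k i) \<le> w i * k i" for i
      unfolding w_def by (rule filt_power[OF assms])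
    then show ?case
      using insert coeff_mult_top[of "\<sigma> x ^ k x" "w x * k x" "\<Prod>i\<in>A. \<sigma> i ^ k i" "\<Sum>i\<in>A. w i * k i"]
        filt_prod[of A "\<lambda>i. \<sigma> i ^ k i" "\<lambda>i. w i * k i"] by (simp add: pow)
  qed auto
  have "mdeg N m = (\<Sum>i\<in>Poly_Mapping.keys m. w i * Poly_Mapping.lookup m i)"
  proof -
    have "mdeg N m = (\<Sum>i\<in>{..<N} \<union> Poly_Mapping.keys m. w i * Poly_Mapping.lookup m i)"
      unfolding mdeg_def w_def by (intro sum.mono_neutral_cong_left) auto
    also have "\<dots> = (\<Sum>i\<in>Poly_Mapping.keys m. w i * Poly_Mapping.lookup m i)"
      by (intro sum.mono_neutral_right) (auto simp: in_keys_iff)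
    finally show ?thesis .
  qed
  then show "coeff (mon_subst \<sigma> m) (mdeg N m) = mon_subst (\<lambda>i. coeff (\<sigma> i) (if i < N then 1 else 0)) m"
    unfolding mon_subst_def w_def[symmetric] by (simp add: prod)
qed

text \<open>Only monomials of top degree \<open>s\<close> reach the power \<open>s\<close> of
  \<open>X\<close>, each contributing its coefficient times the monomial \<open>\<mu> m\<close> in
  slopes and old scalars. As \<open>K\<close> lies beyond the variables of \<open>f\<close>, slopes
  and old scalars are different, so \<open>\<mu> m\<close> determines all exponents of
  \<open>m\<close> except that of \<open>x\<^sub>0\<close>, and the degree \<open>s\<close>
  determines that one. Hence no terms cancel.\<close>

lemma chart_leading_coeff:
  fixes f :: "'a::comm_ring_1 mpoly"
  assumes "N < K" and deg: "deg_le (Suc N) s f"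
    and vars: "\<And>m. m \<in> Poly_Mapping.keys f \<Longrightarrow> Poly_Mapping.keys m \<subseteq> {..<K}"
    and m0: "m0 \<in> Poly_Mapping.keys f" "mdeg (Suc N) m0 = s" "\<not> \<pi> dvd Poly_Mapping.lookup f m0"
  shows "\<not> Const \<pi> dvd coeff (chart N K f) s"
proof -
  define \<sigma> :: "nat \<Rightarrow> 'a mpoly poly" where
    "\<sigma> i = (case i of 0 \<Rightarrow> [:0, 1:] | Suc j \<Rightarrow> [:Var j, if j < N then Var (K + j) else 0:])" for i
  define \<rho> where "\<rho> j = (if j < N then K + j else j)" for j
  \<comment> \<open>The exponent vector of the \<open>k\<close>-th power of the top coefficient of
    the image of variable \<open>i\<close>; \<open>x\<^sub>0\<close> becomes \<open>X\<close>, with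
    coefficient 1, and leaves no trace.\<close>
  define e where "e i k = (case i of 0 \<Rightarrow> 0 | Suc j \<Rightarrow> Poly_Mapping.single (\<rho> j) k)" for i and k :: nat
  define \<mu> where "\<mu> m = (\<Sum>i\<in>Poly_Mapping.keys m. e i (Poly_Mapping.lookup m i))" for m
  have deg_\<sigma>: "degree (\<sigma> i) \<le> (if i < Suc N then 1 else 0)" for i
    by (auto simp: \<sigma>_def split: nat.split)
  have pow: "coeff (\<sigma> i) (if i < Suc N then 1 else 0) ^ k = Poly_Mapping.single (e i k) 1" for i k
    by (cases i) (auto simp: \<sigma>_def e_def \<rho>_def Var_power)
  have top: "coeff (mon_subst \<sigma> m) (mdeg (Suc N) m) = Poly_Mapping.single (\<mu> m) 1" for m
  proof -
    have "mon_subst (\<lambda>i. coeff (\<sigma> i) (if i < Suc N then 1 else 0)) m = Poly_Mapping.single (\<mu> m) 1"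
      unfolding mon_subst_def \<mu>_def pow prod_single_one ..
    then show ?thesis
      using coeff_mon_subst_top(2)[of \<sigma> "Suc N" m, OF deg_\<sigma>] by (rule trans[rotated])
  qed
  have \<rho>_inj: "\<rho> j = \<rho> j' \<longleftrightarrow> j = j'" if "Suc j < K" "Suc j' < K" for j j'
    using that by (auto simp: \<rho>_def)
  have lookup_\<mu>: "Poly_Mapping.lookup (\<mu> m) (\<rho> j) = Poly_Mapping.lookup m (Suc j)"
    if m: "Poly_Mapping.keys m \<subseteq> {..<K}" and j: "Suc j < K" for m j
  proof -
    have "Poly_Mapping.lookup (\<mu> m) (\<rho> j) = (\<Sum>i\<in>Poly_Mapping.keys m. if i = Suc j then Poly_Mapping.lookup m i else 0)"
      unfolding \<mu>_def lookup_sum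
    proof (rule sum.cong[OF refl])
      fix i assume "i \<in> Poly_Mapping.keys m"
      then have "i < K"
        using m by auto
      then show "Poly_Mapping.lookup (e i (Poly_Mapping.lookup m i)) (\<rho> j) =
          (if i = Suc j then Poly_Mapping.lookup m i else 0)"
        using \<rho>_inj[of "i - 1" j] j by (cases i) (auto simp: e_def lookup_single when_def)
    qed
    then show ?thesis
      by (auto simp: in_keys_iff)
  qed
  have \<mu>_inj: "m = m0" if "m \<in> Poly_Mapping.keys f" "mdeg (Suc N) m = s" "\<mu> m = \<mu> m0" for m
  proof (rule poly_mapping_eqI)
    fix i
    have Suc_eq: "Poly_Mapping.lookup m (Suc j) = Poly_Mapping.lookup m0 (Suc j)" for j
    proof (cases "Suc j < K")
      case True
      then show ?thesis
        using lookup_\<mu>[OF vars, of m j] lookup_\<mu>[OF vars, of m0 j] that m0 by simp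
    next
      case False
      then have "Suc j \<notin> Poly_Mapping.keys m" "Suc j \<notin> Poly_Mapping.keys m0"
        using vars that m0 by (auto dest!: subsetD)
      then show ?thesis
        by (simp add: in_keys_iff)
    qed
    have "Poly_Mapping.lookup m 0 = Poly_Mapping.lookup m0 0"
      using that(2) m0(2) unfolding mdeg_def sum.lessThan_Suc_shift Suc_eq by linarith
    then show "Poly_Mapping.lookup m i = Poly_Mapping.lookup m0 i"
      using Suc_eq by (cases i) auto
  qed
  have "coeff (chart N K f) s =
      (\<Sum>m\<in>Poly_Mapping.keys f. Const (Poly_Mapping.lookup f m) * coeff (mon_subst \<sigma> m) s)"
    unfolding chart_def subst_def by (simp add: coeff_sum \<sigma>_def[abs_def])
  also have "\<dots> = (\<Sum>m\<in>Poly_Mapping.keys f. if mdeg (Suc N) m = s then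
      Poly_Mapping.single (\<mu> m) (Poly_Mapping.lookup f m) else 0)"
  proof (rule sum.cong[OF refl])
    fix m assume "m \<in> Poly_Mapping.keys f"
    then have "mdeg (Suc N) m \<le> s"
      using deg by (auto simp: deg_le_def)
    then have "mdeg (Suc N) m \<noteq> s \<Longrightarrow> coeff (mon_subst \<sigma> m) s = 0"
      using coeff_mon_subst_top(1)[of \<sigma> "Suc N" m, OF deg_\<sigma>] by (intro coeff_eq_0) simp
    then show "Const (Poly_Mapping.lookup f m) * coeff (mon_subst \<sigma> m) s =
        (if mdeg (Suc N) m = s then Poly_Mapping.single (\<mu> m) (Poly_Mapping.lookup f m) else 0)"
      using top[of m] by (auto simp: mult_single)
  qed
  finally have coeff_eq: "coeff (chart N K f) s = (\<Sum>m\<in>Poly_Mapping.keys f. if mdeg (Suc N) m = s then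
      Poly_Mapping.single (\<mu> m) (Poly_Mapping.lookup f m) else 0)" .
  have "Poly_Mapping.lookup (coeff (chart N K f) s) (\<mu> m0) =
      (\<Sum>m\<in>Poly_Mapping.keys f. if m = m0 then Poly_Mapping.lookup f m else 0)"
    unfolding coeff_eq lookup_sum
  proof (rule sum.cong[OF refl])
    fix m assume "m \<in> Poly_Mapping.keys f"
    then show "Poly_Mapping.lookup (if mdeg (Suc N) m = s then Poly_Mapping.single (\<mu> m) (Poly_Mapping.lookup f m) else 0) (\<mu> m0) =
        (if m = m0 then Poly_Mapping.lookup f m else 0)"
      using \<mu>_inj[of m] m0(2) by (auto simp: lookup_single when_def)
  qed
  then have "Poly_Mapping.lookup (coeff (chart N K f) s) (\<mu> m0) = Poly_Mapping.lookup f m0"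
    using m0 by simp
  then show ?thesis
    using m0 by (auto simp: Const_dvd_iff intro!: exI[of _ "\<mu> m0"])
qed

section \<open>Lifting kernel vectors\<close>

text \<open>Pairs (\<open>j\<close>, \<open>t\<close>) with \<open>t < L\<close> are coded as
  \<open>j * L + t\<close>. This flattens a system with polynomial unknowns into one for their
  coefficients.\<close>

lemma sum_div_mod:
  fixes f :: "nat \<Rightarrow> nat \<Rightarrow> 'a::comm_monoid_add"
  shows "(\<Sum>a<n * L. f (a div L) (a mod L)) = (\<Sum>j<n. \<Sum>t<L. f j t)"
proof -
  have "(\<Sum>a<n * L. f (a div L) (a mod L)) = (\<Sum>j<n. \<Sum>a\<in>{j * L..<j * L + L}. f (a div L) (a mod L))"
    by (rule sum.nat_group[symmetric])
  also have "\<dots> = (\<Sum>j<n. \<Sum>t<L. f j t)"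
  proof (rule sum.cong[OF refl])
    fix j
    show "(\<Sum>a\<in>{j * L..<j * L + L}. f (a div L) (a mod L)) = (\<Sum>t<L. f j t)"
    proof (rule sum.reindex_bij_witness[of _ "\<lambda>t. j * L + t" "\<lambda>a. a - j * L"])
      fix a assume "a \<in> {j * L..<j * L + L}"
      then obtain t where t: "a = j * L + t" "t < L"
        by (metis atLeastLessThan_iff le_Suc_ex add_less_cancel_left)
      then show "f j (a - j * L) = f (a div L) (a mod L)"
        by simp
    qed auto
  qed
  finally show ?thesis .
qed

text \<open>The combination, with coefficients \<open>q j\<close>, of the kernel vectors from
  Cramer's rule: the one for a non-pivot column \<open>j\<close> has entry \<open>\<Delta>\<close>
  at \<open>j\<close>, entries \<open>- C j l\<close> at the pivots \<open>l\<close>, and 0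
  elsewhere.\<close>

definition pivot_comb :: "nat \<Rightarrow> nat set \<Rightarrow> 'a::comm_ring_1 \<Rightarrow> (nat \<Rightarrow> nat \<Rightarrow> 'a) \<Rightarrow> (nat \<Rightarrow> 'a) \<Rightarrow> nat \<Rightarrow> 'a" where
  "pivot_comb n P \<Delta> C q x = (if x \<in> P then - (\<Sum>j\<in>{..<n} - P. q j * C j x) else \<Delta> * q x)"

lemma sum_pivot_comb:
  assumes "P \<subseteq> {..<n}" "\<And>j. j \<in> {..<n} - P \<Longrightarrow> \<Delta> * a j = (\<Sum>l\<in>P. C j l * a l)"
  shows "(\<Sum>x<n. a x * pivot_comb n P \<Delta> C q x) = 0"
proof -
  have "(\<Sum>x<n. a x * pivot_comb n P \<Delta> C q x) =
      (\<Sum>x\<in>{..<n} - P. a x * pivot_comb n P \<Delta> C q x) + (\<Sum>x\<in>P. a x * pivot_comb n P \<Delta> C q x)"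
    by (rule sum.subset_diff[OF assms(1)]) simp
  also have "(\<Sum>x\<in>{..<n} - P. a x * pivot_comb n P \<Delta> C q x) = (\<Sum>x\<in>{..<n} - P. q x * (\<Sum>l\<in>P. C x l * a l))"
  proof (rule sum.cong[OF refl])
    fix x assume "x \<in> {..<n} - P"
    then show "a x * pivot_comb n P \<Delta> C q x = q x * (\<Sum>l\<in>P. C x l * a l)"
      using assms(2)[of x] by (simp add: pivot_comb_def mult.left_commute flip: assms(2))
  qed
  also have "(\<Sum>x\<in>P. a x * pivot_comb n P \<Delta> C q x) = - (\<Sum>x\<in>P. \<Sum>j\<in>{..<n} - P. q j * (C j x * a x))"
    by (auto simp: pivot_comb_def sum_distrib_left mult_ac simp flip: sum_negf intro!: sum.cong)
  also have "(\<Sum>x\<in>P. \<Sum>j\<in>{..<n} - P. q j * (C j x * a x)) = (\<Sum>j\<in>{..<n} - P. q j * (\<Sum>l\<in>P. C j l * a l))"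
    by (subst sum.swap) (simp add: sum_distrib_left)
  finally show ?thesis
    by simp
qed

lemma pivot_comb_pivot_relation:
  assumes "P \<subseteq> {..<n}" "l \<in> P"
  shows "\<Delta> * pivot_comb n P \<Delta> C q l + (\<Sum>j\<in>{..<n} - P. C j l * pivot_comb n P \<Delta> C q j) = 0"
proof -
  have "(\<Sum>j\<in>{..<n} - P. C j l * pivot_comb n P \<Delta> C q j) = (\<Sum>j\<in>{..<n} - P. \<Delta> * (q j * C j l))"
    by (rule sum.cong) (auto simp: pivot_comb_def mult_ac)
  then show ?thesis
    using assms by (simp add: pivot_comb_def sum_distrib_left)
qed

lemma (in ring_filtration) filt_pivot_comb:
  assumes "F M \<Delta>" "\<And>j l. j \<in> {..<n} - P \<Longrightarrow> l \<in> P \<Longrightarrow> F M (C j l)"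
    and "\<And>j. j \<in> {..<n} - P \<Longrightarrow> F D (q j)" "x < n"
  shows "F (D + M) (pivot_comb n P \<Delta> C q x)"
  unfolding pivot_comb_def using assms filt_mult[of M \<Delta> D "q x"]
  by (auto intro!: filt_uminus filt_sum filt_mult simp: add.commute)

lemma pivot_comb_cong_mod:
  assumes "\<And>j. j \<in> {..<n} - P \<Longrightarrow> p dvd q j - q' j" "x < n"
  shows "p dvd pivot_comb n P \<Delta> C q x - pivot_comb n P \<Delta> C q' x"
proof (cases "x \<in> P")
  case True
  have "pivot_comb n P \<Delta> C q x - pivot_comb n P \<Delta> C q' x = - (\<Sum>j\<in>{..<n} - P. (q j - q' j) * C j x)"
    using True by (simp add: pivot_comb_def left_diff_distrib sum_subtractf)
  then show ?thesis
    using assms(1) by (auto intro!: dvd_sum)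
next
  case False
  then have "pivot_comb n P \<Delta> C q x - pivot_comb n P \<Delta> C q' x = \<Delta> * (q x - q' x)"
    by (simp add: pivot_comb_def right_diff_distrib)
  then show ?thesis
    using assms False by simp
qed

section \<open>Reducing the degree in one variable\<close>

lemma dvd_trans_diff: "p dvd a - b \<Longrightarrow> p dvd b - c \<Longrightarrow> p dvd a - c" for p :: "'a::comm_ring_1"
  using dvd_add[of p "a - b" "b - c"] by simp

lemma dvd_diff_swap: "p dvd a - b \<Longrightarrow> p dvd b - a" for p :: "'a::comm_ring_1"
  using dvd_minus_iff[of p "a - b"] by simp

lemma coeff_mult_eq_0_high:
  fixes p q :: "'a::comm_ring_1 poly"
  assumes "\<And>i. i > a \<Longrightarrow> coeff p i = 0" "\<And>i. i \<ge> b \<Longrightarrow> coeff q i = 0" "i \<ge> a + b"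
  shows "coeff (p * q) i = 0"
  unfolding coeff_mult
proof (rule sum.neutral, rule ballI)
  fix k
  show "coeff p k * coeff q (i - k) = 0"
    using assms by (cases "k > a") auto
qed

lemma smult_sum_right: "smult c (sum f I) = (\<Sum>i\<in>I. smult c (f i))"
  by (induction I rule: infinite_finite_induct) (simp_all add: smult_add_right)

text \<open>The non-pivot entries of \<open>v\<close> are divided by \<open>\<Delta>\<close>, and
  the quotients are removed by subtracting Cramer kernel vectors; remainders of degree below
  \<open>s\<close> stay. Modulo \<open>\<pi> ^ E\<close>, each pivot entry times
  \<open>\<Delta>\<close> then has degree below \<open>M + s\<close>, and multiplication by the
  Weierstrass unit \<open>U\<close> bounds these entries too. This gives \<open>u\<close>, of degree
  below \<open>M\<close> in \<open>X\<close>. What was subtracted survives modulo \<pi> as the exact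
  kernel vector \<open>y\<close>, so that \<open>w' + y\<close> recovers
  \<open>c * w\<close>.\<close>

lemma reduce_degree:
  fixes A C :: "nat \<Rightarrow> nat \<Rightarrow> 'a::idom poly" and v w :: "nat \<Rightarrow> 'a poly"
  assumes filt: "ring_filtration F" and prime: "prime_elem \<pi>"
    and P: "P \<subseteq> {..<n}"
    and rel: "\<And>i j. i < m \<Longrightarrow> j \<in> {..<n} - P \<Longrightarrow> \<Delta> * A i j = (\<Sum>l\<in>P. C j l * A i l)"
    and \<Delta>: "\<Delta> = \<Delta>0 + [:\<pi>:] * Z" and deg_\<Delta>0: "poly_filt F s \<Delta>0" and lead: "\<not> \<pi> dvd coeff \<Delta>0 s"
    and deg_\<Delta>: "s \<le> M" "poly_filt F M \<Delta>"
    and deg_C: "\<And>j l. j \<in> {..<n} - P \<Longrightarrow> l \<in> P \<Longrightarrow> poly_filt F M (C j l)"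
    and "E > 0"
    and ker: "\<And>i. i < m \<Longrightarrow> [:\<pi>:] ^ E dvd (\<Sum>j<n. A i j * v j)"
    and piv: "\<And>l. l \<in> P \<Longrightarrow> [:\<pi>:] ^ E dvd \<Delta> * v l + (\<Sum>j\<in>{..<n} - P. C j l * v j)"
    and vw: "\<And>j. j < n \<Longrightarrow> [:\<pi>:] dvd v j - w j" and deg_w: "\<And>j. j < n \<Longrightarrow> poly_filt F D (w j)"
  obtains u w' y c where
    "\<And>i. i < m \<Longrightarrow> [:\<pi>:] ^ E dvd (\<Sum>j<n. A i j * u j)"
    "\<And>j t. j < n \<Longrightarrow> t \<ge> M \<Longrightarrow> coeff (u j) t = 0"
    "\<And>j. j < n \<Longrightarrow> [:\<pi>:] dvd u j - w' j"
    "\<And>j t. j < n \<Longrightarrow> t \<ge> M \<Longrightarrow> coeff (w' j) t = 0"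
    "\<And>j. j < n \<Longrightarrow> poly_filt F (D + M) (w' j)"
    "\<And>i. i < m \<Longrightarrow> (\<Sum>j<n. A i j * y j) = 0"
    "\<And>j. j < n \<Longrightarrow> poly_filt F (D + M) (y j)"
    "\<And>j. j < n \<Longrightarrow> [:\<pi>:] dvd w' j + y j - [:c:] * w j"
    "F 0 c" "\<not> \<pi> dvd c"
proof -
  interpret F: ring_filtration F by fact
  interpret G: ring_filtration "poly_filt F"
    by (rule F.ring_filtration_poly_filt)
  let ?Q = "{..<n} - P"
  let ?cb = "pivot_comb n P \<Delta> C"
  have high0: "coeff \<Delta>0 i = 0" if "i > s" for i
    using deg_\<Delta>0 that by (auto simp: poly_filt_def)
  have high: "coeff \<Delta> i = 0" if "i > M" for i
    using deg_\<Delta>(2) that by (auto simp: poly_filt_def)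
  define c0 where "c0 = coeff \<Delta>0 s"
  have c0: "F 0 c0" "\<not> \<pi> dvd c0"
    using F.poly_filt_coeff[OF deg_\<Delta>0, of s] lead by (simp_all add: c0_def)
  have c0_power: "\<not> \<pi> dvd c0 ^ e" "F 0 (c0 ^ e)" for e
    using prime_elem_dvd_power[OF prime, of c0 e] c0 F.filt_power[OF c0(1), of e] by auto
  have "\<exists>K0. \<forall>K\<ge>K0. \<exists>q r h q0. smult (c0 ^ K) (v j) = q * \<Delta> + r + [:\<pi>:] ^ E * h \<and>
      (\<forall>i\<ge>s. coeff r i = 0) \<and> [:\<pi>:] dvd q - q0 \<and> (poly_filt F D (w j) \<longrightarrow> poly_filt F D q0)"
    if "j \<in> ?Q" for j
  proof -
    have "[:\<pi>:] dvd v j - w j"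
      using vw that by simp
    then obtain x where "v j - w j = [:\<pi>:] * x"
      by (rule dvdE)
    then have v: "v j = w j + [:\<pi>:] * x"
      by (simp add: algebra_simps)
    show ?thesis
      unfolding c0_def by (rule F.weierstrass_division[OF \<Delta> high0 deg_\<Delta>0 v \<open>E > 0\<close>])
  qed
  then obtain K0 where K0: "\<And>j K. j \<in> ?Q \<Longrightarrow> K \<ge> K0 j \<Longrightarrow> \<exists>q r h q0.
      smult (c0 ^ K) (v j) = q * \<Delta> + r + [:\<pi>:] ^ E * h \<and>
      (\<forall>i\<ge>s. coeff r i = 0) \<and> [:\<pi>:] dvd q - q0 \<and> (poly_filt F D (w j) \<longrightarrow> poly_filt F D q0)"
    by metis
  \<comment> \<open>A common exponent for all entries: the sum is at least every
    \<open>K0 j\<close>.\<close>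
  define K where "K = (\<Sum>j\<in>?Q. K0 j)"
  have "\<exists>q r h q0. smult (c0 ^ K) (v j) = q * \<Delta> + r + [:\<pi>:] ^ E * h \<and>
      (\<forall>i\<ge>s. coeff r i = 0) \<and> [:\<pi>:] dvd q - q0 \<and> (poly_filt F D (w j) \<longrightarrow> poly_filt F D q0)"
    if "j \<in> ?Q" for j
    using K0[OF that, of K] member_le_sum[OF that, of K0] by (simp add: K_def)
  then obtain q r h q0 where qr: "\<And>j. j \<in> ?Q \<Longrightarrow> smult (c0 ^ K) (v j) = q j * \<Delta> + r j + [:\<pi>:] ^ E * h j"
      "\<And>j i. j \<in> ?Q \<Longrightarrow> i \<ge> s \<Longrightarrow> coeff (r j) i = 0" "\<And>j. j \<in> ?Q \<Longrightarrow> [:\<pi>:] dvd q j - q0 j"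
      "\<And>j. j \<in> ?Q \<Longrightarrow> poly_filt F D (w j) \<Longrightarrow> poly_filt F D (q0 j)"
    by metis
  define a where "a = c0 ^ K"
  define v2 where "v2 x = smult a (v x) - ?cb q x" for x
  \<comment> \<open>Built from \<open>q0\<close> because \<open>q\<close> has no degree bound. It is
    an exact kernel vector as well, and for the residues \<open>q\<close> and \<open>q0\<close> are
    interchangeable.\<close>
  define y0 where "y0 = ?cb q0"
  define w2 where "w2 x = smult a (w x) - y0 x" for x
  have ker2: "(\<Sum>j<n. A i j * v2 j) = smult a (\<Sum>j<n. A i j * v j)" if "i < m" for i
    using sum_pivot_comb[OF P rel[OF that], of q]
    by (simp add: v2_def right_diff_distrib sum_subtractf smult_sum_right)
  have ker_y0: "(\<Sum>j<n. A i j * y0 j) = 0" if "i < m" for i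
    unfolding y0_def by (rule sum_pivot_comb[OF P rel[OF that]])
  have deg_y0: "poly_filt F (D + M) (y0 j)" if "j < n" for j
    unfolding y0_def by (rule G.filt_pivot_comb[OF deg_\<Delta>(2) deg_C qr(4)[OF _ deg_w] that]) auto
  have deg_w2: "poly_filt F (D + M) (w2 j)" if "j < n" for j
    unfolding w2_def using G.filt_mult[OF F.poly_filt_const[OF c0_power(2)[of K]] deg_w[OF that]] that
    by (intro G.filt_diff deg_y0) (auto simp: a_def intro: G.filt_mono)
  have vw2: "[:\<pi>:] dvd v2 j - w2 j" if "j < n" for j
  proof -
    have eq: "v2 j - w2 j = smult a (v j - w j) - (?cb q j - ?cb q0 j)"
      by (simp add: v2_def w2_def y0_def smult_diff_right)
    have "[:\<pi>:] dvd ?cb q j - ?cb q0 j"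
      by (rule pivot_comb_cong_mod[OF qr(3) that])
    then show ?thesis
      unfolding eq by (rule dvd_diff[OF dvd_smult[OF vw[OF that]]])
  qed
  have v2_Q: "v2 j = r j + [:\<pi>:] ^ E * h j" if "j \<in> ?Q" for j
    using qr(1)[OF that] that by (simp add: v2_def pivot_comb_def a_def mult.commute)
  define R where "R l = - (\<Sum>j\<in>?Q. C j l * r j)" for l
  have piv2: "[:\<pi>:] ^ E dvd \<Delta> * v2 l - R l" if "l \<in> P" for l
  proof -
    have "\<Delta> * v2 l + (\<Sum>j\<in>?Q. C j l * v2 j) = smult a (\<Delta> * v l + (\<Sum>j\<in>?Q. C j l * v j)) -
        (\<Delta> * ?cb q l + (\<Sum>j\<in>?Q. C j l * ?cb q j))"
      by (simp add: v2_def right_diff_distrib sum_subtractf smult_sum_right smult_add_right)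
    then have "[:\<pi>:] ^ E dvd \<Delta> * v2 l + (\<Sum>j\<in>?Q. C j l * v2 j)"
      using piv[OF that] by (simp add: pivot_comb_pivot_relation[OF P that] dvd_smult)
    moreover have "(\<Sum>j\<in>?Q. C j l * v2 j) = - R l + [:\<pi>:] ^ E * (\<Sum>j\<in>?Q. C j l * h j)"
      by (simp add: v2_Q R_def distrib_left sum.distrib sum_distrib_left mult_ac)
    ultimately have "[:\<pi>:] ^ E dvd \<Delta> * v2 l + (- R l + [:\<pi>:] ^ E * (\<Sum>j\<in>?Q. C j l * h j))"
      by simp
    then have "[:\<pi>:] ^ E dvd (\<Delta> * v2 l - R l) + [:\<pi>:] ^ E * (\<Sum>j\<in>?Q. C j l * h j)"
      by (simp only: diff_conv_add_uminus add.assoc)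
    then show ?thesis
      by (simp only: dvd_add_left_iff[OF dvd_triv_left])
  qed
  have deg_R: "coeff (R l) i = 0" if "l \<in> P" "i \<ge> M + s" for l i
  proof -
    have "coeff (C j l * r j) i = 0" if "j \<in> ?Q" for j
      by (rule coeff_mult_eq_0_high[of M _ s])
        (use deg_C[OF that \<open>l \<in> P\<close>] qr(2)[OF that] \<open>i \<ge> M + s\<close> in \<open>auto simp: poly_filt_def\<close>)
    then show ?thesis
      by (simp add: R_def coeff_sum)
  qed
  \<comment> \<open>One \<open>U\<close> serves all entries: at the pivots it brings the degree
    below \<open>M\<close>, and since its degree is at most \<open>M - s\<close>, the remainders of
    degree below \<open>s\<close> stay below \<open>M\<close>.\<close>
  obtain U t where U: "[:\<pi>:] dvd U - [:c0 ^ t:]" "\<And>i. i > M - s \<Longrightarrow> coeff U i = 0"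
      "\<And>y P. (\<forall>i\<ge>M + s. coeff P i = 0) \<and> [:\<pi>:] ^ E dvd \<Delta> * y - P \<Longrightarrow>
        \<exists>g. [:\<pi>:] ^ E dvd U * y - g \<and> (\<forall>i\<ge>M. coeff g i = 0)"
    using weierstrass_unit[OF prime \<Delta> high0 lead deg_\<Delta>(1) high \<open>E > 0\<close>] unfolding c0_def by blast
  have "\<exists>g. [:\<pi>:] ^ E dvd U * v2 j - g \<and> (\<forall>i\<ge>M. coeff g i = 0)" if "j < n" for j
  proof (cases "j \<in> P")
    case True
    then show ?thesis
      using deg_R piv2 by (intro U(3)[of "R j"]) auto
  next
    case False
    have "coeff (U * r j) i = 0" if "i \<ge> M" for i
      by (rule coeff_mult_eq_0_high[of "M - s" _ s])
        (use U(2) qr(2)[of j] \<open>j < n\<close> False that deg_\<Delta>(1) in auto)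
    moreover have "[:\<pi>:] ^ E dvd U * v2 j - U * r j"
      using False that by (simp add: v2_Q distrib_left)
    ultimately show ?thesis
      by blast
  qed
  then obtain u where u: "\<And>j. j < n \<Longrightarrow> [:\<pi>:] ^ E dvd U * v2 j - u j"
      "\<And>j i. j < n \<Longrightarrow> i \<ge> M \<Longrightarrow> coeff (u j) i = 0"
    by metis
  define b where "b = c0 ^ t"
  define w' where "w' j = poly_cutoff M (smult b (w2 j))" for j
  have "[:\<pi>:] dvd U * v2 j - smult b (w2 j)" if "j < n" for j
  proof -
    have "U * v2 j - smult b (w2 j) = U * (v2 j - w2 j) + (U - [:b:]) * w2 j"
      by (simp add: algebra_simps)
    then show ?thesis
      using vw2[OF that] U(1) by (auto simp: b_def intro!: dvd_add)
  qed
  moreover have "[:\<pi>:] dvd u j - U * v2 j" if "j < n" for j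
    by (rule dvd_diff_swap[OF dvd_trans[OF dvd_power u(1)[OF that]]]) (use \<open>E > 0\<close> in simp)
  ultimately have uw2: "[:\<pi>:] dvd u j - smult b (w2 j)" if "j < n" for j
    using dvd_trans_diff that by blast
  have uw': "[:\<pi>:] dvd u j - w' j" if "j < n" for j
    unfolding const_poly_dvd_iff
  proof
    fix i
    show "\<pi> dvd coeff (u j - w' j) i"
      using uw2[OF that] u(2)[OF that] by (cases "i < M") (auto simp: const_poly_dvd_iff w'_def coeff_poly_cutoff)
  qed
  have deg_bw2: "poly_filt F (D + M) (smult b x)" if "poly_filt F (D + M) x" for x
    using G.filt_mult[OF F.poly_filt_const[OF c0_power(2)[of t]] that] by (simp add: b_def)
  show thesis
  proof (rule that[of u w' "\<lambda>j. smult b (y0 j)" "b * a"])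
    fix i assume i: "i < m"
    have "(\<Sum>j<n. A i j * u j) = U * (\<Sum>j<n. A i j * v2 j) - (\<Sum>j<n. A i j * (U * v2 j - u j))"
      by (simp add: right_diff_distrib sum_subtractf sum_distrib_left mult_ac)
    then show "[:\<pi>:] ^ E dvd (\<Sum>j<n. A i j * u j)"
      unfolding ker2[OF i]
      by (simp only:) (intro dvd_diff[OF dvd_mult[OF dvd_smult[OF ker[OF i]]]] dvd_sum dvd_mult u(1), simp)
    show "(\<Sum>j<n. A i j * smult b (y0 j)) = 0"
      using ker_y0[OF i] by (simp flip: smult_sum_right)
  next
    fix j assume j: "j < n"
    show "poly_filt F (D + M) (w' j)"
      using deg_bw2[OF deg_w2[OF j]] by (auto simp: w'_def poly_filt_def coeff_poly_cutoff)
    show "poly_filt F (D + M) (smult b (y0 j))"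
      by (rule deg_bw2[OF deg_y0[OF j]])
    have "[:\<pi>:] dvd w' j - smult b (w2 j)"
      using dvd_trans_diff[OF dvd_diff_swap[OF uw'[OF j]] uw2[OF j]] .
    then show "[:\<pi>:] dvd w' j + smult b (y0 j) - [:b * a:] * w j"
      by (simp add: w2_def smult_diff_right algebra_simps)
  next
    show "F 0 (b * a)"
      using F.filt_mult[OF c0_power(2)[of t] c0_power(2)[of K]] by (simp add: a_def b_def)
    show "\<not> \<pi> dvd b * a"
      using c0_power(1) prime by (auto simp: a_def b_def prime_elem_dvd_mult_iff)
  qed (use u(2) uw' in \<open>auto simp: w'_def coeff_poly_cutoff\<close>)
qed

text \<open>The recursion of \<open>bounded_lift\<close>. The minors have degree at most
  \<open>M = m * d\<close>; reducing to degree below \<open>M\<close> in \<open>X\<close> costs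
  \<open>M\<close>, and restoring the powers of \<open>X\<close> at the end costs \<open>M\<close>
  again. Each of the \<open>m\<close> equations splits into \<open>M + d\<close> equations between
  coefficients, whose entries again have degree at most \<open>d\<close>.\<close>

fun lift_degree :: "nat \<Rightarrow> nat \<Rightarrow> nat \<Rightarrow> nat" where
  "lift_degree 0 d m = 0"
| "lift_degree (Suc N) d m = 2 * (m * d) + lift_degree N d (m * (m * d + d))"

lemma deg_le_0 [simp]: "deg_le 0 D f"
  by (simp add: deg_le_def mdeg_def)

lemma coeff_sum_mult_split:
  fixes a u :: "nat \<Rightarrow> 'a::comm_ring_1 poly"
  assumes "\<And>j t. j < n \<Longrightarrow> t \<ge> L \<Longrightarrow> coeff (u j) t = 0"
  shows "coeff (\<Sum>j<n. a j * u j) \<tau> =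
    (\<Sum>b<n * L. (if b mod L \<le> \<tau> then coeff (a (b div L)) (\<tau> - b mod L) else 0) * coeff (u (b div L)) (b mod L))"
proof -
  have "coeff (a j * u j) \<tau> = (\<Sum>t<L. (if t \<le> \<tau> then coeff (a j) (\<tau> - t) else 0) * coeff (u j) t)"
    if "j < n" for j
  proof -
    have low: "t < L" if "coeff (u j) t \<noteq> 0" for t
      using assms[OF \<open>j < n\<close>, of t] that by (cases "t < L") auto
    have "coeff (a j * u j) \<tau> = (\<Sum>t\<le>\<tau>. coeff (u j) t * coeff (a j) (\<tau> - t))"
      by (simp add: coeff_mult mult.commute[of "a j"])
    also have "\<dots> = (\<Sum>t\<in>{..<L} \<inter> {..\<tau>}. coeff (u j) t * coeff (a j) (\<tau> - t))"
      by (intro sum.mono_neutral_right) (auto intro!: low)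
    also have "\<dots> = (\<Sum>t<L. (if t \<le> \<tau> then coeff (a j) (\<tau> - t) else 0) * coeff (u j) t)"
      by (intro sum.mono_neutral_cong_left) auto
    finally show ?thesis .
  qed
  then show ?thesis
    unfolding coeff_sum
    by (subst sum_div_mod[of "\<lambda>j t. (if t \<le> \<tau> then coeff (a j) (\<tau> - t) else 0) * coeff (u j) t"]) simp
qed

text \<open>It is the residue modulo \<pi> that has to be regular in \<open>X\<close>; its degree
  \<open>s\<close> may be smaller than that of \<open>f\<close>.\<close>

lemma chart_representative:
  fixes f :: "'a::comm_ring_1 mpoly"
  assumes "\<not> Const \<pi> dvd f" "deg_le (Suc N) M f"
  obtains f0 Z s K where "f = f0 + Const \<pi> * Z" "N \<le> K" "s \<le> M" "deg_le (Suc N) s f0"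
    "\<not> Const \<pi> dvd coeff (chart N K f0) s"
proof -
  define f0 where "f0 = mpart (\<lambda>m. \<not> \<pi> dvd Poly_Mapping.lookup f m) f"
  define s where "s = Max (mdeg (Suc N) ` Poly_Mapping.keys f0)"
  have rep: "Const \<pi> dvd f - f0"
    unfolding f0_def by (rule mod_Const_representative)
  then obtain Z where Z: "f - f0 = Const \<pi> * Z"
    by (rule dvdE)
  have "f0 \<noteq> 0"
    using rep assms(1) by auto
  then have ne: "Poly_Mapping.keys f0 \<noteq> {}"
    by auto
  then have "s \<in> mdeg (Suc N) ` Poly_Mapping.keys f0"
    unfolding s_def by (intro Max_in) auto
  then obtain m0 where m0: "m0 \<in> Poly_Mapping.keys f0" "mdeg (Suc N) m0 = s"
    by auto
  define V where "V = (\<Union>m\<in>Poly_Mapping.keys f0. Poly_Mapping.keys m)"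
  have "finite V"
    by (simp add: V_def)
  then obtain K0 where "\<forall>i\<in>V. i < K0"
    using finite_nat_set_iff_bounded by auto
  then have K: "Poly_Mapping.keys m \<subseteq> {..<max (Suc N) K0}" if "m \<in> Poly_Mapping.keys f0" for m
    using that by (auto simp: V_def less_max_iff_disj)
  have deg: "deg_le (Suc N) s f0"
    by (auto simp: deg_le_def s_def)
  show thesis
  proof (rule that[of f0 Z "max (Suc N) K0" s])
    show "f = f0 + Const \<pi> * Z"
      using Z by (simp add: algebra_simps)
    show "s \<le> M"
      using m0 assms(2) by (auto simp: deg_le_def f0_def keys_mpart)
    show "\<not> Const \<pi> dvd coeff (chart N (max (Suc N) K0) f0) s"
      by (rule chart_leading_coeff[OF _ deg K m0]) (use m0 in \<open>auto simp: f0_def keys_mpart lookup_mpart\<close>)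
  qed (use deg in auto)
qed

text \<open>Working modulo a high power of \<open>\<pi>\<close> replaces passing to the \<open>\<pi>\<close>-adic completion.  The exponent \<open>E\<close> depends on \<open>A\<close>, the degree
  bound does not.\<close>

lemma bounded_lift:
  fixes \<pi> :: "'a::idom" and A :: "nat \<Rightarrow> nat \<Rightarrow> 'a mpoly" and m n d :: nat
  assumes prime: "prime_elem \<pi>" and sep: "\<And>x. x \<noteq> 0 \<Longrightarrow> \<exists>k. \<not> \<pi> ^ k dvd x"
    and "\<And>i j. i < m \<Longrightarrow> j < n \<Longrightarrow> deg_le N d (A i j)"
  shows "\<exists>E. \<forall>v w D.
    (\<forall>i<m. Const \<pi> ^ E dvd (\<Sum>j<n. A i j * v j)) \<and>
    (\<forall>j<n. Const \<pi> dvd v j - w j \<and> deg_le N D (w j)) \<longrightarrow>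
    (\<exists>z c. (\<forall>i<m. (\<Sum>j<n. A i j * z j) = 0) \<and> deg_le N 0 c \<and> \<not> Const \<pi> dvd c \<and>
      (\<forall>j<n. Const \<pi> dvd z j - c * w j \<and> deg_le N (D + lift_degree N d m) (z j)))"
  using assms(3)
proof (induction N arbitrary: m n A)
  case 0
  have prime': "prime_elem (Const \<pi>)"
    by (rule prime_elem_Const[OF prime])
  obtain P \<Delta> C k where P: "P \<subseteq> {..<n}" "\<not> Const \<pi> dvd \<Delta>"
      "\<And>i j. i < m \<Longrightarrow> j \<in> {..<n} - P \<Longrightarrow> \<Delta> * A i j = (\<Sum>l\<in>P. C j l * A i l)"
      "\<And>v E l. (\<And>i. i < m \<Longrightarrow> Const \<pi> ^ (E + k) dvd (\<Sum>j<n. A i j * v j)) \<Longrightarrow> l \<in> P \<Longrightarrow>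
         Const \<pi> ^ E dvd \<Delta> * v l + (\<Sum>j\<in>{..<n} - P. C j l * v j)"
    by (rule exists_pivots[OF prime' Const_separated[OF sep] ring_filtration_deg_le[of 0], of m n d A]) auto
  show ?case
  proof (intro exI[of _ "1 + k"] allI impI, elim conjE)
    fix v w D
    assume ker: "\<forall>i<m. Const \<pi> ^ (1 + k) dvd (\<Sum>j<n. A i j * v j)"
      and vw: "\<forall>j<n. Const \<pi> dvd v j - w j \<and> deg_le 0 D (w j)"
    \<comment> \<open>Without variables all degrees are 0, so nothing has to be divided and
      \<open>w\<close> itself serves as the coefficients. The pivot relations are used modulo \<pi>
      only, whence the exponent \<open>1 + k\<close>.\<close>
    let ?z = "pivot_comb n P \<Delta> C w"
    have "Const \<pi> dvd ?z x - \<Delta> * w x" if x: "x < n" for x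
    proof (cases "x \<in> P")
      case True
      have "Const \<pi> dvd \<Delta> * v x + (\<Sum>j\<in>{..<n} - P. C j x * v j)"
        using P(4)[of 1 v x] ker True by simp
      moreover have "Const \<pi> dvd \<Delta> * (v x - w x) + (\<Sum>j\<in>{..<n} - P. C j x * (v j - w j))"
        using vw x by (intro dvd_add dvd_mult dvd_sum) auto
      ultimately have "Const \<pi> dvd (\<Delta> * (v x - w x) + (\<Sum>j\<in>{..<n} - P. C j x * (v j - w j))) -
          (\<Delta> * v x + (\<Sum>j\<in>{..<n} - P. C j x * v j))"
        by (rule dvd_diff[rotated])
      also have "\<dots> = ?z x - \<Delta> * w x"
        using True by (simp add: pivot_comb_def algebra_simps sum_subtractf)
      finally show ?thesis .
    qed (simp add: pivot_comb_def)
    then show "\<exists>z c. (\<forall>i<m. (\<Sum>j<n. A i j * z j) = 0) \<and> deg_le 0 0 c \<and> \<not> Const \<pi> dvd c \<and>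
        (\<forall>j<n. Const \<pi> dvd z j - c * w j \<and> deg_le 0 (D + lift_degree 0 d m) (z j))"
      using P sum_pivot_comb[OF P(1,3), of _ w] by (intro exI[of _ ?z] exI[of _ \<Delta>]) auto
  qed
next
  case (Suc N)
  have prime': "prime_elem (Const \<pi>)"
    by (rule prime_elem_Const[OF prime])
  have \<pi>0: "\<pi> \<noteq> 0"
    using prime by auto
  define M where "M = m * d"
  obtain P \<Delta> C k where P: "P \<subseteq> {..<n}" "\<not> Const \<pi> dvd \<Delta>" "deg_le (Suc N) M \<Delta>"
      "\<And>j l. j \<in> {..<n} - P \<Longrightarrow> l \<in> P \<Longrightarrow> deg_le (Suc N) M (C j l)"
      "\<And>i j. i < m \<Longrightarrow> j \<in> {..<n} - P \<Longrightarrow> \<Delta> * A i j = (\<Sum>l\<in>P. C j l * A i l)"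
      "\<And>v E l. (\<And>i. i < m \<Longrightarrow> Const \<pi> ^ (E + k) dvd (\<Sum>j<n. A i j * v j)) \<Longrightarrow> l \<in> P \<Longrightarrow>
         Const \<pi> ^ E dvd \<Delta> * v l + (\<Sum>j\<in>{..<n} - P. C j l * v j)"
    by (rule exists_pivots[OF prime' Const_separated[OF sep] ring_filtration_deg_le[of "Suc N"], of m n d A])
      (use Suc.prems \<pi>0 in \<open>auto simp: M_def dest: deg_le_Const_mult_cancel\<close>)
  obtain \<Delta>0 Z s K where rep: "\<Delta> = \<Delta>0 + Const \<pi> * Z" "N \<le> K" "s \<le> M" "deg_le (Suc N) s \<Delta>0"
      "\<not> Const \<pi> dvd coeff (chart N K \<Delta>0) s"
    by (rule chart_representative[OF P(2,3)])
  define \<psi> where "\<psi> = (chart N K :: 'a mpoly \<Rightarrow> _)"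
  interpret \<psi>: comm_ring_hom \<psi>
    unfolding \<psi>_def by (rule comm_ring_hom_chart)
  have \<psi>_\<pi>: "\<psi> (Const \<pi>) = [:Const \<pi>:]"
    by (simp add: \<psi>_def)
  have filt_\<psi>: "poly_filt (deg_le N) D (\<psi> f)" if "deg_le (Suc N) D f" for D f
    unfolding \<psi>_def by (rule poly_filt_chart[OF rep(2) that])
  interpret F: ring_filtration "deg_le N :: nat \<Rightarrow> 'a mpoly \<Rightarrow> bool"
    by (rule ring_filtration_deg_le)
  interpret G: ring_filtration "poly_filt (deg_le N :: nat \<Rightarrow> 'a mpoly \<Rightarrow> bool)"
    by (rule F.ring_filtration_poly_filt)
  \<comment> \<open>Entries of degree at most \<open>d\<close> times unknowns of degree below
    \<open>M\<close> have degree below \<open>H\<close>. A row of \<open>B\<close> codes an equation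
    and a power of \<open>X\<close>, a column an unknown and a power of \<open>X\<close>.\<close>
  define H where "H = M + d"
  define B where "B a b = (if b mod M \<le> a mod H
      then coeff (\<psi> (A (a div H) (b div M))) (a mod H - b mod M) else 0)" for a b
  have "deg_le N d (B a b)" if "a < m * H" "b < n * M" for a b
  proof -
    have "a div H < m" "b div M < n"
      using that by (simp_all add: less_mult_imp_div_less)
    then show ?thesis
      using F.filt_mono[OF F.poly_filt_coeff[OF filt_\<psi>[OF Suc.prems]], of "a div H" "b div M" _ d]
      by (auto simp: B_def F.filt_zero)
  qed
  then obtain E' where E': "\<And>v w D. (\<forall>i<m * H. Const \<pi> ^ E' dvd (\<Sum>j<n * M. B i j * v j)) \<and>
      (\<forall>j<n * M. Const \<pi> dvd v j - w j \<and> deg_le N D (w j)) \<Longrightarrow>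
      (\<exists>z c. (\<forall>i<m * H. (\<Sum>j<n * M. B i j * z j) = 0) \<and> deg_le N 0 c \<and> \<not> Const \<pi> dvd c \<and>
        (\<forall>j<n * M. Const \<pi> dvd z j - c * w j \<and> deg_le N (D + lift_degree N d (m * H)) (z j)))"
    using Suc.IH[of "m * H" "n * M" B] by blast
  have B_row: "coeff (\<Sum>j<n. \<psi> (A i j) * u j) \<tau> = (\<Sum>b<n * M. B (i * H + \<tau>) b * coeff (u (b div M)) (b mod M))"
    if "\<And>j t. j < n \<Longrightarrow> t \<ge> M \<Longrightarrow> coeff (u j) t = 0" "\<tau> < H" for u i \<tau>
  proof -
    have "(i * H + \<tau>) div H = i" "(i * H + \<tau>) mod H = \<tau>"
      using that(2) by auto
    then show ?thesis
      using coeff_sum_mult_split[of n M u "\<lambda>j. \<psi> (A i j)" \<tau>, OF that(1)] by (simp only: B_def)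
  qed
  \<comment> \<open>\<open>E'\<close> is the exponent for the smaller system and \<open>k\<close> is
    lost to the pivots; \<open>Suc\<close> makes the exponent positive, as Weierstrass division
    requires.\<close>
  show ?case
  proof (intro exI[of _ "Suc E' + k"] allI impI, elim conjE)
    fix v w D
    assume ker: "\<forall>i<m. Const \<pi> ^ (Suc E' + k) dvd (\<Sum>j<n. A i j * v j)"
      and vw: "\<forall>j<n. Const \<pi> dvd v j - w j \<and> deg_le (Suc N) D (w j)"
    have red: thesis if "\<And>u w' y c. (\<And>i. i < m \<Longrightarrow> [:Const \<pi>:] ^ Suc E' dvd (\<Sum>j<n. \<psi> (A i j) * u j)) \<Longrightarrow>
        (\<And>j t. j < n \<Longrightarrow> t \<ge> M \<Longrightarrow> coeff (u j) t = 0) \<Longrightarrow>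
        (\<And>j. j < n \<Longrightarrow> [:Const \<pi>:] dvd u j - w' j) \<Longrightarrow>
        (\<And>j t. j < n \<Longrightarrow> t \<ge> M \<Longrightarrow> coeff (w' j) t = 0) \<Longrightarrow>
        (\<And>j. j < n \<Longrightarrow> poly_filt (deg_le N) (D + M) (w' j)) \<Longrightarrow>
        (\<And>i. i < m \<Longrightarrow> (\<Sum>j<n. \<psi> (A i j) * y j) = 0) \<Longrightarrow>
        (\<And>j. j < n \<Longrightarrow> poly_filt (deg_le N) (D + M) (y j)) \<Longrightarrow>
        (\<And>j. j < n \<Longrightarrow> [:Const \<pi>:] dvd w' j + y j - [:c:] * \<psi> (w j)) \<Longrightarrow>
        deg_le N 0 c \<Longrightarrow> \<not> Const \<pi> dvd c \<Longrightarrow> thesis" for thesis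
    proof (rule reduce_degree[of "deg_le N" "Const \<pi>" P n m "\<psi> \<Delta>" "\<lambda>i j. \<psi> (A i j)" "\<lambda>j l. \<psi> (C j l)" "\<psi> \<Delta>0" "\<psi> Z"
          s M "Suc E'" "\<lambda>j. \<psi> (v j)" "\<lambda>j. \<psi> (w j)" D])
      show "ring_filtration (deg_le N :: nat \<Rightarrow> 'a mpoly \<Rightarrow> bool)"
        by (rule ring_filtration_deg_le)
      show "\<psi> \<Delta> * \<psi> (A i j) = (\<Sum>l\<in>P. \<psi> (C j l) * \<psi> (A i l))" if "i < m" "j \<in> {..<n} - P" for i j
        using arg_cong[OF P(5)[OF that], of \<psi>] by (simp add: \<psi>.hom_mult \<psi>.hom_sum)
      show "\<psi> \<Delta> = \<psi> \<Delta>0 + [:Const \<pi>:] * \<psi> Z"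
        unfolding rep(1) \<psi>.hom_add \<psi>.hom_mult \<psi>_\<pi> ..
      show "[:Const \<pi>:] ^ Suc E' dvd (\<Sum>j<n. \<psi> (A i j) * \<psi> (v j))" if "i < m" for i
      proof -
        have "Const \<pi> ^ Suc E' dvd (\<Sum>j<n. A i j * v j)"
          by (rule dvd_trans[OF le_imp_power_dvd[OF le_add1] ker[rule_format, OF that]])
        from \<psi>.hom_dvd[OF this] show ?thesis
          by (simp only: \<psi>.hom_power \<psi>_\<pi> \<psi>.hom_sum \<psi>.hom_mult)
      qed
      show "[:Const \<pi>:] ^ Suc E' dvd \<psi> \<Delta> * \<psi> (v l) + (\<Sum>j\<in>{..<n} - P. \<psi> (C j l) * \<psi> (v j))" if "l \<in> P" for l
        using \<psi>.hom_dvd[OF P(6)[of "Suc E'" v l]] ker that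
        by (simp only: \<psi>.hom_power \<psi>_\<pi> \<psi>.hom_sum \<psi>.hom_mult \<psi>.hom_add)
      show "[:Const \<pi>:] dvd \<psi> (v j) - \<psi> (w j)" if "j < n" for j
        using \<psi>.hom_dvd[of "Const \<pi>" "v j - w j"] vw that by (simp only: \<psi>_\<pi> \<psi>.hom_minus)
      show "\<not> Const \<pi> dvd coeff (\<psi> \<Delta>0) s"
        unfolding \<psi>_def by (rule rep(5))
      show "poly_filt (deg_le N) M (\<psi> (C j l))" if "j \<in> {..<n} - P" "l \<in> P" for j l
        by (rule filt_\<psi>[OF P(4)[OF that]])
      show "poly_filt (deg_le N) D (\<psi> (w j))" if "j < n" for j
        using vw that by (intro filt_\<psi>) simp
    qed (fact that prime' P(1) rep(3) filt_\<psi>[OF P(3)] filt_\<psi>[OF rep(4)] zero_less_Suc)+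
    show "\<exists>z c. (\<forall>i<m. (\<Sum>j<n. A i j * z j) = 0) \<and> deg_le (Suc N) 0 c \<and> \<not> Const \<pi> dvd c \<and>
        (\<forall>j<n. Const \<pi> dvd z j - c * w j \<and> deg_le (Suc N) (D + lift_degree (Suc N) d m) (z j))"
    proof (rule red)
      fix u w' y c
      assume u: "\<And>i. i < m \<Longrightarrow> [:Const \<pi>:] ^ Suc E' dvd (\<Sum>j<n. \<psi> (A i j) * u j)"
          "\<And>j t. j < n \<Longrightarrow> t \<ge> M \<Longrightarrow> coeff (u j) t = 0"
        and uw': "\<And>j. j < n \<Longrightarrow> [:Const \<pi>:] dvd u j - w' j"
        and w': "\<And>j t. j < n \<Longrightarrow> t \<ge> M \<Longrightarrow> coeff (w' j) t = 0"
          "\<And>j. j < n \<Longrightarrow> poly_filt (deg_le N) (D + M) (w' j)"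
        and y: "\<And>i. i < m \<Longrightarrow> (\<Sum>j<n. \<psi> (A i j) * y j) = 0"
          "\<And>j. j < n \<Longrightarrow> poly_filt (deg_le N) (D + M) (y j)"
        and w'y: "\<And>j. j < n \<Longrightarrow> [:Const \<pi>:] dvd w' j + y j - [:c:] * \<psi> (w j)"
        and c: "deg_le N 0 c" "\<not> Const \<pi> dvd c"
      have rows: "Const \<pi> ^ E' dvd (\<Sum>b<n * M. B a b * coeff (u (b div M)) (b mod M))" if "a < m * H" for a
      proof -
        have H: "a div H < m" "a mod H < H" "a div H * H + a mod H = a"
          using that by (cases "H = 0"; simp add: less_mult_imp_div_less)+
        have "[:Const \<pi>:] ^ E' dvd (\<Sum>j<n. \<psi> (A (a div H) j) * u j)"
          by (rule dvd_trans[OF le_imp_power_dvd u(1)[OF H(1)]]) simp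
        then have "Const \<pi> ^ E' dvd coeff (\<Sum>j<n. \<psi> (A (a div H) j) * u j) (a mod H)"
          by (simp only: const_power_dvd_iff)
        moreover have "coeff (\<Sum>j<n. \<psi> (A (a div H) j) * u j) (a mod H) =
            (\<Sum>b<n * M. B (a div H * H + a mod H) b * coeff (u (b div M)) (b mod M))"
          by (rule B_row[OF u(2) H(2)])
        ultimately show ?thesis
          by (simp only: H(3))
      qed
      have cols: "Const \<pi> dvd coeff (u (b div M)) (b mod M) - coeff (w' (b div M)) (b mod M) \<and>
          deg_le N (D + M) (coeff (w' (b div M)) (b mod M))" if "b < n * M" for b
      proof -
        have "b div M < n"
          using that by (simp add: less_mult_imp_div_less)
        then show ?thesis
          using uw'[of "b div M"] F.filt_mono[OF F.poly_filt_coeff[OF w'(2)], of "b div M"]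
          by (auto simp: const_poly_dvd_iff)
      qed
      obtain z' c' where z': "\<And>a. a < m * H \<Longrightarrow> (\<Sum>b<n * M. B a b * z' b) = 0"
          "\<And>b. b < n * M \<Longrightarrow> Const \<pi> dvd z' b - c' * coeff (w' (b div M)) (b mod M)"
          "\<And>b. b < n * M \<Longrightarrow> deg_le N (D + M + lift_degree N d (m * H)) (z' b)"
        and c': "deg_le N 0 c'" "\<not> Const \<pi> dvd c'"
        using E'[of "\<lambda>b. coeff (u (b div M)) (b mod M)" "\<lambda>b. coeff (w' (b div M)) (b mod M)" "D + M"] rows cols
        by blast
      define z where "z j = (\<Sum>t<M. monom (z' (j * M + t)) t)" for j
      have coeff_z: "coeff (z j) t = (if t < M then z' (j * M + t) else 0)" for j t
        by (simp add: z_def coeff_sum)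
      have idx: "j * M + t < n * M" if "j < n" "t < M" for j t
        using that by (metis add.commute add_less_cancel_left less_le_trans mult_Suc mult_le_mono1 Suc_leI)
      have ker_z: "(\<Sum>j<n. \<psi> (A i j) * z j) = 0" if "i < m" for i
      proof (rule poly_eqI)
        fix \<tau>
        show "coeff (\<Sum>j<n. \<psi> (A i j) * z j) \<tau> = coeff 0 \<tau>"
        proof (cases "\<tau> < H")
          case True
          have "coeff (z (b div M)) (b mod M) = z' b" if "b < n * M" for b
            using that by (auto simp: coeff_z) (metis mod_less_divisor mult_0_right neq0_conv not_less_zero)
          then have "coeff (\<Sum>j<n. \<psi> (A i j) * z j) \<tau> = (\<Sum>b<n * M. B (i * H + \<tau>) b * z' b)"
            using B_row[of z \<tau> i] True by (simp add: coeff_z)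
          moreover have "i * H + \<tau> < m * H"
            using that True by (metis add.commute add_less_cancel_left less_le_trans mult_Suc mult_le_mono1 Suc_leI)
          ultimately show ?thesis
            using z'(1) by simp
        next
          case False
          have "coeff (\<psi> (A i j) * z j) \<tau> = 0" if "j < n" for j
            by (rule coeff_mult_eq_0_high[of d _ M])
              (use False filt_\<psi>[OF Suc.prems[OF \<open>i < m\<close> that]] in \<open>auto simp: coeff_z H_def poly_filt_def\<close>)
          then show ?thesis
            by (simp add: coeff_sum)
        qed
      qed
      have deg_z: "poly_filt (deg_le N) (D + M + lift_degree N d (m * H) + M) (z j)" if "j < n" for j
        unfolding z_def
      proof (rule G.filt_sum)
        fix t assume t: "t \<in> {..<M}"
        then show "poly_filt (deg_le N) (D + M + lift_degree N d (m * H) + M) (monom (z' (j * M + t)) t)"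
          using G.filt_mono[OF F.poly_filt_monom[OF z'(3)[OF idx[OF that]]], of t t] by simp
      qed
      have zw': "[:Const \<pi>:] dvd z j - [:c':] * w' j" if "j < n" for j
        unfolding const_poly_dvd_iff
      proof
        fix t
        show "Const \<pi> dvd coeff (z j - [:c':] * w' j) t"
          using z'(2)[OF idx[OF that, of t]] w'(1)[OF that, of t] by (cases "t < M") (auto simp: coeff_z)
      qed
      \<comment> \<open>\<open>z\<close> is congruent only to \<open>c' * w'\<close>, so
        \<open>y\<close> is scaled by \<open>c'\<close> before it is added back, and the multiplier
        becomes \<open>c' * c\<close>.\<close>
      define zz where "zz j = unchart N K (z j + [:c':] * y j)" for j
      define cc where "cc = unshift N K (c' * c)"
      interpret un: comm_ring_hom "unchart N K :: 'a mpoly poly \<Rightarrow> _"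
        by (rule comm_ring_hom_unchart)
      have un_\<psi>: "unchart N K (\<psi> f) = f" for f
        unfolding \<psi>_def by (rule unchart_chart[OF rep(2)])
      have "(\<Sum>j<n. A i j * zz j) = 0" if "i < m" for i
      proof -
        have "(\<Sum>j<n. A i j * zz j) = unchart N K (\<Sum>j<n. \<psi> (A i j) * (z j + [:c':] * y j))"
          by (simp add: zz_def un.hom_sum un.hom_mult un_\<psi>)
        also have "(\<Sum>j<n. \<psi> (A i j) * (z j + [:c':] * y j)) =
            (\<Sum>j<n. \<psi> (A i j) * z j) + [:c':] * (\<Sum>j<n. \<psi> (A i j) * y j)"
          by (simp add: distrib_left sum.distrib smult_sum_right)
        finally show ?thesis
          using ker_z[OF that] y(1)[OF that] by simp
      qed
      moreover have "deg_le (Suc N) 0 cc"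
        unfolding cc_def using F.filt_mult[OF c'(1) c(1)] by (intro deg_le_unshift[OF rep(2)]) simp
      moreover have "\<not> Const \<pi> dvd cc"
      proof
        assume "Const \<pi> dvd cc"
        from \<psi>.hom_dvd[OF this] have "[:Const \<pi>:] dvd [:c' * c:]"
          unfolding \<psi>_\<pi> by (simp only: cc_def \<psi>_def chart_unshift[OF rep(2)])
        then show False
          using prime' c c' by (simp add: prime_elem_dvd_mult_iff)
      qed
      moreover have "Const \<pi> dvd zz j - cc * w j" if "j < n" for j
      proof -
        have "z j + [:c':] * y j - [:c' * c:] * \<psi> (w j) =
            (z j - [:c':] * w' j) + [:c':] * (w' j + y j - [:c:] * \<psi> (w j))"
          by (simp add: algebra_simps smult_add_right smult_diff_right)
        also have "[:Const \<pi>:] dvd \<dots>"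
          using zw'[OF that] w'y[OF that] by (intro dvd_add dvd_mult)
        finally have "unchart N K [:Const \<pi>:] dvd unchart N K (z j + [:c':] * y j - [:c' * c:] * \<psi> (w j))"
          by (rule un.hom_dvd)
        then show ?thesis
          unfolding un.hom_minus un.hom_mult un_\<psi> unchart_const unshift_Const
          by (simp only: zz_def cc_def)
      qed
      moreover have "deg_le (Suc N) (D + lift_degree (Suc N) d m) (zz j)" if "j < n" for j
      proof -
        have "poly_filt (deg_le N) (D + M) ([:c':] * y j)"
          using G.filt_mult[OF F.poly_filt_const[OF c'(1)] y(2)[OF that]] by simp
        then have "poly_filt (deg_le N) (D + M + lift_degree N d (m * H) + M) (z j + [:c':] * y j)"
          by (intro G.filt_add deg_z[OF that]) (rule G.filt_mono, auto)
        then have "deg_le (Suc N) (D + M + lift_degree N d (m * H) + M) (zz j)"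
          unfolding zz_def by (rule deg_le_unchart[OF rep(2)])
        then show ?thesis
          by (simp add: M_def H_def mult_2 add_ac)
      qed
      ultimately show ?thesis
        by blast
    qed
  qed
qed

section \<open>Eliminating parameters\<close>

text \<open>Unlike \<open>deg_le\<close>, this excludes the extra variables; it describes the
  polynomials in the ring of the theorem.\<close>

definition bounded_poly :: "nat \<Rightarrow> nat \<Rightarrow> 'a::zero mpoly \<Rightarrow> bool" where
  "bounded_poly N D f \<longleftrightarrow> (\<forall>m\<in>Poly_Mapping.keys f. Poly_Mapping.keys m \<subseteq> {..<N} \<and> mdeg N m \<le> D)"

lemma ring_filtration_bounded: "ring_filtration (bounded_poly N :: nat \<Rightarrow> 'a::comm_ring_1 mpoly \<Rightarrow> bool)"
proof
  fix a b n :: nat and x y :: "'a mpoly"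
  show "bounded_poly N n 0" "bounded_poly N 0 1"
    by (auto simp: bounded_poly_def)
  show "bounded_poly N n (x + y)" if "bounded_poly N n x" "bounded_poly N n y"
    using that Poly_Mapping.keys_add[of x y] by (auto simp: bounded_poly_def)
  show "bounded_poly N n (- x)" if "bounded_poly N n x"
    using that by (auto simp: bounded_poly_def in_keys_iff)
  show "bounded_poly N (a + b) (x * y)" if x: "bounded_poly N a x" and y: "bounded_poly N b y"
    unfolding bounded_poly_def
  proof
    fix m assume "m \<in> Poly_Mapping.keys (x * y)"
    then obtain k l where "m = k + l" "k \<in> Poly_Mapping.keys x" "l \<in> Poly_Mapping.keys y"
      using keys_mult[of x y] by auto
    then show "Poly_Mapping.keys m \<subseteq> {..<N} \<and> mdeg N m \<le> a + b"
      using x y Poly_Mapping.keys_add[of k l] by (fastforce simp: bounded_poly_def intro: add_mono)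
  qed
  show "bounded_poly N b x" if "bounded_poly N a x" "a \<le> b"
    using that by (auto simp: bounded_poly_def)
qed

lemma bounded_imp_deg_le: "bounded_poly N D f \<Longrightarrow> deg_le N D f"
  by (auto simp: bounded_poly_def deg_le_def)

lemma bounded_single: "Poly_Mapping.keys m \<subseteq> {..<N} \<Longrightarrow> mdeg N m \<le> D \<Longrightarrow> bounded_poly N D (Poly_Mapping.single m c)"
  by (simp add: bounded_poly_def)

lemma bounded_Const [simp]: "bounded_poly N D (Const c)"
  by (simp add: bounded_poly_def)

lemma bounded_Const_mult_cancel:
  "bounded_poly N D (Const c * f) \<Longrightarrow> c \<noteq> 0 \<Longrightarrow> bounded_poly N D f" for c :: "'a::idom"
  by (auto simp: bounded_poly_def in_keys_iff lookup_Const_mult)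

text \<open>The lifts of \<open>bounded_lift\<close> involve variables \<open>x\<^sub>i\<close> with \<open>i \<ge> N\<close>.  Taking the coefficient of one
  monomial in these is linear over the polynomials in \<open>x\<^sub>0, \<dots>, x\<^sub>N\<^sub>-\<^sub>1\<close> and so removes them.\<close>

definition separate :: "nat \<Rightarrow> 'a::comm_ring_1 mpoly \<Rightarrow> 'a mpoly mpoly" where
  "separate N = subst (\<lambda>c. Const (Const c)) (\<lambda>i. if i < N then Const (Var i) else Var i)"

definition param_coeff :: "nat \<Rightarrow> monomial \<Rightarrow> 'a::comm_ring_1 mpoly \<Rightarrow> 'a mpoly" where
  "param_coeff N m0 f = Poly_Mapping.lookup (separate N f) m0"

lemma comm_ring_hom_Const_Const: "comm_ring_hom (\<lambda>c :: 'a::comm_ring_1. Const (Const c))"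
  by (rule comm_ring_hom_comp[OF comm_ring_hom_Const comm_ring_hom_Const])

lemma comm_ring_hom_separate: "comm_ring_hom (separate N)"
  unfolding separate_def by (rule comm_ring_hom_subst[OF comm_ring_hom_Const_Const])

lemma separate_bounded:
  fixes f :: "'a::comm_ring_1 mpoly"
  assumes "bounded_poly N D f"
  shows "separate N f = Const f"
proof -
  interpret C: comm_ring_hom "Const :: 'a mpoly \<Rightarrow> _"
    by (rule comm_ring_hom_Const)
  have mon: "mon_subst (\<lambda>i. if i < N then Const (Var i) else Var i) m = Const (Poly_Mapping.single m (1 :: 'a))"
    if "m \<in> Poly_Mapping.keys f" for m
  proof -
    have "mon_subst (\<lambda>i. if i < N then Const (Var i) else Var i) m = Const (mon_subst Var m :: 'a mpoly)"
      unfolding mon_subst_def C.hom_prod C.hom_power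
      by (rule prod.cong) (use assms that in \<open>auto simp: bounded_poly_def\<close>)
    then show ?thesis
      by (simp only: mon_subst_Var)
  qed
  have "separate N f = (\<Sum>m\<in>Poly_Mapping.keys f. Const (Poly_Mapping.single m (Poly_Mapping.lookup f m)))"
    unfolding separate_def subst_def by (rule sum.cong) (simp_all add: mon mult_single)
  also have "\<dots> = Const f"
    unfolding C.hom_sum[symmetric] by (simp only: mpoly_eq_sum_single[symmetric])
  finally show ?thesis .
qed

lemma separate_deg_le_0:
  fixes c :: "'a::comm_ring_1 mpoly"
  assumes "deg_le N 0 c"
  shows "Poly_Mapping.lookup (separate N c) m0 = Const (Poly_Mapping.lookup c m0)"
proof -
  have mon: "mon_subst (\<lambda>i. if i < N then Const (Var i) else Var i) m = (Poly_Mapping.single m 1 :: 'a mpoly mpoly)"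
    if "m \<in> Poly_Mapping.keys c" for m
  proof -
    have "i \<notin> Poly_Mapping.keys m" if "i < N" for i
      using assms \<open>m \<in> Poly_Mapping.keys c\<close> that by (auto simp: deg_le_def mdeg_def in_keys_iff)
    then have "mon_subst (\<lambda>i. if i < N then Const (Var i) else Var i) m = (mon_subst Var m :: 'a mpoly mpoly)"
      unfolding mon_subst_def by (intro prod.cong) auto
    then show ?thesis
      by (simp only: mon_subst_Var)
  qed
  have "separate N c = (\<Sum>m\<in>Poly_Mapping.keys c. Poly_Mapping.single m (Const (Poly_Mapping.lookup c m)))"
    unfolding separate_def subst_def by (rule sum.cong) (simp_all add: mon mult_single)
  then show ?thesis
    by (auto simp: lookup_sum lookup_single when_def in_keys_iff)
qed

lemma param_coeff_add: "param_coeff N m0 (f + g) = param_coeff N m0 f + param_coeff N m0 g"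
proof -
  interpret comm_ring_hom "separate N :: 'a mpoly \<Rightarrow> _"
    by (rule comm_ring_hom_separate)
  show ?thesis
    by (simp add: param_coeff_def hom_add lookup_add)
qed

lemma param_coeff_diff: "param_coeff N m0 (f - g) = param_coeff N m0 f - param_coeff N m0 g"
  using param_coeff_add[of N m0 "f - g" g] by simp

lemma param_coeff_0 [simp]: "param_coeff N m0 0 = 0"
  using param_coeff_add[of N m0 0 0] by simp

lemma param_coeff_sum: "param_coeff N m0 (sum f I) = (\<Sum>i\<in>I. param_coeff N m0 (f i))"
  by (induction I rule: infinite_finite_induct) (simp_all add: param_coeff_add)

lemma param_coeff_mult:
  fixes f :: "'a::comm_ring_1 mpoly"
  assumes "bounded_poly N D f"
  shows "param_coeff N m0 (f * g) = f * param_coeff N m0 g"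
proof -
  interpret comm_ring_hom "separate N :: 'a mpoly \<Rightarrow> _"
    by (rule comm_ring_hom_separate)
  show ?thesis
    by (simp add: param_coeff_def hom_mult separate_bounded[OF assms] lookup_Const_mult)
qed

lemma param_coeff_deg_le_0: "deg_le N 0 c \<Longrightarrow> param_coeff N m0 c = Const (Poly_Mapping.lookup c m0)"
  unfolding param_coeff_def by (rule separate_deg_le_0)

lemma bounded_param_coeff:
  fixes f :: "'a::comm_ring_1 mpoly"
  assumes "deg_le N D f"
  shows "bounded_poly N D (param_coeff N m0 f)"
proof -
  interpret B: ring_filtration "bounded_poly N :: nat \<Rightarrow> 'a mpoly \<Rightarrow> bool"
    by (rule ring_filtration_bounded)
  \<comment> \<open>Degrees are measured in the coefficients; the outer variables have degree
    0.\<close>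
  interpret ring_filtration "\<lambda>D (q :: 'a mpoly mpoly). \<forall>k. bounded_poly N D (Poly_Mapping.lookup q k)"
  proof
    fix a b n :: nat and x y :: "'a mpoly mpoly"
    show "\<forall>k. bounded_poly N (a + b) (Poly_Mapping.lookup (x * y) k)"
      if "\<forall>k. bounded_poly N a (Poly_Mapping.lookup x k)" "\<forall>k. bounded_poly N b (Poly_Mapping.lookup y k)"
      by (subst mpoly_mult_eq_sum)
        (use that in \<open>auto simp: lookup_sum lookup_single when_def B.filt_zero intro!: B.filt_sum B.filt_mult\<close>)
    show "\<forall>k. bounded_poly N 0 (Poly_Mapping.lookup (1 :: 'a mpoly mpoly) k)"
      by (auto simp: lookup_one when_def B.filt_zero B.filt_one)
  qed (auto simp: lookup_add B.filt_zero intro: B.filt_add B.filt_uminus B.filt_mono)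
  have "\<forall>k. bounded_poly N D (Poly_Mapping.lookup (separate N f) k)"
    unfolding separate_def
    by (rule filt_subst[OF _ _ assms])
      (auto simp: lookup_single when_def B.filt_zero B.filt_one' bounded_single)
  then show ?thesis
    by (simp add: param_coeff_def)
qed

section \<open>Membership over the rationals\<close>

lemma prime_elem_X: "prime_elem ([:0, 1:] :: int poly)"
proof (rule prime_elemI)
  have X_dvd: "[:0, 1:] dvd p \<longleftrightarrow> poly p 0 = 0" for p :: "int poly"
    using poly_eq_0_iff_dvd[of p 0] by simp
  show "\<not> ([:0, 1:] :: int poly) dvd 1"
    by (simp add: X_dvd)
  show "[:0, 1:] dvd p \<or> [:0, 1:] dvd q" if "[:0, 1:] dvd p * q" for p q :: "int poly"
    using that by (simp add: X_dvd)
qed simp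

lemma X_separated: "p \<noteq> 0 \<Longrightarrow> \<exists>k. \<not> [:0, 1:] ^ k dvd p" for p :: "int poly"
proof
  assume "p \<noteq> 0"
  show "\<not> [:0, 1:] ^ Suc (degree p) dvd p"
  proof
    assume "[:0, 1:] ^ Suc (degree p) dvd p"
    then have "degree ([:0, 1 :: int:] ^ Suc (degree p)) \<le> degree p"
      using \<open>p \<noteq> 0\<close> by (rule dvd_imp_degree_le)
    then show False
      by (simp add: degree_power_eq del: power_Suc)
  qed
qed

text \<open>The vector \<open>(T y, 1)\<close> is a syzygy of \<open>(g, - T f)\<close> congruent to \<open>(0, 1)\<close> modulo \<open>T\<close>.\<close>

lemma rational_membership:
  fixes f :: "int mpoly" and g y :: "nat \<Rightarrow> int mpoly"
  assumes f: "bounded_poly N d f" and g: "\<And>j. j < n \<Longrightarrow> bounded_poly N d (g j)"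
    and mem: "f = (\<Sum>j<n. g j * y j)"
  obtains \<delta> w where "\<delta> \<noteq> 0" "\<And>j. j < n \<Longrightarrow> bounded_poly N (lift_degree N d 1) (w j)"
    "Const \<delta> * f = (\<Sum>j<n. g j * w j)"
proof -
  define T :: "int poly" where "T = [:0, 1:]"
  have T0: "T \<noteq> 0"
    by (simp add: T_def)
  have Td: "T dvd p \<longleftrightarrow> poly p 0 = 0" for p
    using poly_eq_0_iff_dvd[of p 0] by (simp add: T_def)
  have \<kappa>: "comm_ring_hom (\<lambda>c :: int. Const [:c:])" "comm_ring_hom (\<lambda>p :: int poly. Const (poly p 0))"
    by (rule comm_ring_hom_comp[OF comm_ring_hom_Const comm_ring_hom_const_poly])
      (rule comm_ring_hom_comp[OF comm_ring_hom_Const], rule comm_ring_homI, simp_all)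
  define \<iota> :: "int mpoly \<Rightarrow> int poly mpoly" where "\<iota> = subst (\<lambda>c. Const [:c:]) Var"
  \<comment> \<open>Evaluation at \<open>T = 0\<close>, a retraction of the extension of
    coefficients \<open>\<iota>\<close>.\<close>
  define \<tau> :: "int poly mpoly \<Rightarrow> int mpoly" where "\<tau> = subst (\<lambda>p. Const (poly p 0)) Var"
  interpret \<iota>: comm_ring_hom \<iota>
    unfolding \<iota>_def by (rule comm_ring_hom_subst[OF \<kappa>(1)])
  interpret \<tau>: comm_ring_hom \<tau>
    unfolding \<tau>_def by (rule comm_ring_hom_subst[OF \<kappa>(2)])
  interpret F: ring_filtration "deg_le N :: nat \<Rightarrow> int poly mpoly \<Rightarrow> bool"
    by (rule ring_filtration_deg_le)
  interpret FZ: ring_filtration "deg_le N :: nat \<Rightarrow> int mpoly \<Rightarrow> bool"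
    by (rule ring_filtration_deg_le)
  have deg_\<iota>: "deg_le N D (\<iota> h)" if "deg_le N D h" for D h
    unfolding \<iota>_def by (rule F.filt_subst[OF _ _ that]) auto
  have deg_\<tau>: "deg_le N D (\<tau> h)" if "deg_le N D h" for D h
    unfolding \<tau>_def by (rule FZ.filt_subst[OF _ _ that]) auto
  have \<tau>_Const: "\<tau> (Const p) = Const (poly p 0)" for p
    by (simp add: \<tau>_def \<kappa>)
  have \<tau>_\<iota>: "\<tau> (\<iota> h) = h" for h
  proof (rule mpoly_hom_eqI[of "\<lambda>h. \<tau> (\<iota> h)" "\<lambda>h. h"])
    show "comm_ring_hom (\<lambda>h. \<tau> (\<iota> h))"
      by (rule comm_ring_hom_comp) unfold_locales
  qed (auto intro: comm_ring_homI simp: \<tau>_def \<iota>_def \<kappa>)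
  have lookup_\<tau>: "Poly_Mapping.lookup (\<tau> h) m = poly (Poly_Mapping.lookup h m) 0" for h m
  proof -
    have "\<tau> h = (\<Sum>m\<in>Poly_Mapping.keys h. Poly_Mapping.single m (poly (Poly_Mapping.lookup h m) 0))"
      unfolding \<tau>_def subst_def mon_subst_Var by (simp add: mult_single)
    then show ?thesis
      by (auto simp: lookup_sum lookup_single when_def in_keys_iff)
  qed
  define A where "A i j = (if j < n then \<iota> (g j) else - Const T * \<iota> f)" for i j :: nat
  define v where "v j = (if j < n then Const T * \<iota> (y j) else 1)" for j
  define w where "w j = (if j < n then 0 else 1 :: int poly mpoly)" for j
  have split: "(\<Sum>j<Suc n. A i j * x j) = (\<Sum>j<n. \<iota> (g j) * x j) - Const T * (\<iota> f * x n)" for i x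
    by (simp add: A_def mult.assoc)
  have "deg_le N d (A i j)" if "i < 1" "j < Suc n" for i j
    using F.filt_mult[of 0 "Const T" d "\<iota> f"] deg_\<iota> bounded_imp_deg_le[OF f] bounded_imp_deg_le[OF g]
    by (auto simp: A_def intro!: F.filt_uminus)
  then obtain E where E: "\<And>v w D. (\<forall>i<1. Const T ^ E dvd (\<Sum>j<Suc n. A i j * v j)) \<and>
      (\<forall>j<Suc n. Const T dvd v j - w j \<and> deg_le N D (w j)) \<Longrightarrow>
      \<exists>z c. (\<forall>i<1. (\<Sum>j<Suc n. A i j * z j) = 0) \<and> deg_le N 0 c \<and> \<not> Const T dvd c \<and>
        (\<forall>j<Suc n. Const T dvd z j - c * w j \<and> deg_le N (D + lift_degree N d 1) (z j))"
    using bounded_lift[OF prime_elem_X X_separated, of 1 "Suc n" N d A] unfolding T_def by blast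
  have "(\<Sum>j<Suc n. A i j * v j) = 0" for i
  proof -
    have "(\<Sum>j<n. \<iota> (g j) * v j) = Const T * \<iota> f"
      unfolding mem \<iota>.hom_sum \<iota>.hom_mult by (simp add: v_def sum_distrib_left mult_ac)
    then show ?thesis
      unfolding split by (simp add: v_def)
  qed
  moreover have "Const T dvd v j - w j \<and> deg_le N 0 (w j)" for j
    by (auto simp: v_def w_def F.filt_zero)
  ultimately obtain z c where z: "(\<Sum>j<Suc n. A 0 j * z j) = 0" "deg_le N 0 c" "\<not> Const T dvd c"
      "\<And>j. j < Suc n \<Longrightarrow> Const T dvd z j - c * w j" "\<And>j. j < Suc n \<Longrightarrow> deg_le N (lift_degree N d 1) (z j)"
    using E[of v w 0] by auto
  \<comment> \<open>Since \<open>w\<close> vanishes at the first \<open>n\<close> places, one factor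
    \<open>T\<close> can be cancelled from the whole equation. At \<open>T = 0\<close> it expresses
    \<open>f\<close> times the last entry of \<open>z\<close> by the \<open>g j\<close>, and there
    that entry equals the nonzero \<open>\<tau> c\<close>.\<close>
  have "Const T dvd z j" if "j < n" for j
    using z(4)[of j] that by (simp add: w_def)
  then obtain z' where z': "\<And>j. j < n \<Longrightarrow> z j = Const T * z' j"
    unfolding dvd_def by metis
  have deg_z': "deg_le N (lift_degree N d 1) (z' j)" if "j < n" for j
    using z(5)[of j] that z'[OF that] T0 by (auto intro: deg_le_Const_mult_cancel)
  have "Const T * ((\<Sum>j<n. \<iota> (g j) * z' j) - \<iota> f * z n) = 0"
  proof -
    have "(\<Sum>j<n. \<iota> (g j) * z j) = Const T * (\<Sum>j<n. \<iota> (g j) * z' j)"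
      by (simp add: z' sum_distrib_left mult_ac)
    then show ?thesis
      using z(1) unfolding split by (simp add: right_diff_distrib)
  qed
  moreover have "Const T \<noteq> 0"
    using T0 by (metis lookup_single_eq lookup_zero)
  ultimately have "(\<Sum>j<n. \<iota> (g j) * z' j) = \<iota> f * z n"
    by simp
  from arg_cong[OF this, of \<tau>] have eq: "(\<Sum>j<n. g j * \<tau> (z' j)) = f * \<tau> (z n)"
    by (simp add: \<tau>.hom_sum \<tau>.hom_mult \<tau>_\<iota>)
  have "\<tau> (Const T) dvd \<tau> (z n - c)"
    using z(4)[of n] by (intro \<tau>.hom_dvd) (simp add: w_def)
  then have \<tau>_z: "\<tau> (z n) = \<tau> c"
    by (simp add: \<tau>_Const T_def \<tau>.hom_minus)
  obtain m0 where m0: "Poly_Mapping.lookup (\<tau> c) m0 \<noteq> 0"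
    using z(3) by (auto simp: Const_dvd_iff Td lookup_\<tau>)
  show thesis
  proof (rule that[of "Poly_Mapping.lookup (\<tau> c) m0" "\<lambda>j. param_coeff N m0 (\<tau> (z' j))"])
    show "bounded_poly N (lift_degree N d 1) (param_coeff N m0 (\<tau> (z' j)))" if "j < n" for j
      by (intro bounded_param_coeff deg_\<tau> deg_z' that)
    have "param_coeff N m0 (f * \<tau> c) = f * Const (Poly_Mapping.lookup (\<tau> c) m0)"
      by (simp add: param_coeff_mult[OF f] param_coeff_deg_le_0[OF deg_\<tau>[OF z(2)]])
    moreover have "param_coeff N m0 (\<Sum>j<n. g j * \<tau> (z' j)) = (\<Sum>j<n. g j * param_coeff N m0 (\<tau> (z' j)))"
      by (simp add: param_coeff_sum param_coeff_mult[OF g])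
    ultimately show "Const (Poly_Mapping.lookup (\<tau> c) m0) * f = (\<Sum>j<n. g j * param_coeff N m0 (\<tau> (z' j)))"
      using eq \<tau>_z by (simp add: mult.commute)
  qed (use m0 in auto)
qed

section \<open>Lifting syzygies modulo a prime\<close>

lemma int_prime_separated:
  fixes p x :: int
  assumes "prime_elem p" "x \<noteq> 0"
  shows "\<exists>k. \<not> p ^ k dvd x"
proof -
  have "finite {k. p ^ k dvd x}"
    using assms by (intro finite_divisor_powers) (auto dest: prime_elem_not_unit)
  then show ?thesis
    using ex_new_if_finite[OF infinite_UNIV_nat] by blast
qed

text \<open>Removes the multiplier \<open>c\<close> of \<open>bounded_lift\<close>. At a monomial
  where the coefficient \<delta> of \<open>c\<close> is prime to \<open>p\<close>, extraction of
  coefficients replaces \<open>c\<close> by \<delta>, and an inverse \<open>e\<close> of \<delta>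
  modulo \<open>p\<close> does the rest.\<close>

lemma syzygy_lift:
  fixes p :: int and g v w :: "nat \<Rightarrow> int mpoly"
  assumes p: "prime_elem p" and g: "\<And>j. j < n \<Longrightarrow> bounded_poly N d (g j)"
    and v: "(\<Sum>j<n. g j * v j) = 0"
    and vw: "\<And>j. j < n \<Longrightarrow> Const p dvd v j - w j" and w: "\<And>j. j < n \<Longrightarrow> bounded_poly N D (w j)"
  obtains z where "(\<Sum>j<n. g j * z j) = 0" "\<And>j. j < n \<Longrightarrow> Const p dvd z j - w j"
    "\<And>j. j < n \<Longrightarrow> bounded_poly N (D + lift_degree N d 1) (z j)"
proof -
  interpret B: ring_filtration "bounded_poly N :: nat \<Rightarrow> int mpoly \<Rightarrow> bool"
    by (rule ring_filtration_bounded)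
  obtain E where E: "\<forall>v w D. (\<forall>i<1::nat. Const p ^ E dvd (\<Sum>j<n. g j * v j)) \<and>
      (\<forall>j<n. Const p dvd v j - w j \<and> deg_le N D (w j)) \<longrightarrow>
      (\<exists>z c. (\<forall>i<1::nat. (\<Sum>j<n. g j * z j) = 0) \<and> deg_le N 0 c \<and> \<not> Const p dvd c \<and>
        (\<forall>j<n. Const p dvd z j - c * w j \<and> deg_le N (D + lift_degree N d 1) (z j)))"
    by (rule exE[OF bounded_lift[OF p int_prime_separated[OF p], of 1 n N d "\<lambda>_. g", OF _ bounded_imp_deg_le[OF g]]])
      auto
  obtain z c where z: "(\<Sum>j<n. g j * z j) = 0" "deg_le N 0 c" "\<not> Const p dvd c"
      "\<And>j. j < n \<Longrightarrow> Const p dvd z j - c * w j" "\<And>j. j < n \<Longrightarrow> deg_le N (D + lift_degree N d 1) (z j)"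
    using E[rule_format, of v w D] v vw bounded_imp_deg_le[OF w] by auto
  obtain m0 where m0: "\<not> p dvd Poly_Mapping.lookup c m0"
    using z(3) by (auto simp: Const_dvd_iff)
  define \<delta> where "\<delta> = Poly_Mapping.lookup c m0"
  have "coprime p \<delta>"
    using p m0 by (simp add: \<delta>_def prime_elem_imp_coprime)
  then obtain e k where "e * \<delta> + k * p = 1"
    using bezout_int[of \<delta> p] by (auto simp: coprime_iff_gcd_eq_1 gcd.commute)
  then have e: "p dvd e * \<delta> - 1"
    by (metis add_diff_cancel_left' dvd_minus_iff dvd_triv_right minus_diff_eq)
  show thesis
  proof (rule that[of "\<lambda>j. Const e * param_coeff N m0 (z j)"])
    have "(\<Sum>j<n. g j * param_coeff N m0 (z j)) = param_coeff N m0 (\<Sum>j<n. g j * z j)"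
      by (simp add: param_coeff_sum param_coeff_mult[OF g])
    then have "(\<Sum>j<n. g j * param_coeff N m0 (z j)) = 0"
      by (simp add: z(1))
    then show "(\<Sum>j<n. g j * (Const e * param_coeff N m0 (z j))) = 0"
      by (simp add: mult.left_commute[of _ "Const e"] flip: sum_distrib_left)
  next
    fix j assume j: "j < n"
    show "bounded_poly N (D + lift_degree N d 1) (Const e * param_coeff N m0 (z j))"
      using B.filt_mult[of 0 "Const e" _ "param_coeff N m0 (z j)"] bounded_param_coeff[OF z(5)[OF j]] by simp
    obtain h where "z j - c * w j = Const p * h"
      using z(4)[OF j] by (rule dvdE)
    then have "param_coeff N m0 (z j) - param_coeff N m0 (w j * c) = Const p * param_coeff N m0 h"
      by (simp add: param_coeff_mult[of N 0 "Const p"] mult.commute[of _ c] flip: param_coeff_diff)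
    then have "param_coeff N m0 (z j) = w j * Const \<delta> + Const p * param_coeff N m0 h"
      unfolding param_coeff_mult[OF w[OF j]] param_coeff_deg_le_0[OF z(2)] \<delta>_def by (simp add: diff_eq_eq add.commute)
    then have "Const e * param_coeff N m0 (z j) - w j =
        Const (e * \<delta> - 1) * w j + Const p * (Const e * param_coeff N m0 h)"
      by (simp add: algebra_simps single_diff mult_single)
    moreover have "Const p dvd Const (e * \<delta> - 1)"
      using e by (auto simp: Const_dvd_iff lookup_single when_def)
    ultimately show "Const p dvd Const e * param_coeff N m0 (z j) - w j"
      by auto
  qed
qed

section \<open>Integer linear systems\<close>

text \<open>The Leibniz formula has \<open>fact r\<close> summands, and
  \<open>fact r \<le> r ^ r\<close>.\<close>

lemma abs_minor_le:
  fixes A :: "nat \<Rightarrow> nat \<Rightarrow> int" and H :: real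
  assumes "length is = r" "length js = r"
    and "\<And>i j. i \<in> set is \<Longrightarrow> j \<in> set js \<Longrightarrow> \<bar>real_of_int (A i j)\<bar> \<le> H"
  shows "\<bar>real_of_int (minor A is js)\<bar> \<le> (real r * H) ^ r"
proof -
  let ?S = "{\<sigma>. \<sigma> permutes {0..<r}}"
  have "minor A is js = (\<Sum>\<sigma>\<in>?S. signof \<sigma> * (\<Prod>a = 0..<r. A (is ! a) (js ! \<sigma> a)))"
    unfolding minor_def using assms(1,2)
    by (subst det_def'[of _ r]) (auto intro!: sum.cong prod.cong dest: permutes_in_image)
  then have "\<bar>real_of_int (minor A is js)\<bar> \<le> (\<Sum>\<sigma>\<in>?S. \<bar>real_of_int (signof \<sigma> * (\<Prod>a = 0..<r. A (is ! a) (js ! \<sigma> a)))\<bar>)"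
    by (simp only: of_int_sum sum_abs)
  also have "\<dots> \<le> (\<Sum>\<sigma>\<in>?S. H ^ r)"
  proof (rule sum_mono)
    fix \<sigma> assume "\<sigma> \<in> ?S"
    then have \<sigma>: "\<sigma> a < r" if "a < r" for a
      using that permutes_in_image[of \<sigma> "{0..<r}" a] by simp
    have "\<bar>real_of_int (signof \<sigma> * (\<Prod>a = 0..<r. A (is ! a) (js ! \<sigma> a)))\<bar> = (\<Prod>a = 0..<r. \<bar>real_of_int (A (is ! a) (js ! \<sigma> a))\<bar>)"
      by (simp add: abs_mult sign_def abs_prod)
    also have "\<dots> \<le> (\<Prod>a = 0..<r. H)"
      by (rule prod_mono) (use assms \<sigma> in auto)
    finally show "\<bar>real_of_int (signof \<sigma> * (\<Prod>a = 0..<r. A (is ! a) (js ! \<sigma> a)))\<bar> \<le> H ^ r"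
      by simp
  qed
  also have "\<dots> = fact r * H ^ r"
    using card_permutations[of "{0..<r}" r] by simp
  also have "\<dots> \<le> real r ^ r * H ^ r"
  proof (cases "r = 0")
    case False
    then have "hd is \<in> set is" "hd js \<in> set js"
      using assms(1,2) by (auto intro!: hd_in_set simp flip: length_greater_0_conv)
    then have "0 \<le> H"
      using assms(3)[of "hd is" "hd js"] by linarith
    moreover have "fact r \<le> real r ^ r"
      using fact_le_power[of r, where 'a = real] by simp
    ultimately show ?thesis
      by (intro mult_right_mono) auto
  qed simp
  finally show ?thesis
    by (simp add: power_mult_distrib)
qed

text \<open>A maximal nonvanishing minor \<open>D\<close> is a denominator for every solvable
  right-hand side. The column relations move the given solution to the pivot columns; there Cramer's
  rule yields \<open>D * b i\<close> with integral unknowns \<open>x0\<close>, obtained by applying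
  the adjugate to \<open>b\<close>. Thus the bound sees only the entries of \<open>A\<close>, not
  the size of \<open>b\<close> or of the given solution.\<close>

lemma integer_solution_bound:
  fixes A :: "nat \<Rightarrow> nat \<Rightarrow> int" and b x :: "nat \<Rightarrow> int" and H :: real
  assumes A: "\<And>i j. i < m \<Longrightarrow> j < n \<Longrightarrow> \<bar>real_of_int (A i j)\<bar> \<le> H" and "1 \<le> H"
    and "\<delta>0 \<noteq> 0" and sol: "\<And>i. i < m \<Longrightarrow> \<delta>0 * b i = (\<Sum>j<n. A i j * x j)"
  obtains \<delta> x' where "\<delta> > 0" "real_of_int \<delta> \<le> (real m * H) ^ m"
    "\<And>i. i < m \<Longrightarrow> \<delta> * b i = (\<Sum>j<n. A i j * x' j)"
proof -
  obtain r "is" js where r: "r \<le> m" "length is = r" "length js = r"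
      "set is \<subseteq> {..<m}" "set js \<subseteq> {..<n}" "minor A is js \<noteq> 0"
    and zero: "\<And>is js. length is = Suc r \<Longrightarrow> length js = Suc r \<Longrightarrow> set is \<subseteq> {..<m} \<Longrightarrow> set js \<subseteq> {..<n} \<Longrightarrow>
      minor A is js = 0"
    using maximal_minor[of m n A] by blast
  define D where "D = minor A is js"
  define C where "C j l = - ((- 1) ^ (r + l) * minor A is (take l js @ drop (Suc l) js @ [j]))" for j l
  have rel: "D * A i j = (\<Sum>l<r. C j l * A i (js ! l))" if "i < m" "j < n" for i j
    unfolding D_def C_def by (rule minor_relation[OF r(2-5) _ that]) (rule zero)
  define y where "y l = (\<Sum>j<n. x j * C j l)" for l
  have Dy: "D * (\<delta>0 * b i) = (\<Sum>l<r. A i (js ! l) * y l)" if "i < m" for i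
  proof -
    have "D * (\<delta>0 * b i) = (\<Sum>j<n. x j * (D * A i j))"
      unfolding sol[OF that] by (simp add: sum_distrib_left mult_ac)
    also have "\<dots> = (\<Sum>j<n. \<Sum>l<r. A i (js ! l) * (x j * C j l))"
      by (rule sum.cong[OF refl]) (use that in \<open>simp add: rel sum_distrib_left mult_ac\<close>)
    also have "\<dots> = (\<Sum>l<r. A i (js ! l) * y l)"
      by (subst sum.swap) (simp add: y_def sum_distrib_left)
    finally show ?thesis .
  qed
  obtain K where K: "\<And>y l. l < r \<Longrightarrow> D * y l = (\<Sum>a<r. K l a * (\<Sum>l<r. A (is ! a) (js ! l) * y l))"
    using minor_cramer[OF r(2,3), of A] unfolding D_def by blast
  define x0 where "x0 l = (\<Sum>a<r. K l a * b (is ! a))" for l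
  have D0: "D \<noteq> 0"
    using r by (simp add: D_def)
  have is_lt: "is ! a < m" if "a < r" for a
    using r that subsetD[OF r(4) nth_mem[of a "is"]] by simp
  have "y l = \<delta>0 * x0 l" if "l < r" for l
  proof -
    have "D * y l = (\<Sum>a<r. K l a * (D * (\<delta>0 * b (is ! a))))"
      unfolding K[OF that, of y] by (rule sum.cong) (auto simp: Dy is_lt)
    also have "\<dots> = D * (\<delta>0 * x0 l)"
      by (simp add: x0_def sum_distrib_left mult_ac)
    finally show ?thesis
      using D0 by simp
  qed
  then have "\<delta>0 * (D * b i) = \<delta>0 * (\<Sum>l<r. A i (js ! l) * x0 l)" if "i < m" for i
    using Dy[OF that] by (simp add: sum_distrib_left mult_ac)
  then have Db: "D * b i = (\<Sum>l<r. A i (js ! l) * x0 l)" if "i < m" for i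
    using that \<open>\<delta>0 \<noteq> 0\<close> by simp
  \<comment> \<open>The sign makes the denominator positive, as the later descent on it
    requires.\<close>
  define x' where "x' j = sgn D * (\<Sum>l<r. if js ! l = j then x0 l else 0)" for j
  have js_lt: "js ! l < n" if "l < r" for l
    using r that subsetD[OF r(5) nth_mem[of l js]] by simp
  have x': "(\<Sum>j<n. A i j * x' j) = sgn D * (\<Sum>l<r. A i (js ! l) * x0 l)" for i
  proof -
    have "(\<Sum>j<n. A i j * x' j) = (\<Sum>j<n. \<Sum>l<r. if js ! l = j then sgn D * (A i j * x0 l) else 0)"
      by (auto simp: x'_def sum_distrib_left intro!: sum.cong)
    also have "\<dots> = (\<Sum>l<r. \<Sum>j<n. if js ! l = j then sgn D * (A i j * x0 l) else 0)"
      by (rule sum.swap)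
    also have "\<dots> = (\<Sum>l<r. sgn D * (A i (js ! l) * x0 l))"
      by (rule sum.cong) (use js_lt in \<open>auto simp: sum.delta\<close>)
    finally show ?thesis
      by (simp add: sum_distrib_left)
  qed
  show thesis
  proof (rule that[of "\<bar>D\<bar>" x'])
    show "\<bar>D\<bar> > 0"
      using D0 by simp
    have "\<bar>real_of_int D\<bar> \<le> (real r * H) ^ r"
      unfolding D_def by (rule abs_minor_le[OF r(2,3)]) (use A r in auto)
    also have "\<dots> \<le> (real m * H) ^ m"
    proof (cases "m = 0")
      case False
      have "1 * 1 \<le> real m * H"
        using False \<open>1 \<le> H\<close> by (intro mult_mono) auto
      moreover have "(real r * H) ^ r \<le> (real m * H) ^ r"
        using r \<open>1 \<le> H\<close> by (intro power_mono mult_right_mono) auto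
      ultimately show ?thesis
        using power_increasing[OF r(1), of "real m * H"] by simp
    qed (use r in simp)
    finally show "real_of_int \<bar>D\<bar> \<le> (real m * H) ^ m"
      by simp
    show "\<bar>D\<bar> * b i = (\<Sum>j<n. A i j * x' j)" if "i < m" for i
      unfolding x' Db[OF that, symmetric] by (simp add: abs_sgn mult_ac)
  qed
qed

section \<open>Comparison of coefficients as an integer linear system\<close>

definition monomials :: "nat \<Rightarrow> nat \<Rightarrow> monomial set" where
  "monomials N D = {m. Poly_Mapping.keys m \<subseteq> {..<N} \<and> mdeg N m \<le> D}"

lemma finite_card_monomials: "finite (monomials N D) \<and> card (monomials N D) \<le> (D + 1) ^ N"
proof -
  let ?\<phi> = "\<lambda>m. restrict (Poly_Mapping.lookup m) {..<N}"
  have inj: "inj_on ?\<phi> (monomials N D)"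
  proof (rule inj_onI)
    fix m m' assume *: "m \<in> monomials N D" "m' \<in> monomials N D" "?\<phi> m = ?\<phi> m'"
    show "m = m'"
    proof (rule poly_mapping_eqI)
      fix i
      show "Poly_Mapping.lookup m i = Poly_Mapping.lookup m' i"
      proof (cases "i < N")
        case True
        then show ?thesis
          using fun_cong[OF *(3), of i] by simp
      next
        case False
        then have "i \<notin> Poly_Mapping.keys m" "i \<notin> Poly_Mapping.keys m'"
          using * by (auto simp: monomials_def)
        then show ?thesis
          by (simp add: in_keys_iff)
      qed
    qed
  qed
  have "Poly_Mapping.lookup m i \<le> D" if "m \<in> monomials N D" "i < N" for m i
    using that member_le_sum[of i "{..<N}" "Poly_Mapping.lookup m"] by (auto simp: monomials_def mdeg_def)
  then have sub: "?\<phi> ` monomials N D \<subseteq> ({..<N} \<rightarrow>\<^sub>E {..D})"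
    by (auto split: if_splits)
  have fin: "finite ({..<N} \<rightarrow>\<^sub>E {..D})"
    by (intro finite_PiE) auto
  have "finite (monomials N D)"
    by (rule inj_on_finite[OF inj sub fin])
  moreover have "card (monomials N D) \<le> card ({..<N} \<rightarrow>\<^sub>E {..D})"
    by (rule card_inj_on_le[OF inj sub fin])
  ultimately show ?thesis
    by (simp add: card_PiE)
qed

lemma lookup_eq_0_if_bounded: "bounded_poly N D f \<Longrightarrow> m \<notin> monomials N D \<Longrightarrow> Poly_Mapping.lookup f m = 0"
  unfolding bounded_poly_def monomials_def not_in_keys_iff_lookup_eq_zero[symmetric] by blast

lemma bounded_eq_sum_monomials:
  assumes "bounded_poly N D f"
  shows "f = (\<Sum>m\<in>monomials N D. Poly_Mapping.single m (Poly_Mapping.lookup f m))"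
proof (rule poly_mapping_eqI)
  fix m
  show "Poly_Mapping.lookup f m =
      Poly_Mapping.lookup (\<Sum>m\<in>monomials N D. Poly_Mapping.single m (Poly_Mapping.lookup f m)) m"
    using finite_card_monomials[of N D] lookup_eq_0_if_bounded[OF assms, of m]
    by (auto simp: lookup_sum lookup_single when_def)
qed

lemma abs_lookup_mult_single_le:
  fixes g :: "int mpoly" and H :: real
  assumes "\<And>m. \<bar>real_of_int (Poly_Mapping.lookup g m)\<bar> \<le> H" "0 \<le> H"
  shows "\<bar>real_of_int (Poly_Mapping.lookup (g * Poly_Mapping.single a 1) \<mu>)\<bar> \<le> H"
proof -
  have "g * Poly_Mapping.single a 1 = (\<Sum>m\<in>Poly_Mapping.keys g. Poly_Mapping.single (m + a) (Poly_Mapping.lookup g m))"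
    by (subst mpoly_mult_eq_sum) simp
  then have eq: "Poly_Mapping.lookup (g * Poly_Mapping.single a 1) \<mu> =
      (\<Sum>m\<in>Poly_Mapping.keys g. if m + a = \<mu> then Poly_Mapping.lookup g m else 0)"
    by (simp add: lookup_sum lookup_single when_def)
  show ?thesis
  proof (cases "\<exists>m. m + a = \<mu>")
    case True
    then obtain m0 where "m0 + a = \<mu>"
      by blast
    then have "m + a = \<mu> \<longleftrightarrow> m = m0" for m
      by auto
    then show ?thesis
      unfolding eq using assms by (simp add: sum.delta)
  next
    case False
    then show ?thesis
      unfolding eq using assms by simp
  qed
qed

lemma mult_single_eq: "g * Poly_Mapping.single m c = Const c * (g * Poly_Mapping.single m 1)" for c :: "'a::comm_ring_1"
proof -
  have "Poly_Mapping.single m c = Const c * Poly_Mapping.single m 1"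
    by (simp add: mult_single)
  then show ?thesis
    by (simp only: mult.left_commute)
qed

text \<open>Rows are monomials of degree at most \<open>d + B\<close>, columns are pairs of an index
  \<open>j\<close> and a monomial of degree at most \<open>B\<close>, and the entries are
  coefficients of the \<open>g j\<close>. The number of rows limits the size of minors, which keeps
  \<open>n\<close> out of the bound.\<close>

lemma denominator_bound:
  fixes f :: "int mpoly" and g w :: "nat \<Rightarrow> int mpoly" and H :: real
  assumes f: "bounded_poly N d f" and g: "\<And>j. j < n \<Longrightarrow> bounded_poly N d (g j)"
    and H: "\<And>j m. j < n \<Longrightarrow> \<bar>real_of_int (Poly_Mapping.lookup (g j) m)\<bar> \<le> H" "1 \<le> H"
    and "\<delta>0 \<noteq> 0" and w: "\<And>j. j < n \<Longrightarrow> bounded_poly N B (w j)"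
    and sol: "Const \<delta>0 * f = (\<Sum>j<n. g j * w j)"
  defines "M \<equiv> (d + B + 1) ^ N"
  obtains \<delta> w' where "\<delta> > 0" "real_of_int \<delta> \<le> (real M * H) ^ M"
    "\<And>j. j < n \<Longrightarrow> bounded_poly N B (w' j)" "Const \<delta> * f = (\<Sum>j<n. g j * w' j)"
proof -
  interpret F: ring_filtration "bounded_poly N :: nat \<Rightarrow> int mpoly \<Rightarrow> bool"
    by (rule ring_filtration_bounded)
  define M0 where "M0 = card (monomials N (d + B))"
  define K where "K = card (monomials N B)"
  obtain h where h: "bij_betw h {..<M0} (monomials N (d + B))"
    using ex_bij_betw_nat_finite[of "monomials N (d + B)"] finite_card_monomials[of N "d + B"]
    by (auto simp: M0_def atLeast0LessThan)
  obtain k where k: "bij_betw k {..<K} (monomials N B)"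
    using ex_bij_betw_nat_finite[of "monomials N B"] finite_card_monomials[of N B]
    by (auto simp: K_def atLeast0LessThan)
  define e where "e j t = g j * Poly_Mapping.single (k t) 1" for j t
  define A where "A i b = Poly_Mapping.lookup (e (b div K) (b mod K)) (h i)" for i b
  define x where "x b = Poly_Mapping.lookup (w (b div K)) (k (b mod K))" for b
  have w_eq: "g j * w j = (\<Sum>t<K. Const (Poly_Mapping.lookup (w j) (k t)) * e j t)" if "j < n" for j
  proof -
    have "w j = (\<Sum>t<K. Poly_Mapping.single (k t) (Poly_Mapping.lookup (w j) (k t)))"
      using bounded_eq_sum_monomials[OF w[OF that]]
        sum.reindex_bij_betw[OF k, of "\<lambda>m. Poly_Mapping.single m (Poly_Mapping.lookup (w j) m)"] by simp
    then have "g j * w j = (\<Sum>t<K. g j * Poly_Mapping.single (k t) (Poly_Mapping.lookup (w j) (k t)))"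
      by (metis sum_distrib_left)
    also have "\<dots> = (\<Sum>t<K. Const (Poly_Mapping.lookup (w j) (k t)) * e j t)"
      unfolding e_def by (intro sum.cong refl mult_single_eq)
    finally show ?thesis .
  qed
  have sol': "\<delta>0 * Poly_Mapping.lookup f (h i) = (\<Sum>b<n * K. A i b * x b)" for i
  proof -
    have "\<delta>0 * Poly_Mapping.lookup f (h i) = Poly_Mapping.lookup (\<Sum>j<n. g j * w j) (h i)"
      unfolding sol[symmetric] lookup_Const_mult ..
    also have "\<dots> = (\<Sum>j<n. \<Sum>t<K. Poly_Mapping.lookup (e j t) (h i) * Poly_Mapping.lookup (w j) (k t))"
      by (simp add: lookup_sum w_eq lookup_Const_mult) (simp only: mult.commute)
    also have "\<dots> = (\<Sum>b<n * K. A i b * x b)"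
      unfolding A_def x_def
      by (rule sum_div_mod[of "\<lambda>j t. Poly_Mapping.lookup (e j t) (h i) * Poly_Mapping.lookup (w j) (k t)", symmetric])
    finally show ?thesis .
  qed
  have "\<bar>real_of_int (A i b)\<bar> \<le> H" if "b < n * K" for i b
    unfolding A_def e_def using H that by (intro abs_lookup_mult_single_le) (auto simp: less_mult_imp_div_less)
  then obtain \<delta> x' where \<delta>: "\<delta> > 0" "real_of_int \<delta> \<le> (real M0 * H) ^ M0"
      "\<And>i. i < M0 \<Longrightarrow> \<delta> * Poly_Mapping.lookup f (h i) = (\<Sum>b<n * K. A i b * x' b)"
    using integer_solution_bound[of M0 "n * K" A H \<delta>0 "\<lambda>i. Poly_Mapping.lookup f (h i)" x] sol' \<open>\<delta>0 \<noteq> 0\<close> H(2)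
    by metis
  define w' where "w' j = (\<Sum>t<K. Poly_Mapping.single (k t) (x' (j * K + t)))" for j
  have bounded_w': "bounded_poly N B (w' j)" for j
    unfolding w'_def
  proof (rule F.filt_sum)
    fix t assume "t \<in> {..<K}"
    then have "k t \<in> monomials N B"
      using k by (auto simp: bij_betw_def)
    then show "bounded_poly N B (Poly_Mapping.single (k t) (x' (j * K + t)))"
      by (auto simp: monomials_def intro: bounded_single)
  qed
  show thesis
  proof (rule that[of \<delta> w'])
    show "\<delta> > 0"
      by fact
    have "M0 \<le> M" "1 \<le> M"
      using finite_card_monomials[of N "d + B"] by (simp_all add: M0_def M_def)
    have "1 * 1 \<le> real M * H"
      using \<open>1 \<le> M\<close> H(2) by (intro mult_mono) auto
    have "(real M0 * H) ^ M0 \<le> (real M * H) ^ M0"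
      using \<open>M0 \<le> M\<close> H(2) by (intro power_mono mult_right_mono) auto
    also have "\<dots> \<le> (real M * H) ^ M"
      using \<open>M0 \<le> M\<close> \<open>1 * 1 \<le> real M * H\<close> by (intro power_increasing) auto
    finally show "real_of_int \<delta> \<le> (real M * H) ^ M"
      using \<delta>(2) by simp
    show "bounded_poly N B (w' j)" if "j < n" for j
      by (rule bounded_w')
    show "Const \<delta> * f = (\<Sum>j<n. g j * w' j)"
    proof (rule poly_mapping_eqI)
      fix \<mu>
      show "Poly_Mapping.lookup (Const \<delta> * f) \<mu> = Poly_Mapping.lookup (\<Sum>j<n. g j * w' j) \<mu>"
      proof (cases "\<mu> \<in> monomials N (d + B)")
        case True
        then obtain i where i: "i < M0" "\<mu> = h i"
          using h by (auto simp: bij_betw_def)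
        have "g j * w' j = (\<Sum>t<K. Const (x' (j * K + t)) * e j t)" for j
          unfolding w'_def sum_distrib_left e_def by (intro sum.cong refl mult_single_eq)
        then have "Poly_Mapping.lookup (\<Sum>j<n. g j * w' j) \<mu> =
            (\<Sum>j<n. \<Sum>t<K. Poly_Mapping.lookup (e j t) (h i) * x' (j * K + t))"
          by (simp add: lookup_sum lookup_Const_mult i) (simp only: mult.commute)
        also have "\<dots> = (\<Sum>b<n * K. A i b * x' b)"
          unfolding A_def
          by (subst sum_div_mod[of "\<lambda>j t. Poly_Mapping.lookup (e j t) (h i) * x' (j * K + t)", symmetric])
            (simp only: div_mult_mod_eq)
        finally show ?thesis
          using \<delta>(3)[OF i(1)] by (simp add: lookup_Const_mult i)
      next
        case False
        have "bounded_poly N (d + B) (\<Sum>j<n. g j * w' j)"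
          by (intro F.filt_sum F.filt_mult g bounded_w') simp
        moreover have "bounded_poly N (d + B) (Const \<delta> * f)"
          by (rule F.filt_mono[OF F.filt_mult[of 0, OF _ f]]) auto
        ultimately show ?thesis
          using False by (simp add: lookup_eq_0_if_bounded)
      qed
    qed
  qed
qed

text \<open>\<open>k\<close> counts the primes removed, each at least 2. The given solution
  \<open>y\<close>, of arbitrary degree, is reused at every stage to correct the current
  \<open>w\<close> to an exact syzygy.\<close>

lemma clear_denominator:
  fixes f :: "int mpoly" and g y w :: "nat \<Rightarrow> int mpoly"
  assumes g: "\<And>j. j < n \<Longrightarrow> bounded_poly N d (g j)" and mem: "f = (\<Sum>j<n. g j * y j)"
    and "\<delta> > 0" and "Const \<delta> * f = (\<Sum>j<n. g j * w j)"
    and "\<And>j. j < n \<Longrightarrow> bounded_poly N D (w j)"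
  shows "\<exists>k w'. 2 ^ k \<le> \<delta> \<and> f = (\<Sum>j<n. g j * w' j) \<and> (\<forall>j<n. bounded_poly N (D + k * lift_degree N d 1) (w' j))"
  using assms(3-5)
proof (induction "nat \<delta>" arbitrary: \<delta> w D rule: less_induct)
  case less
  show ?case
  proof (cases "\<delta> = 1")
    case True
    then show ?thesis
      using less.prems by (intro exI[of _ 0] exI[of _ w]) simp
  next
    case False
    then obtain p where p: "prime p" "p dvd \<delta>"
      using prime_divisor_exists[of \<delta>] less.prems(1) by auto
    then obtain \<delta>' where \<delta>': "\<delta> = p * \<delta>'"
      by blast
    have "p \<ge> 2"
      using p(1) by (rule prime_ge_2_int)
    then have "\<delta>' > 0"
      using less.prems(1) by (simp add: \<delta>' zero_less_mult_iff)
    define v where "v j = w j - Const \<delta> * y j" for j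
    have ker: "(\<Sum>j<n. g j * v j) = 0"
    proof -
      have "(\<Sum>j<n. g j * v j) = (\<Sum>j<n. g j * w j) - Const \<delta> * (\<Sum>j<n. g j * y j)"
        by (simp add: v_def right_diff_distrib sum_subtractf sum_distrib_left mult_ac)
      then show ?thesis
        using less.prems(2) mem by simp
    qed
    have cong: "Const p dvd v j - w j" for j
      using p(2) by (auto simp: v_def Const_dvd_iff lookup_Const_mult)
    have "\<exists>z. (\<Sum>j<n. g j * z j) = 0 \<and> (\<forall>j<n. Const p dvd z j - w j) \<and>
        (\<forall>j<n. bounded_poly N (D + lift_degree N d 1) (z j))"
      by (rule syzygy_lift[OF prime_imp_prime_elem[OF p(1)] g ker cong less.prems(3)]) (assumption | blast)+
    then obtain z where z: "(\<Sum>j<n. g j * z j) = 0" "\<And>j. j < n \<Longrightarrow> Const p dvd z j - w j"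
        "\<And>j. j < n \<Longrightarrow> bounded_poly N (D + lift_degree N d 1) (z j)"
      by blast
    interpret F: ring_filtration "bounded_poly N :: nat \<Rightarrow> int mpoly \<Rightarrow> bool"
      by (rule ring_filtration_bounded)
    have "\<exists>w1. w j - z j = Const p * w1" if "j < n" for j
      using dvd_diff_swap[OF z(2)[OF that]] by (auto elim: dvdE)
    then obtain w1 where w1: "\<And>j. j < n \<Longrightarrow> w j - z j = Const p * w1 j"
      by metis
    have "p \<noteq> 0"
      using \<open>p \<ge> 2\<close> by simp
    have bounded_w1: "bounded_poly N (D + lift_degree N d 1) (w1 j)" if "j < n" for j
    proof (rule bounded_Const_mult_cancel[OF _ \<open>p \<noteq> 0\<close>])
      show "bounded_poly N (D + lift_degree N d 1) (Const p * w1 j)"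
        unfolding w1[OF that, symmetric]
        by (intro F.filt_diff z(3)[OF that] F.filt_mono[OF less.prems(3)[OF that]]) simp
    qed
    have "Const p * (Const \<delta>' * f) = Const p * (\<Sum>j<n. g j * w1 j)"
    proof -
      have "Const p * (\<Sum>j<n. g j * w1 j) = (\<Sum>j<n. g j * (w j - z j))"
        by (simp add: w1 sum_distrib_left mult.left_commute)
      also have "\<dots> = Const \<delta> * f"
        using z(1) less.prems(2) by (simp add: right_diff_distrib sum_subtractf)
      finally show ?thesis
        by (simp add: \<delta>' mult_single flip: mult.assoc)
    qed
    moreover have "Const p \<noteq> 0"
      using \<open>p \<noteq> 0\<close> by (metis lookup_single_eq lookup_zero)
    ultimately have "Const \<delta>' * f = (\<Sum>j<n. g j * w1 j)"
      by simp
    moreover have "nat \<delta>' < nat \<delta>"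
      using \<open>\<delta>' > 0\<close> \<open>p \<ge> 2\<close> by (simp add: \<delta>')
    ultimately obtain k w' where k: "2 ^ k \<le> \<delta>'" "f = (\<Sum>j<n. g j * w' j)"
        "\<forall>j<n. bounded_poly N (D + lift_degree N d 1 + k * lift_degree N d 1) (w' j)"
      using less.hyps[of \<delta>' w1 "D + lift_degree N d 1"] \<open>\<delta>' > 0\<close> bounded_w1 by blast
    have "2 * 2 ^ k \<le> p * \<delta>'"
      using k(1) \<open>p \<ge> 2\<close> by (intro mult_mono) auto
    then show ?thesis
      using k by (intro exI[of _ "Suc k"] exI[of _ w']) (simp add: \<delta>' add.assoc)
  qed
qed

section \<open>Numerical estimates\<close>

lemma lift_degree_le:
  assumes "d \<ge> 1" "m \<ge> 1"
  shows "lift_degree N d m + 2 * d * m \<le> (2 * d * m) ^ 2 ^ N"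
  using assms(2)
proof (induction N arbitrary: m)
  case (Suc N)
  define m' where "m' = m * (m * d + d)"
  have "1 \<le> m'"
    using Suc.prems assms(1) by (simp add: m'_def)
  have "m * d + d \<ge> 2"
    using Suc.prems assms(1) by (metis add_mono mult_le_mono nat_mult_1 one_add_one)
  then have "2 * m \<le> m'"
    by (simp add: m'_def mult.commute)
  \<comment> \<open>The extra summand \<open>2 * d * m\<close> in the claim makes the induction
    close: it absorbs the cost of the step because \<open>m'\<close> is at least
    \<open>2 * m\<close>. The exponent doubles since
    \<open>2 * d * m' \<le> (2 * d * m) ^ 2\<close>.\<close>
  then have "2 * (m * d) + 2 * d * m \<le> 2 * d * m'"
    using mult_le_mono2[of "2 * m" m' "2 * d"] by (simp add: mult_ac)
  then have "lift_degree (Suc N) d m + 2 * d * m \<le> lift_degree N d m' + 2 * d * m'"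
    by (simp add: m'_def)
  also have "\<dots> \<le> (2 * d * m') ^ 2 ^ N"
    by (rule Suc.IH) fact
  also have "2 * d * m' \<le> (2 * d * m) ^ 2"
  proof -
    have "d * m + d \<le> 2 * (d * m)"
      using Suc.prems by simp
    then have "(2 * d * m) * (d * m + d) \<le> (2 * d * m) * (2 * (d * m))"
      by (rule mult_le_mono2)
    then show ?thesis
      by (simp add: m'_def power2_eq_square mult_ac)
  qed
  then have "(2 * d * m') ^ 2 ^ N \<le> ((2 * d * m) ^ 2) ^ 2 ^ N"
    by (rule power_mono) simp
  also have "\<dots> = (2 * d * m) ^ 2 ^ Suc N"
    by (simp add: power_mult[symmetric] mult.commute)
  finally show ?case .
qed simp

text \<open>The summands on the left are the exponents of \<open>2 * d\<close> that bound the
  factors 3, \<open>B\<close> and \<open>M ^ 2\<close> in \<open>final_degree_le\<close>. They total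
  at most \<open>2 ^ (3 + 2 * N)\<close>, and \<open>3 + 2 * N \<le> 5 * N ^ 2\<close> is the origin
  of the constant 5.\<close>

lemma exponent_le:
  assumes "N \<ge> 1"
  shows "2 + 2 ^ N + 2 * (N * 2 ^ N) \<le> (2 :: nat) ^ (5 * N ^ 2)"
proof -
  have "N \<le> 2 ^ N"
    using less_exp[of N] by simp
  then have "N * 2 ^ N \<le> 2 ^ N * 2 ^ N"
    by (rule mult_le_mono1)
  moreover have "(2::nat) ^ N * 2 ^ N = 2 ^ (2 * N)" "(2::nat) ^ N \<le> 2 ^ (2 * N)" "(1::nat) \<le> 2 ^ (2 * N)"
    by (simp_all add: mult_2 flip: power_add)
  ultimately have "2 + 2 ^ N + 2 * (N * 2 ^ N) \<le> 8 * (2::nat) ^ (2 * N)"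
    by linarith
  also have "\<dots> = 2 ^ (3 + 2 * N)"
    by (simp add: power_add)
  also have "\<dots> \<le> 2 ^ (5 * N ^ 2)"
  proof (rule power_increasing)
    have "N \<le> N ^ 2"
      using assms by (simp add: power2_eq_square)
    then show "3 + 2 * N \<le> 5 * N ^ 2"
      using assms by linarith
  qed simp
  finally show ?thesis .
qed

text \<open>Logarithms bound \<open>k\<close> by a multiple of \<open>M ^ 2 * (h + 1)\<close>,
  linear in \<open>h\<close> because the coefficients are bounded by \<open>exp h\<close>. The crude
  \<open>ln M \<le> M\<close> is harmless: \<open>M\<close> itself is at most a power of
  \<open>2 * d\<close> with exponent \<open>N * 2 ^ N\<close>.\<close>

lemma final_degree_le:
  fixes h :: real
  assumes "N \<ge> 1" "d \<ge> 1" "h \<ge> 0"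
  defines "B \<equiv> lift_degree N d 1"
  defines "M \<equiv> (d + B + 1) ^ N"
  assumes "2 ^ k \<le> (real M * exp h) ^ M"
  shows "real (B + k * B) \<le> (2 * real d) powr (2 powr (5 * real N ^ 2)) * (h + 1)"
proof -
  define x where "x = 2 * d"
  have x: "x \<ge> 2"
    using assms(2) by (simp add: x_def)
  have B: "B + x \<le> x ^ 2 ^ N"
    using lift_degree_le[OF assms(2), of 1 N] by (simp add: B_def x_def)
  have "d + B + 1 \<le> x ^ 2 ^ N"
    using B assms(2) by (simp add: x_def)
  then have "M \<le> (x ^ 2 ^ N) ^ N"
    unfolding M_def by (rule power_mono) simp
  then have M: "M \<le> x ^ (N * 2 ^ N)"
    by (simp add: power_mult[symmetric] mult.commute)
  have M1: "1 \<le> M"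
    by (simp add: M_def)
  have "real k * ln 2 = ln (2 ^ k)"
    by (simp add: ln_realpow)
  also have "\<dots> \<le> ln ((real M * exp h) ^ M)"
    using assms(6) M1 by (subst ln_le_cancel_iff) auto
  also have "\<dots> = real M * (ln (real M) + h)"
    using M1 by (simp add: ln_realpow ln_mult)
  also have "\<dots> \<le> real M * (real M + real M * h)"
  proof (intro mult_left_mono add_mono)
    show "ln (real M) \<le> real M"
      using M1 ln_bound[of "real M"] by simp
    show "h \<le> real M * h"
      using M1 assms(3) mult_right_mono[of 1 "real M" h] by simp
  qed simp
  also have "\<dots> = real M ^ 2 * (h + 1)"
    by (simp add: power2_eq_square algebra_simps)
  finally have k_ln: "real k * ln 2 \<le> real M ^ 2 * (h + 1)" .
  have "real k * (1 / 2) \<le> real k * ln 2"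
    using ln2_ge_two_thirds by (intro mult_left_mono) auto
  then have k: "real k \<le> 2 * (real M ^ 2 * (h + 1))"
    using k_ln by simp
  have "1 * 1 \<le> real M ^ 2 * (h + 1)"
    using M1 assms(3) by (intro mult_mono) auto
  then have k1: "1 + real k \<le> 3 * (real M ^ 2 * (h + 1))"
    using k by simp
  have "real (B + k * B) = real B * (1 + real k)"
    by (simp add: algebra_simps)
  also have "\<dots> \<le> real B * (3 * (real M ^ 2 * (h + 1)))"
    by (rule mult_left_mono[OF k1]) simp
  also have "\<dots> = real (3 * B * M ^ 2) * (h + 1)"
    by simp
  also have "\<dots> \<le> real (x ^ (2 + 2 ^ N + 2 * (N * 2 ^ N))) * (h + 1)"
  proof (intro mult_right_mono of_nat_mono)
    have "3 \<le> x ^ 2"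
      using power_mono[OF x, of 2] by simp
    moreover have "B \<le> x ^ 2 ^ N"
      using B by simp
    moreover have "M ^ 2 \<le> x ^ (2 * (N * 2 ^ N))"
      using power_mono[OF M, of 2] by (simp add: power_mult[symmetric] mult.commute)
    ultimately have "3 * B * M ^ 2 \<le> x ^ 2 * x ^ 2 ^ N * x ^ (2 * (N * 2 ^ N))"
      by (intro mult_le_mono)
    then show "3 * B * M ^ 2 \<le> x ^ (2 + 2 ^ N + 2 * (N * 2 ^ N))"
      by (simp only: power_add)
  qed (use assms(3) in simp)
  also have "\<dots> \<le> real (x ^ 2 ^ (5 * N ^ 2)) * (h + 1)"
    using x assms(3) by (intro mult_right_mono of_nat_mono power_increasing exponent_le assms(1)) auto
  also have "real (x ^ 2 ^ (5 * N ^ 2)) = (2 * real d) powr (2 powr (5 * real N ^ 2))"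
  proof -
    have "2 powr (5 * real N ^ 2) = real (2 ^ (5 * N ^ 2))"
      using powr_realpow[of 2 "5 * N ^ 2"] by simp
    then show ?thesis
      using powr_realpow[of "2 * real d" "2 ^ (5 * N ^ 2)"] assms(2) by (simp add: x_def)
  qed
  finally show ?thesis .
qed

section \<open>The ring of integer polynomials\<close>

lemma finsum_int_mpoly_ring:
  assumes "finite I" "\<And>i. i \<in> I \<Longrightarrow> F i \<in> carrier (int_mpoly_ring N)"
  shows "(\<Oplus>\<^bsub>int_mpoly_ring N\<^esub>i\<in>I. F i) = sum F I"
proof -
  interpret cring "int_mpoly_ring N"
    by (rule cring_int_mpoly_ring)
  show ?thesis
    using assms by (induction I rule: finite_induct) (simp_all add: finsum_insert int_mpoly_ring_simps(4,5))
qed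

text \<open>The combinations form an ideal \<open>J\<close> that contains the generators, and the
  generated ideal is the least such.\<close>

lemma genideal_imp_combination:
  fixes f :: int_mpoly and g :: "nat \<Rightarrow> int_mpoly"
  assumes g: "\<And>i. i \<in> I \<Longrightarrow> g i \<in> carrier (int_mpoly_ring N)" and "finite I"
    and mem: "f \<in> Idl\<^bsub>int_mpoly_ring N\<^esub> (g ` I)"
  shows "\<exists>y. f = (\<Sum>i\<in>I. g i * y i)"
proof -
  let ?R = "int_mpoly_ring N"
  interpret R: cring ?R
    by (rule cring_int_mpoly_ring)
  define J where "J = {(\<Sum>i\<in>I. g i * y i) | y. \<forall>i. y i \<in> carrier ?R}"
  have closed: "x + y \<in> carrier ?R" "x * y \<in> carrier ?R" "0 \<in> carrier ?R" "1 \<in> carrier ?R" "- x \<in> carrier ?R"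
    if "x \<in> carrier ?R" "y \<in> carrier ?R" for x y :: int_mpoly
    using R.a_closed[OF that] R.m_closed[OF that] R.zero_closed R.one_closed that
    by (simp_all add: int_mpoly_ring_simps)
  have sum_closed: "(\<Sum>i\<in>I. g i * y i) \<in> carrier ?R" if "\<forall>i. y i \<in> carrier ?R" for y
    using R.finsum_closed[of "\<lambda>i. g i * y i" I] finsum_int_mpoly_ring[OF \<open>finite I\<close>, of "\<lambda>i. g i * y i" N] g that closed
    by (auto simp: Pi_def)
  have minus: "\<ominus>\<^bsub>?R\<^esub> x = - x" if "x \<in> carrier ?R" for x
    using that closed by (intro R.minus_equality) (auto simp: int_mpoly_ring_simps(4,5))
  have mult_J: "x * a \<in> J" if "a \<in> J" "x \<in> carrier ?R" for a x
  proof -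
    obtain y where y: "a = (\<Sum>i\<in>I. g i * y i)" "\<forall>i. y i \<in> carrier ?R"
      using \<open>a \<in> J\<close> by (auto simp: J_def)
    then have "x * a = (\<Sum>i\<in>I. g i * (x * y i))"
      by (simp add: sum_distrib_left mult.left_commute)
    then show ?thesis
      unfolding J_def mem_Collect_eq using y(2) that(2) closed(2)
      by (intro exI[of _ "\<lambda>i. x * y i"] conjI allI) auto
  qed
  have add_J: "a + b \<in> J" if "a \<in> J" "b \<in> J" for a b
  proof -
    obtain y where y: "a = (\<Sum>i\<in>I. g i * y i)" "\<forall>i. y i \<in> carrier ?R"
      using \<open>a \<in> J\<close> by (auto simp: J_def)
    obtain z where z: "b = (\<Sum>i\<in>I. g i * z i)" "\<forall>i. z i \<in> carrier ?R"
      using \<open>b \<in> J\<close> by (auto simp: J_def)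
    from y z have "a + b = (\<Sum>i\<in>I. g i * (y i + z i))"
      by (simp add: distrib_left sum.distrib)
    then show ?thesis
      unfolding J_def mem_Collect_eq using y(2) z(2) closed(1)
      by (intro exI[of _ "\<lambda>i. y i + z i"] conjI allI) auto
  qed
  have J_sub: "J \<subseteq> carrier ?R"
    using sum_closed by (auto simp: J_def)
  have "subgroup J (add_monoid ?R)"
  proof
    show "J \<subseteq> carrier (add_monoid ?R)"
      using J_sub by simp
    show "x \<otimes>\<^bsub>add_monoid ?R\<^esub> y \<in> J" if "x \<in> J" "y \<in> J" for x y
      using add_J[OF that] by (simp add: int_mpoly_ring_simps(5))
    have "(\<Sum>i\<in>I. g i * 0) \<in> J"
      unfolding J_def mem_Collect_eq using R.zero_closed
      by (intro exI[of _ "\<lambda>_. 0"] conjI allI) (auto simp: int_mpoly_ring_simps(4))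
    then show "\<one>\<^bsub>add_monoid ?R\<^esub> \<in> J"
      by (simp add: int_mpoly_ring_simps(4))
    show "inv\<^bsub>add_monoid ?R\<^esub> x \<in> J" if "x \<in> J" for x
    proof -
      have "- 1 * x \<in> J"
        using closed(4,5) that J_sub by (intro mult_J) auto
      then show ?thesis
        using minus[of x] that J_sub by (auto simp: a_inv_def)
    qed
  qed
  then have "ideal J ?R"
    using mult_J by (intro idealI) (auto simp: int_mpoly_ring_simps(2) mult.commute R.ring_axioms)
  moreover have "g ` I \<subseteq> J"
  proof
    fix a assume "a \<in> g ` I"
    then obtain i where i: "i \<in> I" "a = g i"
      by blast
    then have "a = (\<Sum>j\<in>I. g j * (if j = i then 1 else 0))"
      using \<open>finite I\<close> by (simp add: if_distrib sum.delta cong: if_cong)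
    then show "a \<in> J"
      using closed(3,4) g i unfolding J_def by (intro CollectI exI[of _ "\<lambda>j. if j = i then 1 else 0"]) auto
  qed
  ultimately have "Idl\<^bsub>?R\<^esub> (g ` I) \<subseteq> J"
    by (rule R.genideal_minimal)
  then show ?thesis
    using mem by (auto simp: J_def)
qed

section \<open>Translation to the degrees and heights of the theorem\<close>

lemma monomial_degree_eq_mdeg: "Poly_Mapping.keys m \<subseteq> {..<N} \<Longrightarrow> monomial_degree m = mdeg N m"
  unfolding monomial_degree_def mdeg_def by (rule sum.mono_neutral_left) (auto simp: in_keys_iff)

lemma carrier_total_degree_imp_bounded:
  assumes "f \<in> carrier (int_mpoly_ring N)" "total_degree f \<le> ereal (real d)"
  shows "bounded_poly N d f"
  unfolding bounded_poly_def
proof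
  fix m assume m: "m \<in> Poly_Mapping.keys f"
  then have "f \<noteq> 0"
    by auto
  then have "Max (monomial_degree ` Poly_Mapping.keys f) \<le> d"
    using assms(2) by (simp add: total_degree_def)
  moreover have "monomial_degree m \<le> Max (monomial_degree ` Poly_Mapping.keys f)"
    using m by (intro Max_ge) auto
  ultimately have "monomial_degree m \<le> d"
    by linarith
  then show "Poly_Mapping.keys m \<subseteq> {..<N} \<and> mdeg N m \<le> d"
    using assms(1) m by (auto simp: int_mpoly_ring_simps monomial_degree_eq_mdeg)
qed

lemma bounded_imp_carrier: "bounded_poly N D f \<Longrightarrow> f \<in> carrier (int_mpoly_ring N)"
  by (auto simp: bounded_poly_def int_mpoly_ring_simps)

lemma bounded_imp_total_degree_le:
  assumes "bounded_poly N D f" "real D \<le> b"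
  shows "total_degree f \<le> ereal b"
proof (cases "f = 0")
  case False
  then have "Max (monomial_degree ` Poly_Mapping.keys f) \<in> monomial_degree ` Poly_Mapping.keys f"
    by (intro Max_in) auto
  then obtain m where "m \<in> Poly_Mapping.keys f" "Max (monomial_degree ` Poly_Mapping.keys f) = monomial_degree m"
    by auto
  then have "Max (monomial_degree ` Poly_Mapping.keys f) \<le> D"
    using assms(1) by (auto simp: bounded_poly_def monomial_degree_eq_mdeg)
  then have "real (Max (monomial_degree ` Poly_Mapping.keys f)) \<le> b"
    using assms(2) by linarith
  then show ?thesis
    using False by (simp only: total_degree_def if_False ereal_less_eq)
qed (simp add: total_degree_def)

lemma abs_lookup_le_exp_height:
  assumes "height f \<le> h" "0 \<le> h"
  shows "\<bar>real_of_int (Poly_Mapping.lookup f m)\<bar> \<le> exp h"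
proof (cases "Poly_Mapping.lookup f m = 0")
  case False
  then have m: "m \<in> Poly_Mapping.keys f" "f \<noteq> 0"
    by (auto simp: in_keys_iff)
  have "ln \<bar>real_of_int (Poly_Mapping.lookup f m)\<bar> \<le>
      Max ((\<lambda>m. ln \<bar>real_of_int (Poly_Mapping.lookup f m)\<bar>) ` Poly_Mapping.keys f)"
    using m by (intro Max_ge) auto
  then have "ln \<bar>real_of_int (Poly_Mapping.lookup f m)\<bar> \<le> h"
    using m assms(1) by (simp add: height_def)
  then show ?thesis
    using False by (metis exp_ln exp_le_cancel_iff zero_less_abs_iff of_int_eq_0_iff)
qed simp

lemma bounded_constant:
  assumes "bounded_poly N d f" "N = 0 \<or> d = 0"
  shows "f = Const (Poly_Mapping.lookup f 0)"
proof (rule poly_mapping_eqI)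
  fix m
  have "m = 0" if "m \<in> Poly_Mapping.keys f"
  proof (rule poly_mapping_eqI)
    fix i
    have "Poly_Mapping.keys m \<subseteq> {..<N}" "N = 0 \<or> (\<forall>i<N. Poly_Mapping.lookup m i = 0)"
      using assms that by (auto simp: bounded_poly_def mdeg_def)
    then show "Poly_Mapping.lookup m i = Poly_Mapping.lookup 0 i"
      by (cases "i < N") (auto simp: in_keys_iff)
  qed
  then show "Poly_Mapping.lookup f m = Poly_Mapping.lookup (Const (Poly_Mapping.lookup f 0)) m"
    by (auto simp: lookup_single when_def in_keys_iff)
qed

lemma membership_degree_bound:
  fixes f :: int_mpoly and g y :: "nat \<Rightarrow> int_mpoly" and h :: real
  assumes f: "bounded_poly N d f" and g: "\<And>j. j < n \<Longrightarrow> bounded_poly N d (g j)"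
    and height: "\<And>j. j < n \<Longrightarrow> height (g j) \<le> h" "h \<ge> 0"
    and mem: "f = (\<Sum>j<n. g j * y j)"
  shows "\<exists>w D. f = (\<Sum>j<n. g j * w j) \<and> (\<forall>j<n. bounded_poly N D (w j)) \<and>
    real D \<le> (2 * real d) powr (2 powr (5 * real N ^ 2)) * (h + 1)"
proof (cases "N = 0 \<or> d = 0")
  case True
  \<comment> \<open>Here \<open>f\<close> and all \<open>g j\<close> are constants, so the constant
    terms of a given solution suffice. For \<open>d = 0\<close> degree 0 is forced, as
    \<open>0 powr x\<close> is 0 and the claimed bound vanishes; for \<open>N = 0\<close> the
    inequality of \<open>exponent_le\<close> would fail.\<close>
  define w :: "nat \<Rightarrow> int_mpoly" where "w j = Const (Poly_Mapping.lookup (y j) 0)" for j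
  have const: "g j = Const (Poly_Mapping.lookup (g j) 0)" if "j < n" for j
    by (rule bounded_constant[OF g[OF that] True])
  have lookup: "Poly_Mapping.lookup (g j * x) 0 = Poly_Mapping.lookup (g j) 0 * Poly_Mapping.lookup x 0"
    if "j < n" for j x
    by (subst const[OF that]) (rule lookup_Const_mult)
  have "f = Const (Poly_Mapping.lookup f 0)"
    by (rule bounded_constant[OF f True])
  also have "Poly_Mapping.lookup f 0 = (\<Sum>j<n. Poly_Mapping.lookup (g j) 0 * Poly_Mapping.lookup (y j) 0)"
    unfolding mem by (simp add: lookup_sum lookup)
  also have "Const \<dots> = (\<Sum>j<n. g j * w j)"
  proof -
    interpret C: comm_ring_hom "Const :: int \<Rightarrow> int_mpoly"
      by (rule comm_ring_hom_Const)
    show ?thesis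
      unfolding C.hom_sum C.hom_mult w_def by (rule sum.cong[OF refl]) (use const in simp)
  qed
  finally show ?thesis
    using height(2) by (intro exI[of _ w] exI[of _ 0]) (auto simp: w_def)
next
  case False
  then have Nd: "N \<ge> 1" "d \<ge> 1"
    by auto
  define B where "B = lift_degree N d 1"
  obtain \<delta>0 w0 where w0: "\<delta>0 \<noteq> 0" "\<And>j. j < n \<Longrightarrow> bounded_poly N B (w0 j)" "Const \<delta>0 * f = (\<Sum>j<n. g j * w0 j)"
    using rational_membership[OF f g mem] unfolding B_def by blast
  have "\<exists>\<delta> w1. \<delta> > 0 \<and> real_of_int \<delta> \<le> (real ((d + B + 1) ^ N) * exp h) ^ ((d + B + 1) ^ N) \<and>
      (\<forall>j<n. bounded_poly N B (w1 j)) \<and> Const \<delta> * f = (\<Sum>j<n. g j * w1 j)"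
    by (rule denominator_bound[OF f g abs_lookup_le_exp_height[OF height] _ w0])
      (assumption | simp add: height(2) | blast)+
  then obtain \<delta> w1 where \<delta>: "\<delta> > 0" "real_of_int \<delta> \<le> (real ((d + B + 1) ^ N) * exp h) ^ ((d + B + 1) ^ N)"
      "\<And>j. j < n \<Longrightarrow> bounded_poly N B (w1 j)" "Const \<delta> * f = (\<Sum>j<n. g j * w1 j)"
    by blast
  obtain k w where w: "2 ^ k \<le> \<delta>" "f = (\<Sum>j<n. g j * w j)" "\<forall>j<n. bounded_poly N (B + k * B) (w j)"
    using clear_denominator[OF g mem \<delta>(1,4,3)] unfolding B_def by blast
  have "(2::real) ^ k \<le> real_of_int \<delta>"
    using w(1) by (metis of_int_le_iff of_int_numeral of_int_power)
  then have "(2::real) ^ k \<le> (real ((d + B + 1) ^ N) * exp h) ^ ((d + B + 1) ^ N)"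
    using \<delta>(2) by (rule order_trans)
  then show ?thesis
    using final_degree_le[OF Nd height(2), of k] w unfolding B_def by blast
qed

theorem theoremA:
  shows "\<exists>c::real. c > 0 \<and>
    (\<forall>(N::nat) (n::nat) (d::nat) (h::real) (f :: nat \<Rightarrow> int_mpoly).
      h \<ge> 0 \<longrightarrow>
      (\<forall>i \<in> {0..n}. f i \<in> carrier (int_mpoly_ring N)
                 \<and> total_degree (f i) \<le> ereal (real d) \<and> height (f i) \<le> h) \<longrightarrow>
      f 0 \<in> Idl\<^bsub>int_mpoly_ring N\<^esub> (f ` {1..n}) \<longrightarrow>
      (\<exists>g :: nat \<Rightarrow> int_mpoly.
        (\<forall>i \<in> {1..n}. g i \<in> carrier (int_mpoly_ring N)
            \<and> total_degree (g i)
               \<le> ereal ((2 * real d) powr (2 powr (c * real N ^ 2)) * (h + 1))) \<and>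
        f 0 = (\<Oplus>\<^bsub>int_mpoly_ring N\<^esub>i \<in> {1..n}. g i \<otimes>\<^bsub>int_mpoly_ring N\<^esub> f i)))"
proof (rule exI[of _ 5], intro conjI allI impI)
  fix N n d :: nat and h :: real and f :: "nat \<Rightarrow> int_mpoly"
  assume h: "h \<ge> 0"
    and f: "\<forall>i \<in> {0..n}. f i \<in> carrier (int_mpoly_ring N)
                 \<and> total_degree (f i) \<le> ereal (real d) \<and> height (f i) \<le> h"
    and mem: "f 0 \<in> Idl\<^bsub>int_mpoly_ring N\<^esub> (f ` {1..n})"
  interpret R: cring "int_mpoly_ring N"
    by (rule cring_int_mpoly_ring)
  have bounded_f: "bounded_poly N d (f i)" if "i \<le> n" for i
    using f that by (intro carrier_total_degree_imp_bounded) auto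
  have shift: "(\<Sum>i\<in>{1..n}. F i) = (\<Sum>j<n. F (Suc j))" for F :: "nat \<Rightarrow> int_mpoly"
    by (simp add: sum.atLeast1_atMost_eq)
  obtain y where "f 0 = (\<Sum>i\<in>{1..n}. f i * y i)"
    using genideal_imp_combination[OF _ _ mem] f by auto
  then have mem': "f 0 = (\<Sum>j<n. f (Suc j) * y (Suc j))"
    by (simp only: shift)
  have "\<exists>w D. f 0 = (\<Sum>j<n. f (Suc j) * w j) \<and> (\<forall>j<n. bounded_poly N D (w j)) \<and>
      real D \<le> (2 * real d) powr (2 powr (5 * real N ^ 2)) * (h + 1)"
    by (rule membership_degree_bound[OF bounded_f bounded_f _ h mem']) (use f in auto)
  then obtain w D where w: "f 0 = (\<Sum>j<n. f (Suc j) * w j)" "\<forall>j<n. bounded_poly N D (w j)"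
      "real D \<le> (2 * real d) powr (2 powr (5 * real N ^ 2)) * (h + 1)"
    by blast
  define g where "g i = w (i - 1)" for i
  have g: "bounded_poly N D (g i)" if "i \<in> {1..n}" for i
    using w(2) that by (auto simp: g_def)
  have "(\<Oplus>\<^bsub>int_mpoly_ring N\<^esub>i \<in> {1..n}. g i \<otimes>\<^bsub>int_mpoly_ring N\<^esub> f i) = (\<Sum>i\<in>{1..n}. g i * f i)"
    using f bounded_imp_carrier[OF g] R.m_closed
    by (subst finsum_int_mpoly_ring) (auto simp: int_mpoly_ring_simps(2))
  also have "\<dots> = f 0"
    unfolding shift w(1) by (simp add: g_def mult.commute)
  finally show "\<exists>g :: nat \<Rightarrow> int_mpoly.
        (\<forall>i \<in> {1..n}. g i \<in> carrier (int_mpoly_ring N)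
            \<and> total_degree (g i)
               \<le> ereal ((2 * real d) powr (2 powr (5 * real N ^ 2)) * (h + 1))) \<and>
        f 0 = (\<Oplus>\<^bsub>int_mpoly_ring N\<^esub>i \<in> {1..n}. g i \<otimes>\<^bsub>int_mpoly_ring N\<^esub> f i)"
    using bounded_imp_carrier[OF g] bounded_imp_total_degree_le[OF g w(3)] by (intro exI[of _ g]) auto
qed simp

end
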